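(* Let $(B,A,\blacktriangleright,\partial)$ be a crossed module, $H$ the associated group object in the category $\mathrm{Cat}$ of small categories, and $\Sigma$ an oriented closed surface of genus $g\ge1$. The protected object for $H$ and $\Sigma$ is a groupoid $\mathcal M_{H,\Sigma}$ with - conjugacy classes of group homomorphisms $\rho:\pi_1(\Sigma)\to B$ as objects, - equivalence classes of group homomorphisms $\tau=(\phi,\rho):\pi_1(\Sigma)\to A\rtimes B$ as morphisms from $[\rho]$ to $[(\partial\circ\phi)\cdot\rho]$. The equivalence relation is given by $\tau_2\circ\tau_1\sim\tau_2'\circ\tau_1'$ for all composable pairs $(\tau_1,\tau_2)$ and $(\tau_1',\tau_2')$ of group homomorphisms $\tau_i,\tau_i':F_{2g}\to A\rtimes B$ such that $\tau_i$ and $\tau_i'$ are conjugate (for $i=1,2$) and $\tau_2\circ\tau_1$, $\tau_2'\circ\tau_1'$ define group homomorphisms $\pi_1(\Sigma)\to A\rtimes B$.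
   Context: Crossed modules. A crossed module $(B,A,\blacktriangleright,\partial)$ consists of groups $A,B$, a group homomorphism $\partial:A\to B$ and an action $\blacktriangleright:B\times A\to A$ by group automorphisms with $\partial(b\blacktriangleright a)=b\,\partial(a)\,b^{-1}$ and $\partial(a)\blacktriangleright a'=aa'a^{-1}$. The group $A\rtimes B$ has multiplication $(a',b')(a,b)=(a'(b'\blacktriangleright a),b'b)$. The associated group object $H$ in the cartesian monoidal category $(\mathrm{Cat},\times)$ is the category with $\mathrm{Ob}\,H=B$, $\mathrm{Hom}_H(b,b')=\{(a,b)\in A\times B\mid\partial(a)b=b'\}$, composition $(a',\partial(a)b)\circ(a,b)=(a'a,b)$, with group structure on objects that of $B$ and on morphisms that of $A\rtimes B$. Homomorphisms into $A\rtimes B$. For a group $K$, a group homomorphism $\tau:K\to A\rtimes B$ is the same as a pair $(\phi,\rho)$ of a group homomorphism $\rho:K\to B$ and a map $\phi:K\to A$ with $\phi(\lambda\mu)=\phi(\lambda)\cdot(\rho(\lambda)\blacktriangleright\phi(\mu))$. Then $(\partial\circ\phi)\cdot\rho$ (pointwise product) is a group homomorphism $K\to B$. Such $\tau$ are the morphisms $\rho\to(\partial\circ\phi)\cdot\rho$ of a groupoid with objects $\mathrm{Hom}(K,B)$ and composition $(\psi,(\partial\circ\phi)\cdot\rho)\circ(\phi,\rho)=(\psi\cdot\phi,\rho)$; "composable" and "$\circ$" in the equivalence relation refer to this groupoid for $K=F_{2g}$. Conjugacy of homomorphisms into $B$ is with respect to elements of $B$, and of homomorphisms into $A\rtimes B$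 with respect to elements of $A\rtimes B$. Here $\Sigma$ is connected with $\pi_1(\Sigma)=\langle\alpha_1,\beta_1,\dots,\alpha_g,\beta_g\mid[\beta_g^{-1},\alpha_g]\cdots[\beta_1^{-1},\alpha_1]=1\rangle$, $[x,y]=xyx^{-1}y^{-1}$, and $F_{2g}$ is the free group on the same generators. A homomorphism $F_{2g}\to A\rtimes B$ defines a homomorphism $\pi_1(\Sigma)\to A\rtimes B$ if it factors through the projection $F_{2g}\to\pi_1(\Sigma)$. Protected object. It is computed from the standard graph of $\Sigma$, which has one vertex, one face and edges $\alpha_1,\beta_1,\dots,\alpha_g,\beta_g$ given by the generators of $\pi_1(\Sigma)$ (other graphs embedded in $\Sigma$ whose complement is a disjoint union of discs yield isomorphic objects). Let $\mathcal M=H^{\times 2g}$ with the functors $\triangleright:H\times\mathcal M\to\mathcal M$, $h\triangleright(a_1,b_1,\dots,a_g,b_g)=(ha_1h^{-1},hb_1h^{-1},\dots,ha_gh^{-1},hb_gh^{-1})$ and $F:\mathcal M\to H$, $F(a_1,b_1,\dots,a_g,b_g)=[b_g^{-1},a_g]\cdots[b_1^{-1},a_1]$ (on objects and on morphisms). The coinvariants $\iota:\mathcal M^{coH}\to\mathcal M$ are the equaliser in $\mathrm{Cat}$ of the functors $\mathcal M\to H\times\mathcal M$ given by $x\mapsto(F(x),x)$ and $x\mapsto(e,x)$, where $e$ is the unit of $H$ (respectively its identity morphism $1_e$, on morphisms). The invariants $\pi:\mathcal M\to\mathcal M^H$ are the coequaliser in $\mathrm{Cat}$ of $\triangleright$ and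 the projection $H\times\mathcal M\to\mathcal M$. The protected object is the image of $\pi\circ\iota$: a category $\mathcal M_{inv}$ with a monomorphism $I:\mathcal M_{inv}\to\mathcal M^H$ and a functor $P:\mathcal M^{coH}\to\mathcal M_{inv}$ with $IP=\pi\iota$ such that for every monomorphism $J:X\to\mathcal M^H$ and functor $Q:\mathcal M^{coH}\to X$ with $JQ=\pi\iota$ there is a unique functor $v:\mathcal M_{inv}\to X$ with $I=Jv$.
   Formalization: The relation is generated by τ2∘τ1 ~ τ2'∘τ1' on all homomorphisms from F_2g and then restricted to those defining homomorphisms on π1(Σ); intermediate composites need not do so. Requiring this at each step gives a relation that is too fine in general. *)

theory Defs
  imports "HOL-Algebra.Algebra"
begin

section \<open>Small categories\<close>

record ('o, 'm) category =
  Ob :: "'o set"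
  Ar :: "'m set"
  Dom :: "'m \<Rightarrow> 'o"
  Cod :: "'m \<Rightarrow> 'o"
  Idn :: "'o \<Rightarrow> 'm"
  Comp :: "'m \<Rightarrow> 'm \<Rightarrow> 'm"  \<comment> \<open>\<open>Comp C f' f\<close> is \<open>f'\<close> after \<open>f\<close>\<close>

definition is_category :: "('o, 'm) category \<Rightarrow> bool" where
  "is_category C \<longleftrightarrow>
     (\<forall>f\<in>Ar C. Dom C f \<in> Ob C \<and> Cod C f \<in> Ob C) \<and>
     (\<forall>x\<in>Ob C. Idn C x \<in> Ar C \<and> Dom C (Idn C x) = x \<and> Cod C (Idn C x) = x) \<and>
     (\<forall>f\<in>Ar C. \<forall>f'\<in>Ar C. Cod C f = Dom C f' \<longrightarrow>
        Comp C f' f \<in> Ar C \<and> Dom C (Comp C f' f) = Dom C f \<and> Cod C (Comp C f' f) = Cod C f') \<and>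
     (\<forall>f\<in>Ar C. Comp C f (Idn C (Dom C f)) = f \<and> Comp C (Idn C (Cod C f)) f = f) \<and>
     (\<forall>f\<in>Ar C. \<forall>f'\<in>Ar C. \<forall>f''\<in>Ar C. Cod C f = Dom C f' \<longrightarrow> Cod C f' = Dom C f'' \<longrightarrow>
        Comp C f'' (Comp C f' f) = Comp C (Comp C f'' f') f)"

definition is_groupoid :: "('o, 'm) category \<Rightarrow> bool" where
  "is_groupoid C \<longleftrightarrow> is_category C \<and>
     (\<forall>f\<in>Ar C. \<exists>f'\<in>Ar C. Dom C f' = Cod C f \<and> Cod C f' = Dom C f \<and>
        Comp C f' f = Idn C (Dom C f) \<and> Comp C f f' = Idn C (Cod C f))"

record ('o, 'm, 'p, 'q) cfunctor =
  on_ob :: "'o \<Rightarrow> 'p"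
  on_ar :: "'m \<Rightarrow> 'q"

definition is_functor ::
  "('o, 'm) category \<Rightarrow> ('p, 'q) category \<Rightarrow> ('o, 'm, 'p, 'q) cfunctor \<Rightarrow> bool" where
  "is_functor C D F \<longleftrightarrow> is_category C \<and> is_category D \<and>
     (\<forall>x\<in>Ob C. on_ob F x \<in> Ob D) \<and>
     (\<forall>f\<in>Ar C. on_ar F f \<in> Ar D \<and>
        Dom D (on_ar F f) = on_ob F (Dom C f) \<and> Cod D (on_ar F f) = on_ob F (Cod C f)) \<and>
     (\<forall>x\<in>Ob C. on_ar F (Idn C x) = Idn D (on_ob F x)) \<and>
     (\<forall>f\<in>Ar C. \<forall>f'\<in>Ar C. Cod C f = Dom C f' \<longrightarrow>
        on_ar F (Comp C f' f) = Comp D (on_ar F f') (on_ar F f))"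

text \<open>Values of a functor outside the object and arrow sets of its source are irrelevant; equality of
  functors with source \<open>C\<close> is \<open>feq C\<close>.\<close>

definition feq ::
  "('o, 'm) category \<Rightarrow> ('o, 'm, 'p, 'q) cfunctor \<Rightarrow> ('o, 'm, 'p, 'q) cfunctor \<Rightarrow> bool" where
  "feq C F G \<longleftrightarrow> (\<forall>x\<in>Ob C. on_ob F x = on_ob G x) \<and> (\<forall>f\<in>Ar C. on_ar F f = on_ar G f)"

definition func_comp ::
  "('p, 'q, 'r, 's) cfunctor \<Rightarrow> ('o, 'm, 'p, 'q) cfunctor \<Rightarrow> ('o, 'm, 'r, 's) cfunctor" where
  "func_comp G F = \<lparr>on_ob = on_ob G \<circ> on_ob F, on_ar = on_ar G \<circ> on_ar F\<rparr>"

definition prod_cat :: "('o, 'm) category \<Rightarrow> ('p, 'q) category \<Rightarrow> ('o \<times> 'p, 'm \<times> 'q) category" where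
  "prod_cat C D = \<lparr>Ob = Ob C \<times> Ob D, Ar = Ar C \<times> Ar D,
     Dom = map_prod (Dom C) (Dom D), Cod = map_prod (Cod C) (Cod D),
     Idn = map_prod (Idn C) (Idn D),
     Comp = (\<lambda>(f', k') (f, k). (Comp C f' f, Comp D k' k))\<rparr>"

definition proj2 :: "('o \<times> 'p, 'm \<times> 'q, 'p, 'q) cfunctor" where
  "proj2 = \<lparr>on_ob = snd, on_ar = snd\<rparr>"

definition power_cat :: "'i set \<Rightarrow> ('o, 'm) category \<Rightarrow> ('i \<Rightarrow> 'o, 'i \<Rightarrow> 'm) category" where
  "power_cat S C = \<lparr>Ob = S \<rightarrow>\<^sub>E Ob C, Ar = S \<rightarrow>\<^sub>E Ar C,
     Dom = (\<lambda>f. \<lambda>i\<in>S. Dom C (f i)), Cod = (\<lambda>f. \<lambda>i\<in>S. Cod C (f i)),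
     Idn = (\<lambda>x. \<lambda>i\<in>S. Idn C (x i)),
     Comp = (\<lambda>f' f. \<lambda>i\<in>S. Comp C (f' i) (f i))\<rparr>"

text \<open>The universal properties below are those in the category of small categories. A type \<open>'u\<close>, given
  by a value of type \<open>'u itself\<close>, plays the role of the universe from which the objects and arrows of
  the test categories are taken.\<close>

definition is_mono :: "'u itself \<Rightarrow>
    ('o, 'm) category \<Rightarrow> ('p, 'q) category \<Rightarrow> ('o, 'm, 'p, 'q) cfunctor \<Rightarrow> bool" where
  "is_mono (_ :: 'u itself) C D J \<longleftrightarrow> is_functor C D J \<and>
     (\<forall>(Z :: ('u, 'u) category) U V.
        is_functor Z C U \<longrightarrow> is_functor Z C V \<longrightarrow> feq Z (func_comp J U) (func_comp J V) \<longrightarrow> feq Z U V)"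

definition is_equaliser :: "'u itself \<Rightarrow>
    ('p, 'q) category \<Rightarrow> ('r, 's) category \<Rightarrow>
    ('p, 'q, 'r, 's) cfunctor \<Rightarrow> ('p, 'q, 'r, 's) cfunctor \<Rightarrow>
    ('o, 'm) category \<Rightarrow> ('o, 'm, 'p, 'q) cfunctor \<Rightarrow> bool" where
  "is_equaliser (_ :: 'u itself) C D F G E \<iota> \<longleftrightarrow>
     is_functor C D F \<and> is_functor C D G \<and> is_functor E C \<iota> \<and>
     feq E (func_comp F \<iota>) (func_comp G \<iota>) \<and>
     (\<forall>(Z :: ('u, 'u) category) K.
        is_functor Z C K \<longrightarrow> feq Z (func_comp F K) (func_comp G K) \<longrightarrow>
        (\<exists>v. is_functor Z E v \<and> feq Z (func_comp \<iota> v) K \<and>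
           (\<forall>w. is_functor Z E w \<longrightarrow> feq Z (func_comp \<iota> w) K \<longrightarrow> feq Z w v)))"

definition is_coequaliser :: "'u itself \<Rightarrow>
    ('o, 'm) category \<Rightarrow> ('p, 'q) category \<Rightarrow>
    ('o, 'm, 'p, 'q) cfunctor \<Rightarrow> ('o, 'm, 'p, 'q) cfunctor \<Rightarrow>
    ('r, 's) category \<Rightarrow> ('p, 'q, 'r, 's) cfunctor \<Rightarrow> bool" where
  "is_coequaliser (_ :: 'u itself) C D F G Q \<pi> \<longleftrightarrow>
     is_functor C D F \<and> is_functor C D G \<and> is_functor D Q \<pi> \<and>
     feq C (func_comp \<pi> F) (func_comp \<pi> G) \<and>
     (\<forall>(Z :: ('u, 'u) category) K.
        is_functor D Z K \<longrightarrow> feq C (func_comp K F) (func_comp K G) \<longrightarrow>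
        (\<exists>v. is_functor Q Z v \<and> feq D (func_comp v \<pi>) K \<and>
           (\<forall>w. is_functor Q Z w \<longrightarrow> feq D (func_comp w \<pi>) K \<longrightarrow> feq Q w v)))"

text \<open>\<open>N\<close> with \<open>I : N \<rightarrow> D\<close> and \<open>P : C \<rightarrow> N\<close> is an image of \<open>K : C \<rightarrow> D\<close>.\<close>

definition is_image :: "'u itself \<Rightarrow>
    ('o, 'm) category \<Rightarrow> ('p, 'q) category \<Rightarrow> ('o, 'm, 'p, 'q) cfunctor \<Rightarrow>
    ('r, 's) category \<Rightarrow> ('r, 's, 'p, 'q) cfunctor \<Rightarrow> ('o, 'm, 'r, 's) cfunctor \<Rightarrow> bool" where
  "is_image (u :: 'u itself) C D K N I P \<longleftrightarrow>
     is_functor C D K \<and> is_mono u N D I \<and> is_functor C N P \<and> feq C (func_comp I P) K \<and>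
     (\<forall>(Z :: ('u, 'u) category) J Q.
        is_mono u Z D J \<longrightarrow> is_functor C Z Q \<longrightarrow> feq C (func_comp J Q) K \<longrightarrow>
        (\<exists>v. is_functor N Z v \<and> feq N I (func_comp J v) \<and>
           (\<forall>w. is_functor N Z w \<longrightarrow> feq N I (func_comp J w) \<longrightarrow> feq N w v)))"

text \<open>The smallest equivalence relation (on the whole type) containing \<open>r\<close>.\<close>

definition gen_equiv :: "('x \<times> 'x) set \<Rightarrow> ('x \<times> 'x) set" where
  "gen_equiv r = (r \<union> r\<inverse>)\<^sup>*"

text \<open>Structure induced on classes of objects and of arrows. The unions are over families of equal
  classes whenever the induced structure is well defined.\<close>

definition quot_cat ::
  "('o, 'm) category \<Rightarrow> ('o \<times> 'o) set \<Rightarrow> ('m \<times> 'm) set \<Rightarrow> ('o set, 'm set) category" where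
  "quot_cat C r s = \<lparr>Ob = Ob C // r, Ar = Ar C // s,
     Dom = (\<lambda>T. \<Union>f\<in>T. r `` {Dom C f}), Cod = (\<lambda>T. \<Union>f\<in>T. r `` {Cod C f}),
     Idn = (\<lambda>T. \<Union>x\<in>T. s `` {Idn C x}),
     Comp = (\<lambda>T' T. \<Union>f'\<in>T'. \<Union>f\<in>{f \<in> T. Cod C f = Dom C f'}. s `` {Comp C f' f})\<rparr>"

definition quot_functor ::
  "('o \<times> 'o) set \<Rightarrow> ('m \<times> 'm) set \<Rightarrow> ('o, 'm, 'o set, 'm set) cfunctor" where
  "quot_functor r s = \<lparr>on_ob = (\<lambda>x. r `` {x}), on_ar = (\<lambda>f. s `` {f})\<rparr>"

text \<open>All pairs \<open>(f\<^sub>2 \<circ> f\<^sub>1, f\<^sub>2' \<circ> f\<^sub>1')\<close> for composable pairs of arrows with \<open>f\<^sub>i\<close> related to \<open>f\<^sub>i'\<close> by \<open>s\<close>.\<close>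

definition comp_pairs :: "('o, 'm) category \<Rightarrow> ('m \<times> 'm) set \<Rightarrow> ('m \<times> 'm) set" where
  "comp_pairs C s = {(Comp C f2 f1, Comp C f2' f1') | f1 f2 f1' f2'.
     f1 \<in> Ar C \<and> f2 \<in> Ar C \<and> Cod C f1 = Dom C f2 \<and>
     f1' \<in> Ar C \<and> f2' \<in> Ar C \<and> Cod C f1' = Dom C f2' \<and>
     (f1, f1') \<in> s \<and> (f2, f2') \<in> s}"


section \<open>Free groups and surface groups\<close>

text \<open>Words are lists of letters \<open>(x, s)\<close>, where \<open>(x, True)\<close> stands for the generator \<open>x\<close> and
  \<open>(x, False)\<close> for its inverse.\<close>

definition word_rel :: "'x set \<Rightarrow> (('x \<times> bool) list \<times> ('x \<times> bool) list) set" where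
  "word_rel S = gen_equiv {(u @ [(x, s), (x, \<not> s)] @ v, u @ v) | u v x s.
     u \<in> lists (S \<times> UNIV) \<and> v \<in> lists (S \<times> UNIV) \<and> x \<in> S}"

definition free_group :: "'x set \<Rightarrow> ('x \<times> bool) list set monoid" where
  "free_group S = \<lparr>carrier = lists (S \<times> UNIV) // word_rel S,
     monoid.mult = (\<lambda>T T'. \<Union>u\<in>T. \<Union>v\<in>T'. word_rel S `` {u @ v}),
     one = word_rel S `` {[]}\<rparr>"

definition free_gen :: "'x set \<Rightarrow> 'x \<Rightarrow> ('x \<times> bool) list set" where
  "free_gen S x = word_rel S `` {[(x, True)]}"

datatype sgen = Alpha nat | Beta nat

definition sgens :: "nat \<Rightarrow> sgen set" where
  "sgens g = Alpha ` {1..g} \<union> Beta ` {1..g}"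

definition commutator :: "('k, 'z) monoid_scheme \<Rightarrow> 'k \<Rightarrow> 'k \<Rightarrow> 'k" where
  "commutator K x y = x \<otimes>\<^bsub>K\<^esub> y \<otimes>\<^bsub>K\<^esub> inv\<^bsub>K\<^esub> x \<otimes>\<^bsub>K\<^esub> inv\<^bsub>K\<^esub> y"

text \<open>\<open>surface_word K g x\<close> is \<open>[b\<^sub>g\<inverse>, a\<^sub>g] \<cdots> [b\<^sub>1\<inverse>, a\<^sub>1]\<close> for \<open>a\<^sub>i = x (Alpha i)\<close> and \<open>b\<^sub>i = x (Beta i)\<close>.\<close>

primrec surface_word :: "('k, 'z) monoid_scheme \<Rightarrow> nat \<Rightarrow> (sgen \<Rightarrow> 'k) \<Rightarrow> 'k" where
  "surface_word K 0 x = \<one>\<^bsub>K\<^esub>"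
| "surface_word K (Suc n) x =
     commutator K (inv\<^bsub>K\<^esub> (x (Beta (Suc n)))) (x (Alpha (Suc n))) \<otimes>\<^bsub>K\<^esub> surface_word K n x"

type_synonym fgrp = "(sgen \<times> bool) list set"

definition F2g :: "nat \<Rightarrow> fgrp monoid" where
  "F2g g = free_group (sgens g)"

definition relator_closure :: "nat \<Rightarrow> fgrp set" where
  "relator_closure g = \<Inter> {N. N \<lhd> F2g g \<and> surface_word (F2g g) g (free_gen (sgens g)) \<in> N}"

definition pi1 :: "nat \<Rightarrow> fgrp set monoid" where
  "pi1 g = F2g g Mod relator_closure g"

definition pi1_proj :: "nat \<Rightarrow> fgrp \<Rightarrow> fgrp set" where
  "pi1_proj g x = relator_closure g #>\<^bsub>F2g g\<^esub> x"

definition pi1_gen :: "nat \<Rightarrow> sgen \<Rightarrow> fgrp set" where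
  "pi1_gen g i = pi1_proj g (free_gen (sgens g) i)"

text \<open>Homomorphisms as extensional functions, so that equality of homomorphisms is equality in HOL.\<close>

definition Homs :: "('k, 'y) monoid_scheme \<Rightarrow> ('l, 'z) monoid_scheme \<Rightarrow> ('k \<Rightarrow> 'l) set" where
  "Homs K L = hom K L \<inter> extensional (carrier K)"

text \<open>The homomorphism on \<open>F2g g\<close> that defines a given homomorphism on \<open>pi1 g\<close>.\<close>

definition inflate :: "nat \<Rightarrow> (fgrp set \<Rightarrow> 'l) \<Rightarrow> (fgrp \<Rightarrow> 'l)" where
  "inflate g \<tau> = (\<lambda>x\<in>carrier (F2g g). \<tau> (pi1_proj g x))"

definition conj_fun :: "('l, 'z) monoid_scheme \<Rightarrow> 'i set \<Rightarrow> 'l \<Rightarrow> ('i \<Rightarrow> 'l) \<Rightarrow> ('i \<Rightarrow> 'l)" where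
  "conj_fun L S h x = (\<lambda>i\<in>S. h \<otimes>\<^bsub>L\<^esub> x i \<otimes>\<^bsub>L\<^esub> inv\<^bsub>L\<^esub> h)"

definition conjugacy ::
  "('k, 'y) monoid_scheme \<Rightarrow> ('l, 'z) monoid_scheme \<Rightarrow> (('k \<Rightarrow> 'l) \<times> ('k \<Rightarrow> 'l)) set" where
  "conjugacy K L = {(\<rho>, conj_fun L (carrier K) h \<rho>) | \<rho> h. \<rho> \<in> Homs K L \<and> h \<in> carrier L}"


section \<open>Crossed modules\<close>

text \<open>\<open>AutoGroup A\<close> is the library's group of automorphisms of \<open>A\<close>.\<close>

definition crossed_module :: "'b monoid \<Rightarrow> 'a monoid \<Rightarrow> ('b \<Rightarrow> 'a \<Rightarrow> 'a) \<Rightarrow> ('a \<Rightarrow> 'b) \<Rightarrow> bool" where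
  "crossed_module B A act d \<longleftrightarrow> group B \<and> group A \<and>
     d \<in> hom A B \<and> act \<in> hom B (AutoGroup A) \<and>
     (\<forall>b\<in>carrier B. \<forall>a\<in>carrier A. d (act b a) = b \<otimes>\<^bsub>B\<^esub> d a \<otimes>\<^bsub>B\<^esub> inv\<^bsub>B\<^esub> b) \<and>
     (\<forall>a\<in>carrier A. \<forall>a'\<in>carrier A. act (d a) a' = a \<otimes>\<^bsub>A\<^esub> a' \<otimes>\<^bsub>A\<^esub> inv\<^bsub>A\<^esub> a)"

definition semidirect :: "'b monoid \<Rightarrow> 'a monoid \<Rightarrow> ('b \<Rightarrow> 'a \<Rightarrow> 'a) \<Rightarrow> ('a \<times> 'b) monoid" where
  "semidirect B A act = \<lparr>carrier = carrier A \<times> carrier B,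
     monoid.mult = (\<lambda>(a', b') (a, b). (a' \<otimes>\<^bsub>A\<^esub> act b' a, b' \<otimes>\<^bsub>B\<^esub> b)),
     one = (\<one>\<^bsub>A\<^esub>, \<one>\<^bsub>B\<^esub>)\<rparr>"

text \<open>The category underlying the group object \<open>H\<close>. Its group structure is that of \<open>B\<close> on objects and
  that of \<open>semidirect B A act\<close> on arrows.\<close>

definition H_cat :: "'b monoid \<Rightarrow> 'a monoid \<Rightarrow> ('a \<Rightarrow> 'b) \<Rightarrow> ('b, 'a \<times> 'b) category" where
  "H_cat B A d = \<lparr>Ob = carrier B, Ar = carrier A \<times> carrier B,
     Dom = snd, Cod = (\<lambda>(a, b). d a \<otimes>\<^bsub>B\<^esub> b),
     Idn = (\<lambda>b. (\<one>\<^bsub>A\<^esub>, b)),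
     Comp = (\<lambda>(a', b') (a, b). (a' \<otimes>\<^bsub>A\<^esub> a, b))\<rparr>"

text \<open>The groupoid with objects \<open>Hom(K, B)\<close> and arrows \<open>\<tau> = (\<phi>, \<rho>) : \<rho> \<rightarrow> (d \<circ> \<phi>) \<cdot> \<rho>\<close> in
  \<open>Hom(K, semidirect B A act)\<close>, composed by \<open>(\<psi>, (d \<circ> \<phi>) \<cdot> \<rho>) \<circ> (\<phi>, \<rho>) = (\<psi> \<cdot> \<phi>, \<rho>)\<close>.\<close>

definition hom_cat :: "('k, 'z) monoid_scheme \<Rightarrow> 'b monoid \<Rightarrow> 'a monoid \<Rightarrow> ('b \<Rightarrow> 'a \<Rightarrow> 'a) \<Rightarrow>
    ('a \<Rightarrow> 'b) \<Rightarrow> ('k \<Rightarrow> 'b, 'k \<Rightarrow> 'a \<times> 'b) category" where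
  "hom_cat K B A act d = \<lparr>Ob = Homs K B, Ar = Homs K (semidirect B A act),
     Dom = (\<lambda>\<tau>. \<lambda>k\<in>carrier K. snd (\<tau> k)),
     Cod = (\<lambda>\<tau>. \<lambda>k\<in>carrier K. d (fst (\<tau> k)) \<otimes>\<^bsub>B\<^esub> snd (\<tau> k)),
     Idn = (\<lambda>\<rho>. \<lambda>k\<in>carrier K. (\<one>\<^bsub>A\<^esub>, \<rho> k)),
     Comp = (\<lambda>\<tau>' \<tau>. \<lambda>k\<in>carrier K. (fst (\<tau>' k) \<otimes>\<^bsub>A\<^esub> fst (\<tau> k), snd (\<tau> k)))\<rparr>"


section \<open>The protected object\<close>

definition M_cat :: "'b monoid \<Rightarrow> 'a monoid \<Rightarrow> ('a \<Rightarrow> 'b) \<Rightarrow> nat \<Rightarrow>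
    (sgen \<Rightarrow> 'b, sgen \<Rightarrow> 'a \<times> 'b) category" where
  "M_cat B A d g = power_cat (sgens g) (H_cat B A d)"

definition act_functor :: "'b monoid \<Rightarrow> 'a monoid \<Rightarrow> ('b \<Rightarrow> 'a \<Rightarrow> 'a) \<Rightarrow> nat \<Rightarrow>
    ('b \<times> (sgen \<Rightarrow> 'b), ('a \<times> 'b) \<times> (sgen \<Rightarrow> 'a \<times> 'b), sgen \<Rightarrow> 'b, sgen \<Rightarrow> 'a \<times> 'b) cfunctor" where
  "act_functor B A act g = \<lparr>on_ob = (\<lambda>(h, x). conj_fun B (sgens g) h x),
     on_ar = (\<lambda>(h, x). conj_fun (semidirect B A act) (sgens g) h x)\<rparr>"

text \<open>The functors \<open>x \<mapsto> (F x, x)\<close> and \<open>x \<mapsto> (e, x)\<close>.\<close>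

definition coact_functor :: "'b monoid \<Rightarrow> 'a monoid \<Rightarrow> ('b \<Rightarrow> 'a \<Rightarrow> 'a) \<Rightarrow> nat \<Rightarrow>
    (sgen \<Rightarrow> 'b, sgen \<Rightarrow> 'a \<times> 'b, 'b \<times> (sgen \<Rightarrow> 'b), ('a \<times> 'b) \<times> (sgen \<Rightarrow> 'a \<times> 'b)) cfunctor" where
  "coact_functor B A act g = \<lparr>on_ob = (\<lambda>x. (surface_word B g x, x)),
     on_ar = (\<lambda>x. (surface_word (semidirect B A act) g x, x))\<rparr>"

definition unit_functor :: "'b monoid \<Rightarrow> 'a monoid \<Rightarrow> ('a \<Rightarrow> 'b) \<Rightarrow>
    (sgen \<Rightarrow> 'b, sgen \<Rightarrow> 'a \<times> 'b, 'b \<times> (sgen \<Rightarrow> 'b), ('a \<times> 'b) \<times> (sgen \<Rightarrow> 'a \<times> 'b)) cfunctor" where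
  "unit_functor B A d = \<lparr>on_ob = (\<lambda>x. (\<one>\<^bsub>B\<^esub>, x)),
     on_ar = (\<lambda>x. (Idn (H_cat B A d) \<one>\<^bsub>B\<^esub>, x))\<rparr>"

text \<open>Concrete models of the coinvariants and of the invariants; that they have the universal
  properties of the equaliser and of the coequaliser is not part of their definition.\<close>

definition coinv_cat :: "'b monoid \<Rightarrow> 'a monoid \<Rightarrow> ('b \<Rightarrow> 'a \<Rightarrow> 'a) \<Rightarrow> ('a \<Rightarrow> 'b) \<Rightarrow> nat \<Rightarrow>
    (fgrp set \<Rightarrow> 'b, fgrp set \<Rightarrow> 'a \<times> 'b) category" where
  "coinv_cat B A act d g = hom_cat (pi1 g) B A act d"

definition coinv_incl :: "nat \<Rightarrow>
    (fgrp set \<Rightarrow> 'b, fgrp set \<Rightarrow> 'a \<times> 'b, sgen \<Rightarrow> 'b, sgen \<Rightarrow> 'a \<times> 'b) cfunctor" where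
  "coinv_incl g = \<lparr>on_ob = (\<lambda>\<rho>. \<lambda>i\<in>sgens g. \<rho> (pi1_gen g i)),
     on_ar = (\<lambda>\<tau>. \<lambda>i\<in>sgens g. \<tau> (pi1_gen g i))\<rparr>"

definition orbit_ob :: "'b monoid \<Rightarrow> 'a monoid \<Rightarrow> ('b \<Rightarrow> 'a \<Rightarrow> 'a) \<Rightarrow> ('a \<Rightarrow> 'b) \<Rightarrow> nat \<Rightarrow>
    ((sgen \<Rightarrow> 'b) \<times> (sgen \<Rightarrow> 'b)) set" where
  "orbit_ob B A act d g = {(x, on_ob (act_functor B A act g) (h, x)) | h x.
     h \<in> Ob (H_cat B A d) \<and> x \<in> Ob (M_cat B A d g)}"

definition orbit_ar :: "'b monoid \<Rightarrow> 'a monoid \<Rightarrow> ('b \<Rightarrow> 'a \<Rightarrow> 'a) \<Rightarrow> ('a \<Rightarrow> 'b) \<Rightarrow> nat \<Rightarrow>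
    ((sgen \<Rightarrow> 'a \<times> 'b) \<times> (sgen \<Rightarrow> 'a \<times> 'b)) set" where
  "orbit_ar B A act d g = {(x, on_ar (act_functor B A act g) (h, x)) | h x.
     h \<in> Ar (H_cat B A d) \<and> x \<in> Ar (M_cat B A d g)}"

definition inv_rel :: "'b monoid \<Rightarrow> 'a monoid \<Rightarrow> ('b \<Rightarrow> 'a \<Rightarrow> 'a) \<Rightarrow> ('a \<Rightarrow> 'b) \<Rightarrow> nat \<Rightarrow>
    ((sgen \<Rightarrow> 'a \<times> 'b) \<times> (sgen \<Rightarrow> 'a \<times> 'b)) set" where
  "inv_rel B A act d g = gen_equiv (comp_pairs (M_cat B A d g) (orbit_ar B A act d g))"

definition inv_cat :: "'b monoid \<Rightarrow> 'a monoid \<Rightarrow> ('b \<Rightarrow> 'a \<Rightarrow> 'a) \<Rightarrow> ('a \<Rightarrow> 'b) \<Rightarrow> nat \<Rightarrow>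
    ((sgen \<Rightarrow> 'b) set, (sgen \<Rightarrow> 'a \<times> 'b) set) category" where
  "inv_cat B A act d g =
     quot_cat (M_cat B A d g) (orbit_ob B A act d g) (inv_rel B A act d g)"

definition inv_proj :: "'b monoid \<Rightarrow> 'a monoid \<Rightarrow> ('b \<Rightarrow> 'a \<Rightarrow> 'a) \<Rightarrow> ('a \<Rightarrow> 'b) \<Rightarrow> nat \<Rightarrow>
    (sgen \<Rightarrow> 'b, sgen \<Rightarrow> 'a \<times> 'b, (sgen \<Rightarrow> 'b) set, (sgen \<Rightarrow> 'a \<times> 'b) set) cfunctor" where
  "inv_proj B A act d g = quot_functor (orbit_ob B A act d g) (inv_rel B A act d g)"

text \<open>The equivalence relation on \<open>Hom(pi1 g, semidirect B A act)\<close>: it is generated by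
  \<open>\<tau>\<^sub>2 \<circ> \<tau>\<^sub>1 \<sim> \<tau>\<^sub>2' \<circ> \<tau>\<^sub>1'\<close> for composable pairs of homomorphisms on \<open>F2g g\<close> with \<open>\<tau>\<^sub>i\<close> conjugate to \<open>\<tau>\<^sub>i'\<close>,
  and then restricted to the homomorphisms that factor through \<open>pi1 g\<close>. Only the two ends of a chain of
  such elementary steps have to factor through \<open>pi1 g\<close>. Imposing this on the intermediate homomorphisms
  as well gives a finer relation, which in general does not describe the arrows of the protected object.
  An example: \<open>g = 1\<close>, \<open>d\<close> trivial, \<open>R = \<int>[x\<^sup>\<plusminus>, y\<^sup>\<plusminus>]\<close> with augmentation ideal \<open>U = (x - 1, y - 1)\<close>,
  \<open>A = R\<^sup>2 \<oplus> U\<close>, and \<open>B = \<int>\<^sup>3\<close> with generators \<open>r, x, y\<close>, where \<open>x, y\<close> act by multiplication and \<open>r\<close> acts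
  by \<open>(p, q, u) \<mapsto> (p, q, u + (x - 1) p + (y - 1) q)\<close>. For \<open>\<rho>(\<alpha>\<^sub>1) = r\<close>, \<open>\<rho>(\<beta>\<^sub>1) = 1\<close>, the homomorphisms
  \<open>(\<phi>, \<rho>)\<close> with \<open>\<phi>(\<alpha>\<^sub>1) = 0\<close> and \<open>\<phi>(\<beta>\<^sub>1) = (y - 1, 1 - x, 0)\<close> or \<open>\<phi>(\<beta>\<^sub>1) = 0\<close> have the same image in
  the invariants, but are not related by the finer relation.\<close>

definition prot_rel :: "'b monoid \<Rightarrow> 'a monoid \<Rightarrow> ('b \<Rightarrow> 'a \<Rightarrow> 'a) \<Rightarrow> ('a \<Rightarrow> 'b) \<Rightarrow> nat \<Rightarrow>
    ((fgrp set \<Rightarrow> 'a \<times> 'b) \<times> (fgrp set \<Rightarrow> 'a \<times> 'b)) set" where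
  "prot_rel B A act d g = {(\<tau>, \<tau>').
     \<tau> \<in> Homs (pi1 g) (semidirect B A act) \<and> \<tau>' \<in> Homs (pi1 g) (semidirect B A act) \<and>
     (inflate g \<tau>, inflate g \<tau>') \<in>
       gen_equiv (comp_pairs (hom_cat (F2g g) B A act d) (conjugacy (F2g g) (semidirect B A act)))}"

definition prot_cat :: "'b monoid \<Rightarrow> 'a monoid \<Rightarrow> ('b \<Rightarrow> 'a \<Rightarrow> 'a) \<Rightarrow> ('a \<Rightarrow> 'b) \<Rightarrow> nat \<Rightarrow>
    ((fgrp set \<Rightarrow> 'b) set, (fgrp set \<Rightarrow> 'a \<times> 'b) set) category" where
  "prot_cat B A act d g =
     quot_cat (hom_cat (pi1 g) B A act d) (conjugacy (pi1 g) B) (prot_rel B A act d g)"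

definition prot_proj :: "'b monoid \<Rightarrow> 'a monoid \<Rightarrow> ('b \<Rightarrow> 'a \<Rightarrow> 'a) \<Rightarrow> ('a \<Rightarrow> 'b) \<Rightarrow> nat \<Rightarrow>
    (fgrp set \<Rightarrow> 'b, fgrp set \<Rightarrow> 'a \<times> 'b, (fgrp set \<Rightarrow> 'b) set, (fgrp set \<Rightarrow> 'a \<times> 'b) set) cfunctor" where
  "prot_proj B A act d g = quot_functor (conjugacy (pi1 g) B) (prot_rel B A act d g)"

end

(* Every arrow c : b -> e of H acts as the composite of the identity of b (or e) with c acting on
   identities. This makes the relation generated by f2 o f1 ~ f2' o f1' (fi' in the orbit of fi) a
   congruence, and since an orbit of arrows meets every source and target in the orbit of its own ones,
   the quotient of M by orbits is already a category: no formal paths are needed, and it is the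
   coequaliser. Homomorphisms out of a free group are tuples and those out of pi1 are the tuples on which
   the relator is trivial; together with the interchange law in A x B this gives the equaliser. The
   composite of the inclusion with the projection then has the prescribed kernel pair, and the quotient
   by that kernel pair is again a category, hence the image, because monomorphisms of categories are
   injective on objects and arrows. *)

theory Submission
  imports Defs
begin

section \<open>Generated equivalence relations\<close>

text \<open>The obstacle is composition. A generating pair changes the two factors of a composite by
  unrelated arrows of \<open>H\<close>. After composition with a further arrow there are three
  factors and three unrelated arrows of \<open>H\<close>, which no single generator relates. What
  helps is that the non-identity part of the middle one, \<open>c\<close> acting on identities, sits
  between the second and the third factor and may be absorbed into either; see
  \<open>orb_rel_triple\<close>. The second obstacle is that the image of a functor need not be
  closed under composition, because arrows whose endpoints agree only in the target may have no
  composable preimages. For the coinvariants this is repaired inside the homomorphisms out of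
  \<open>pi1 g\<close>: conjugation by an identity arrow of \<open>H\<close> preserves them and
  moves their source to any conjugate. The universal property of the image speaks of arbitrary
  monomorphisms. Their injectivity is detected by a test category with two objects and three arrows,
  and infinitude of \<open>'u\<close> provides room for it.\<close>

lemma equiv_gen_equiv: "equiv UNIV (gen_equiv R)"
  unfolding gen_equiv_def
  by (intro equivI refl_onI trans_rtrancl sym_rtrancl) (auto simp: sym_Un_converse)

lemma gen_equiv_base: "(x, y) \<in> R \<Longrightarrow> (x, y) \<in> gen_equiv R"
  by (auto simp: gen_equiv_def)

lemma gen_equiv_refl [simp]: "(x, x) \<in> gen_equiv R"
  by (auto simp: gen_equiv_def)

lemma gen_equiv_sym: "(x, y) \<in> gen_equiv R \<Longrightarrow> (y, x) \<in> gen_equiv R"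
  using equiv_gen_equiv[of R] by (auto elim: equivE dest: symD)

lemma gen_equiv_trans: "(x, y) \<in> gen_equiv R \<Longrightarrow> (y, z) \<in> gen_equiv R \<Longrightarrow> (x, z) \<in> gen_equiv R"
  using equiv_gen_equiv[of R] by (auto elim: equivE dest: transD)

lemma gen_equiv_induct [consumes 1, case_names refl step]:
  assumes "(x, y) \<in> gen_equiv R" "P x"
    and "\<And>y z. (x, y) \<in> gen_equiv R \<Longrightarrow> (y, z) \<in> R \<union> R\<inverse> \<Longrightarrow> P y \<Longrightarrow> P z"
  shows "P y"
  using assms(1)[unfolded gen_equiv_def] assms(2)
proof (induction rule: rtrancl_induct)
  case (step y z)
  with assms(3)[of y z] show ?case by (auto simp: gen_equiv_def)
qed

lemma gen_equiv_least:
  assumes "(x, y) \<in> gen_equiv R" "R \<subseteq> s" "\<And>x. (x, x) \<in> s" "sym s" "trans s"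
  shows "(x, y) \<in> s"
  using assms(1)
proof (induction rule: gen_equiv_induct)
  case (step y z)
  then have "(y, z) \<in> s" using assms(2,4) by (auto dest: symD)
  with step show ?case using assms(5) by (blast dest: transD)
qed (rule assms(3))

lemma gen_equiv_eq:
  assumes "(x, y) \<in> gen_equiv R" and "\<And>x y. (x, y) \<in> R \<Longrightarrow> f x = f y"
  shows "f x = f y"
  using gen_equiv_least[OF assms(1), of "{(x, y). f x = f y}"] assms(2)
  by (auto simp: sym_def trans_def)

lemma gen_equiv_map:
  assumes "(x, y) \<in> gen_equiv R" and "\<And>x y. (x, y) \<in> R \<Longrightarrow> (f x, f y) \<in> gen_equiv R'"
  shows "(f x, f y) \<in> gen_equiv R'"
proof -
  let ?s = "{(x, y). (f x, f y) \<in> gen_equiv R'}"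
  have "sym ?s" unfolding sym_def mem_Collect_eq prod.case by (iprover intro: gen_equiv_sym)
  moreover have "trans ?s"
    unfolding trans_def mem_Collect_eq prod.case by (iprover intro: gen_equiv_trans)
  ultimately have "(x, y) \<in> ?s"
    by (intro gen_equiv_least[OF assms(1), of ?s]) (use assms(2) in auto)
  then show ?thesis by simp
qed

lemma gen_equiv_closed:
  assumes "(x, y) \<in> gen_equiv R" "R \<subseteq> S \<times> S"
  shows "x \<in> S \<longleftrightarrow> y \<in> S"
  using gen_equiv_eq[OF assms(1), of "\<lambda>x. x \<in> S"] assms(2) by auto

text \<open>The relations are generated on whole types, whereas \<open>f\<close> is a bijection
  between \<open>S\<close> and \<open>S'\<close> only. As the generators are confined to these sets,
  every link of a chain can be pulled back along the inverse of \<open>f\<close>.\<close>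

lemma gen_equiv_bij_betw_iff:
  assumes f: "bij_betw f S S'" and R: "R \<subseteq> S \<times> S" "R' \<subseteq> S' \<times> S'"
    and iff: "\<And>x y. x \<in> S \<Longrightarrow> y \<in> S \<Longrightarrow> (x, y) \<in> R \<longleftrightarrow> (f x, f y) \<in> R'"
    and S: "x \<in> S" "y \<in> S"
  shows "(x, y) \<in> gen_equiv R \<longleftrightarrow> (f x, f y) \<in> gen_equiv R'"
proof
  assume "(x, y) \<in> gen_equiv R"
  then show "(f x, f y) \<in> gen_equiv R'"
    by (rule gen_equiv_map) (use R iff in \<open>blast intro: gen_equiv_base\<close>)
next
  let ?g = "inv_into S f"
  assume "(f x, f y) \<in> gen_equiv R'"
  then have "(?g (f x), ?g (f y)) \<in> gen_equiv R"
  proof (rule gen_equiv_map)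
    fix x' y' assume *: "(x', y') \<in> R'"
    then have "x' \<in> S'" "y' \<in> S'" using R by auto
    then have "?g x' \<in> S" "?g y' \<in> S" "f (?g x') = x'" "f (?g y') = y'"
      using f by (auto simp: bij_betw_def inv_into_into f_inv_into_f)
    with iff[of "?g x'" "?g y'"] * show "(?g x', ?g y') \<in> gen_equiv R"
      by (auto intro: gen_equiv_base)
  qed
  then show "(x, y) \<in> gen_equiv R" using f S by (simp add: bij_betw_def)
qed


section \<open>Categories and quotients\<close>

lemma is_categoryD:
  assumes "is_category C"
  shows cat_dom: "f \<in> Ar C \<Longrightarrow> Dom C f \<in> Ob C"
    and cat_cod: "f \<in> Ar C \<Longrightarrow> Cod C f \<in> Ob C"
    and cat_idn: "x \<in> Ob C \<Longrightarrow> Idn C x \<in> Ar C"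
    and cat_dom_idn: "x \<in> Ob C \<Longrightarrow> Dom C (Idn C x) = x"
    and cat_cod_idn: "x \<in> Ob C \<Longrightarrow> Cod C (Idn C x) = x"
    and cat_comp: "f \<in> Ar C \<Longrightarrow> f' \<in> Ar C \<Longrightarrow> Cod C f = Dom C f' \<Longrightarrow> Comp C f' f \<in> Ar C"
    and cat_dom_comp: "f \<in> Ar C \<Longrightarrow> f' \<in> Ar C \<Longrightarrow> Cod C f = Dom C f' \<Longrightarrow> Dom C (Comp C f' f) = Dom C f"
    and cat_cod_comp: "f \<in> Ar C \<Longrightarrow> f' \<in> Ar C \<Longrightarrow> Cod C f = Dom C f' \<Longrightarrow> Cod C (Comp C f' f) = Cod C f'"
    and cat_comp_idn: "f \<in> Ar C \<Longrightarrow> x = Dom C f \<Longrightarrow> Comp C f (Idn C x) = f"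
    and cat_idn_comp: "f \<in> Ar C \<Longrightarrow> x = Cod C f \<Longrightarrow> Comp C (Idn C x) f = f"
    and cat_assoc: "f \<in> Ar C \<Longrightarrow> f' \<in> Ar C \<Longrightarrow> f'' \<in> Ar C \<Longrightarrow> Cod C f = Dom C f' \<Longrightarrow>
      Cod C f' = Dom C f'' \<Longrightarrow> Comp C f'' (Comp C f' f) = Comp C (Comp C f'' f') f"
  using assms unfolding is_category_def by blast+

lemmas cat_simps = cat_dom cat_cod cat_idn cat_dom_idn cat_cod_idn cat_comp cat_dom_comp
  cat_cod_comp cat_comp_idn cat_idn_comp

lemma is_functorD:
  assumes "is_functor C D F"
  shows functor_source: "is_category C" and functor_target: "is_category D"
    and functor_ob: "x \<in> Ob C \<Longrightarrow> on_ob F x \<in> Ob D"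
    and functor_ar: "f \<in> Ar C \<Longrightarrow> on_ar F f \<in> Ar D"
    and functor_dom: "f \<in> Ar C \<Longrightarrow> Dom D (on_ar F f) = on_ob F (Dom C f)"
    and functor_cod: "f \<in> Ar C \<Longrightarrow> Cod D (on_ar F f) = on_ob F (Cod C f)"
    and functor_idn: "x \<in> Ob C \<Longrightarrow> on_ar F (Idn C x) = Idn D (on_ob F x)"
    and functor_comp: "f \<in> Ar C \<Longrightarrow> f' \<in> Ar C \<Longrightarrow> Cod C f = Dom C f' \<Longrightarrow>
      on_ar F (Comp C f' f) = Comp D (on_ar F f') (on_ar F f)"
  using assms unfolding is_functor_def by blast+

lemma is_functorI:
  assumes "is_category C" "is_category D"
    and "\<And>x. x \<in> Ob C \<Longrightarrow> on_ob F x \<in> Ob D"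
    and "\<And>f. f \<in> Ar C \<Longrightarrow> on_ar F f \<in> Ar D"
    and "\<And>f. f \<in> Ar C \<Longrightarrow> Dom D (on_ar F f) = on_ob F (Dom C f)"
    and "\<And>f. f \<in> Ar C \<Longrightarrow> Cod D (on_ar F f) = on_ob F (Cod C f)"
    and "\<And>x. x \<in> Ob C \<Longrightarrow> on_ar F (Idn C x) = Idn D (on_ob F x)"
    and "\<And>f f'. f \<in> Ar C \<Longrightarrow> f' \<in> Ar C \<Longrightarrow> Cod C f = Dom C f' \<Longrightarrow>
      on_ar F (Comp C f' f) = Comp D (on_ar F f') (on_ar F f)"
  shows "is_functor C D F"
  using assms unfolding is_functor_def by blast

lemma func_comp_simps [simp]:
  "on_ob (func_comp G F) x = on_ob G (on_ob F x)"
  "on_ar (func_comp G F) f = on_ar G (on_ar F f)"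
  by (simp_all add: func_comp_def)

lemma is_functor_func_comp:
  assumes F: "is_functor C D F" and G: "is_functor D E G"
  shows "is_functor C E (func_comp G F)"
  using functor_source[OF F] functor_target[OF G]
  by (rule is_functorI)
    (simp_all add: functor_ob[OF F] functor_ob[OF G] functor_ar[OF F] functor_ar[OF G]
      functor_dom[OF F] functor_dom[OF G] functor_cod[OF F] functor_cod[OF G]
      functor_idn[OF F] functor_idn[OF G] functor_comp[OF F] functor_comp[OF G])

lemma is_groupoid_inverse:
  assumes "is_groupoid C" "f \<in> Ar C"
  obtains f' where "f' \<in> Ar C" "Dom C f' = Cod C f" "Cod C f' = Dom C f"
    "Comp C f' f = Idn C (Dom C f)" "Comp C f f' = Idn C (Cod C f)"
  using assms unfolding is_groupoid_def by blast

lemma is_category_prod_cat: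
  assumes "is_category C" "is_category D"
  shows "is_category (prod_cat C D)"
  using assms unfolding is_category_def prod_cat_def by (auto simp: map_prod_def)

lemma is_functor_proj2:
  assumes "is_category C" "is_category D"
  shows "is_functor (prod_cat C D) D proj2"
  using assms(2) is_category_prod_cat[OF assms]
  by (intro is_functorI) (auto simp: proj2_def prod_cat_def)

text \<open>The last assumption makes every two arrow classes with matching object classes composable
  without passing to formal paths.\<close>

locale cat_congruence =
  fixes C :: "('o, 'm) category" and r :: "('o \<times> 'o) set" and s :: "('m \<times> 'm) set"
  assumes cat: "is_category C"
    and r_equiv: "equiv (Ob C) r"
    and s_refl: "f \<in> Ar C \<Longrightarrow> (f, f) \<in> s"
    and s_sym: "(f, f') \<in> s \<Longrightarrow> (f', f) \<in> s"
    and s_trans: "(f, f') \<in> s \<Longrightarrow> (f', f'') \<in> s \<Longrightarrow> (f, f'') \<in> s"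
    and s_closed: "(f, f') \<in> s \<Longrightarrow> f \<in> Ar C \<Longrightarrow> f' \<in> Ar C"
    and s_dom: "(f, f') \<in> s \<Longrightarrow> f \<in> Ar C \<Longrightarrow> (Dom C f, Dom C f') \<in> r"
    and s_cod: "(f, f') \<in> s \<Longrightarrow> f \<in> Ar C \<Longrightarrow> (Cod C f, Cod C f') \<in> r"
    and s_idn: "(x, x') \<in> r \<Longrightarrow> (Idn C x, Idn C x') \<in> s"
    and s_comp: "(h, h') \<in> s \<Longrightarrow> (f, f') \<in> s \<Longrightarrow> h \<in> Ar C \<Longrightarrow> f \<in> Ar C \<Longrightarrow>
      Cod C f = Dom C h \<Longrightarrow> Cod C f' = Dom C h' \<Longrightarrow> (Comp C h f, Comp C h' f') \<in> s"
    and s_lift: "f \<in> Ar C \<Longrightarrow> h \<in> Ar C \<Longrightarrow> (Cod C f, Dom C h) \<in> r \<Longrightarrow>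
      \<exists>h'. (h, h') \<in> s \<and> Dom C h' = Cod C f"
begin

abbreviation "Q \<equiv> quot_cat C r s"

lemmas C_simps = cat_simps[OF cat]

lemma r_refl: "x \<in> Ob C \<Longrightarrow> (x, x) \<in> r"
  using r_equiv by (meson equivE refl_onD)

text \<open>The relation \<open>s\<close> is not assumed to lie in
  \<open>Ar C \<times> Ar C\<close>, since \<open>gen_equiv\<close> relates every element of its
  type to itself. What is available is that \<open>s\<close> does not lead out of
  \<open>Ar C\<close>.\<close>

lemma s_class_eq_iff: "f \<in> Ar C \<Longrightarrow> s `` {f} = s `` {f'} \<longleftrightarrow> (f, f') \<in> s"
  using s_refl s_sym s_trans s_closed by blast

lemma r_class_eq_iff: "x \<in> Ob C \<Longrightarrow> y \<in> Ob C \<Longrightarrow> r `` {x} = r `` {y} \<longleftrightarrow> (x, y) \<in> r"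
  using r_equiv by (simp add: eq_equiv_class_iff)

lemma r_class_eq: "(x, y) \<in> r \<Longrightarrow> r `` {x} = r `` {y}"
  using r_equiv by (simp add: equiv_class_eq)

lemma quot_Dom: "f \<in> Ar C \<Longrightarrow> Dom Q (s `` {f}) = r `` {Dom C f}"
  unfolding quot_cat_def using s_refl s_dom r_class_eq by auto blast

lemma quot_Cod: "f \<in> Ar C \<Longrightarrow> Cod Q (s `` {f}) = r `` {Cod C f}"
  unfolding quot_cat_def using s_refl s_cod r_class_eq by auto blast

lemma quot_Idn:
  assumes "x \<in> Ob C"
  shows "Idn Q (r `` {x}) = s `` {Idn C x}"
proof -
  have "s `` {Idn C x'} = s `` {Idn C x}" if "(x, x') \<in> r" for x'
    using s_idn[OF that] s_class_eq_iff assms C_simps by blast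
  then have "(\<Union>x'\<in>r `` {x}. s `` {Idn C x'}) = (\<Union>x'\<in>r `` {x}. s `` {Idn C x})"
    by (intro SUP_cong) auto
  with r_refl[OF assms] show ?thesis by (auto simp: quot_cat_def)
qed

text \<open>The union that defines the composite runs over all composable representatives. By
  \<open>s_comp\<close> each of them contributes the same class, and \<open>h\<close>,
  \<open>f\<close> themselves show that the union is over a nonempty family.\<close>

lemma quot_Comp:
  assumes "f \<in> Ar C" "h \<in> Ar C" "Cod C f = Dom C h"
  shows "Comp Q (s `` {h}) (s `` {f}) = s `` {Comp C h f}"
proof -
  have *: "s `` {Comp C h' f'} = s `` {Comp C h f}"
    if "(h, h') \<in> s" "(f, f') \<in> s" "Cod C f' = Dom C h'" for h' f'
    using s_comp[OF that(1,2)] that(3) assms s_class_eq_iff C_simps by blast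
  show ?thesis
    unfolding quot_cat_def category.simps
  proof (intro equalityI subsetI)
    fix t assume "t \<in> (\<Union>f'\<in>s `` {h}. \<Union>k\<in>{k \<in> s `` {f}. Cod C k = Dom C f'}. s `` {Comp C f' k})"
    then obtain h' f' where hf: "(h, h') \<in> s" "(f, f') \<in> s" "Cod C f' = Dom C h'"
      and t: "t \<in> s `` {Comp C h' f'}"
      by auto
    from t show "t \<in> s `` {Comp C h f}" unfolding *[OF hf] .
  qed (use assms s_refl in blast)
qed

lemma quot_Ob: "Ob Q = Ob C // r" and quot_Ar: "Ar Q = Ar C // s"
  by (simp_all add: quot_cat_def)

lemma quot_ArE:
  assumes "T \<in> Ar Q"
  obtains f where "f \<in> Ar C" "T = s `` {f}"
  using assms by (auto simp: quot_Ar elim: quotientE)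

lemma quot_ObE:
  assumes "Y \<in> Ob Q"
  obtains x where "x \<in> Ob C" "Y = r `` {x}"
  using assms by (auto simp: quot_Ob elim: quotientE)

text \<open>Here \<open>s_lift\<close> enters: the representative \<open>f\<close> of
  \<open>T\<close> is kept, and that of \<open>T'\<close> is moved along \<open>s\<close> until it
  starts where \<open>f\<close> ends. Applied repeatedly, it yields composable representatives of
  longer chains of classes, as associativity requires.\<close>

lemma quot_composableE:
  assumes "T \<in> Ar Q" "T' \<in> Ar Q" "Cod Q T = Dom Q T'" "f \<in> Ar C" "T = s `` {f}"
  obtains f' where "f' \<in> Ar C" "T' = s `` {f'}" "Cod C f = Dom C f'"
proof -
  from assms(2) obtain h where h: "h \<in> Ar C" "T' = s `` {h}" by (elim quot_ArE)
  with assms have "(Cod C f, Dom C h) \<in> r"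
    by (simp add: quot_Cod quot_Dom r_class_eq_iff C_simps)
  with s_lift assms h obtain h' where "(h, h') \<in> s" "Dom C h' = Cod C f" by blast
  with h s_closed s_class_eq_iff that show ?thesis by metis
qed

lemma quot_in_Ob: "x \<in> Ob C \<Longrightarrow> r `` {x} \<in> Ob Q"
  and quot_in_Ar: "f \<in> Ar C \<Longrightarrow> s `` {f} \<in> Ar Q"
  by (simp_all add: quot_Ob quot_Ar quotientI)

lemmas quot_simps = quot_in_Ob quot_in_Ar quot_Dom quot_Cod quot_Idn quot_Comp

lemma is_category_quot: "is_category Q"
  unfolding is_category_def
proof (intro conjI ballI impI)
  fix T assume "T \<in> Ar Q"
  then obtain f where f: "f \<in> Ar C" "T = s `` {f}" by (elim quot_ArE)
  then show "Dom Q T \<in> Ob Q" "Cod Q T \<in> Ob Q"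
    "Comp Q T (Idn Q (Dom Q T)) = T" "Comp Q (Idn Q (Cod Q T)) T = T"
    by (simp_all add: quot_simps C_simps)
  fix T' assume T': "T' \<in> Ar Q" "Cod Q T = Dom Q T'"
  obtain f' where f': "f' \<in> Ar C" "T' = s `` {f'}" "Cod C f = Dom C f'"
    by (rule quot_composableE[OF \<open>T \<in> Ar Q\<close> T' f])
  with f show "Comp Q T' T \<in> Ar Q" "Dom Q (Comp Q T' T) = Dom Q T" "Cod Q (Comp Q T' T) = Cod Q T'"
    by (simp_all add: quot_simps C_simps)
  fix T'' assume T'': "T'' \<in> Ar Q" "Cod Q T' = Dom Q T''"
  obtain f'' where f'': "f'' \<in> Ar C" "T'' = s `` {f''}" "Cod C f' = Dom C f''"
    by (rule quot_composableE[OF T'(1) T'' f'(1,2)])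
  with f f' show "Comp Q T'' (Comp Q T' T) = Comp Q (Comp Q T'' T') T"
    by (simp add: quot_simps C_simps cat_assoc[OF cat])
next
  fix Y assume "Y \<in> Ob Q"
  then obtain x where "x \<in> Ob C" "Y = r `` {x}" by (elim quot_ObE)
  then show "Idn Q Y \<in> Ar Q" "Dom Q (Idn Q Y) = Y" "Cod Q (Idn Q Y) = Y"
    by (simp_all add: quot_simps C_simps)
qed

lemma is_groupoid_quot:
  assumes "is_groupoid C"
  shows "is_groupoid Q"
  unfolding is_groupoid_def
proof (intro conjI ballI is_category_quot)
  fix T assume "T \<in> Ar Q"
  then obtain f where f: "f \<in> Ar C" "T = s `` {f}" by (elim quot_ArE)
  obtain f' where f': "f' \<in> Ar C" "Dom C f' = Cod C f" "Cod C f' = Dom C f"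
    "Comp C f' f = Idn C (Dom C f)" "Comp C f f' = Idn C (Cod C f)"
    using is_groupoid_inverse[OF assms f(1)] .
  show "\<exists>T'\<in>Ar Q. Dom Q T' = Cod Q T \<and> Cod Q T' = Dom Q T \<and>
      Comp Q T' T = Idn Q (Dom Q T) \<and> Comp Q T T' = Idn Q (Cod Q T)"
    using f f' by (intro bexI[of _ "s `` {f'}"]) (simp_all add: quot_simps C_simps)
qed

lemma is_functor_quot_functor: "is_functor C Q (quot_functor r s)"
  using cat is_category_quot
  by (rule is_functorI) (simp_all add: quot_functor_def quot_simps C_simps)

text \<open>The quotient functor is surjective on objects and on arrows, hence right
  cancellable.\<close>

lemma quot_functor_cancel:
  assumes "feq C (func_comp v (quot_functor r s)) (func_comp w (quot_functor r s))"
  shows "feq Q v w"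
  using assms unfolding feq_def
  by (auto simp: quot_functor_def elim!: quot_ArE quot_ObE)

lemma quot_functor_universal:
  fixes Z :: "('p, 'q) category"
  assumes K: "is_functor C Z K"
    and r: "\<And>x y. (x, y) \<in> r \<Longrightarrow> on_ob K x = on_ob K y"
    and s: "\<And>f h. f \<in> Ar C \<Longrightarrow> (f, h) \<in> s \<Longrightarrow> on_ar K f = on_ar K h"
  shows "\<exists>v. is_functor Q Z v \<and> feq C (func_comp v (quot_functor r s)) K"
proof -
  \<comment> \<open>The functor is evaluated at a chosen member of each class; by the two
    compatibility assumptions the choice does not affect the value.\<close>
  define v where "v = \<lparr>on_ob = (\<lambda>Y. on_ob K (SOME x. x \<in> Y)), on_ar = (\<lambda>T. on_ar K (SOME f. f \<in> T))\<rparr>"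
  have ob: "on_ob v (r `` {x}) = on_ob K x" if "x \<in> Ob C" for x
  proof -
    have "(x, SOME y. y \<in> r `` {x}) \<in> r"
      using someI[of "\<lambda>y. y \<in> r `` {x}" x] r_refl[OF that] by simp
    from r[OF this] show ?thesis by (simp add: v_def)
  qed
  have ar: "on_ar v (s `` {f}) = on_ar K f" if "f \<in> Ar C" for f
  proof -
    have "(f, SOME h. h \<in> s `` {f}) \<in> s"
      using someI[of "\<lambda>h. h \<in> s `` {f}" f] s_refl[OF that] by simp
    from s[OF that this] show ?thesis by (simp add: v_def)
  qed
  note K_simps = functor_ob[OF K] functor_ar[OF K] functor_dom[OF K] functor_cod[OF K]
    functor_idn[OF K] functor_comp[OF K]
  have "is_functor Q Z v"
    using is_category_quot functor_target[OF K]
  proof (rule is_functorI)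
    fix T T' assume T: "T \<in> Ar Q" "T' \<in> Ar Q" "Cod Q T = Dom Q T'"
    from T(1) obtain f where f: "f \<in> Ar C" "T = s `` {f}" by (elim quot_ArE)
    obtain f' where "f' \<in> Ar C" "T' = s `` {f'}" "Cod C f = Dom C f'"
      by (rule quot_composableE[OF T f])
    with f show "on_ar v (Comp Q T' T) = Comp Z (on_ar v T') (on_ar v T)"
      by (simp add: quot_simps ar K_simps C_simps)
  qed (auto elim!: quot_ArE quot_ObE simp: ob ar quot_simps K_simps C_simps)
  moreover have "feq C (func_comp v (quot_functor r s)) K"
    by (simp add: feq_def quot_functor_def ob ar)
  ultimately show ?thesis by blast
qed

end


section \<open>Monomorphisms and images\<close>

lemma is_mono_inj:
  assumes "is_functor C D J" "inj_on (on_ob J) (Ob C)" "inj_on (on_ar J) (Ar C)"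
  shows "is_mono TYPE('u) C D J"
  unfolding is_mono_def
proof (intro conjI allI impI assms(1))
  fix Z :: "('u, 'u) category" and U V
  assume UV: "is_functor Z C U" "is_functor Z C V" and eq: "feq Z (func_comp J U) (func_comp J V)"
  show "feq Z U V"
    unfolding feq_def
  proof (intro conjI ballI)
    fix x assume "x \<in> Ob Z"
    with eq show "on_ob U x = on_ob V x"
      by (intro inj_onD[OF assms(2)]) (simp_all add: feq_def functor_ob[OF UV(1)] functor_ob[OF UV(2)])
  next
    fix f assume "f \<in> Ar Z"
    with eq show "on_ar U f = on_ar V f"
      by (intro inj_onD[OF assms(3)]) (simp_all add: feq_def functor_ar[OF UV(1)] functor_ar[OF UV(2)])
  qed
qed

text \<open>The test category is the arrow category \<open>a \<rightarrow> b\<close>; the non-identity arrow is \<open>c\<close>.\<close>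

lemma is_mono_inj_on_ar:
  fixes C :: "('o, 'm) category"
  assumes inf: "infinite (UNIV :: 'u set)" and mono: "is_mono TYPE('u) C D J"
  shows "inj_on (on_ar J) (Ar C)"
proof (rule inj_onI)
  fix f f' assume f: "f \<in> Ar C" "f' \<in> Ar C" "on_ar J f = on_ar J f'"
  obtain a :: 'u where True by simp
  obtain b :: 'u where b: "b \<noteq> a" using ex_new_if_finite[OF inf, of "{a}"] by auto
  obtain c :: 'u where c: "c \<noteq> a" "c \<noteq> b" using ex_new_if_finite[OF inf, of "{a, b}"] by auto
  \<comment> \<open>The elements \<open>a\<close> and \<open>b\<close> are at once the two objects
    and their identity arrows (\<open>Idn = id\<close>), so three elements of \<open>'u\<close>
    suffice.\<close>
  define Z :: "('u, 'u) category" where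
    "Z = \<lparr>Ob = {a, b}, Ar = {a, b, c}, Dom = (\<lambda>x. if x = b then b else a),
      Cod = (\<lambda>x. if x = a then a else b), Idn = id, Comp = (\<lambda>y x. if y = b then x else if x = a then y else c)\<rparr>"
  have Z: "is_category Z"
    using b c by (auto simp: is_category_def Z_def)
  define U :: "'m \<Rightarrow> ('u, 'u, 'o, 'm) cfunctor" where
    "U = (\<lambda>f. \<lparr>on_ob = (\<lambda>x. if x = a then Dom C f else Cod C f),
      on_ar = (\<lambda>x. if x = a then Idn C (Dom C f) else if x = b then Idn C (Cod C f) else f)\<rparr>)"
  have J: "is_functor C D J"
    using mono by (simp add: is_mono_def)
  have C: "is_category C" using functor_source[OF J] .
  have U: "is_functor Z C (U f)" if "f \<in> Ar C" for f
    using Z C by (rule is_functorI) (use b c that in \<open>auto simp: Z_def U_def cat_simps[OF C]\<close>)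
  \<comment> \<open>A functor that agrees on two arrows agrees on their endpoints, so the two
    functors out of \<open>Z\<close> become equal after \<open>J\<close> also on objects and
    identities.\<close>
  have "on_ob J (Dom C f) = on_ob J (Dom C f')" "on_ob J (Cod C f) = on_ob J (Cod C f')"
    using functor_dom[OF J] functor_cod[OF J] f by metis+
  then have "feq Z (func_comp J (U f)) (func_comp J (U f'))"
    using f b c by (auto simp: feq_def Z_def U_def functor_idn[OF J] cat_simps[OF C])
  with mono U f have "feq Z (U f) (U f')" unfolding is_mono_def by blast
  then show "f = f'" using b c by (auto simp: feq_def Z_def U_def)
qed

text \<open>An object is recovered from its identity arrow, so injectivity on arrows is
  enough.\<close>

lemma is_mono_inj_on_ob:
  assumes inf: "infinite (UNIV :: 'u set)" and mono: "is_mono TYPE('u) C D J"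
  shows "inj_on (on_ob J) (Ob C)"
proof (rule inj_onI)
  fix x y assume xy: "x \<in> Ob C" "y \<in> Ob C" "on_ob J x = on_ob J y"
  have J: "is_functor C D J"
    using mono by (simp add: is_mono_def)
  note C = functor_source[OF J]
  from xy have "on_ar J (Idn C x) = on_ar J (Idn C y)" by (simp add: functor_idn[OF J])
  with is_mono_inj_on_ar[OF assms] xy have "Idn C x = Idn C y"
    by (auto simp: cat_simps[OF C] dest: inj_onD)
  with xy show "x = y" by (metis cat_dom_idn[OF C])
qed

text \<open>Here \<open>r\<close> and \<open>s\<close> are the kernel pair of \<open>K\<close>, so
  \<open>K\<close> descends to a functor on the quotient that is injective on objects and arrows. In
  a competing factorisation through a monomorphism \<open>J\<close>, injectivity of \<open>J\<close>
  forces the first factor to identify whatever \<open>K\<close> identifies; hence it descends as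
  well, and this gives the comparison functor.\<close>

lemma (in cat_congruence) is_image_quot:
  fixes K :: "('o, 'm, 'p, 'q) cfunctor"
  assumes inf: "infinite (UNIV :: 'u set)"
    and K: "is_functor C D K"
    and r_iff: "\<And>x y. x \<in> Ob C \<Longrightarrow> y \<in> Ob C \<Longrightarrow> (x, y) \<in> r \<longleftrightarrow> on_ob K x = on_ob K y"
    and s_iff: "\<And>f h. f \<in> Ar C \<Longrightarrow> h \<in> Ar C \<Longrightarrow> (f, h) \<in> s \<longleftrightarrow> on_ar K f = on_ar K h"
  shows "\<exists>I. is_image TYPE('u) C D K Q I (quot_functor r s)"
proof -
  have r_closed: "x \<in> Ob C" "y \<in> Ob C" if "(x, y) \<in> r" for x y
    using that r_equiv by (auto elim: equivE)
  obtain I where I: "is_functor Q D I" "feq C (func_comp I (quot_functor r s)) K"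
    using quot_functor_universal[OF K] r_iff r_closed s_iff s_closed by metis
  have I_ob: "on_ob I (r `` {x}) = on_ob K x" if "x \<in> Ob C" for x
    using I(2) that by (simp add: feq_def quot_functor_def)
  have I_ar: "on_ar I (s `` {f}) = on_ar K f" if "f \<in> Ar C" for f
    using I(2) that by (simp add: feq_def quot_functor_def)
  have "inj_on (on_ob I) (Ob Q)"
    by (rule inj_onI, elim quot_ObE) (simp add: I_ob r_class_eq_iff r_iff)
  moreover have "inj_on (on_ar I) (Ar Q)"
    by (rule inj_onI, elim quot_ArE) (simp add: I_ar s_class_eq_iff s_iff)
  ultimately have "is_mono TYPE('u) Q D I"
    using I(1) by (intro is_mono_inj)
  moreover have "\<exists>v. is_functor Q Z v \<and> feq Q I (func_comp J v) \<and>
      (\<forall>w. is_functor Q Z w \<longrightarrow> feq Q I (func_comp J w) \<longrightarrow> feq Q w v)"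
    if J: "is_mono TYPE('u) Z D J" and P: "is_functor C Z P" and JP: "feq C (func_comp J P) K"
    for Z :: "('u, 'u) category" and J P
  proof -
    note inj = is_mono_inj_on_ob[OF inf J, THEN inj_onD] is_mono_inj_on_ar[OF inf J, THEN inj_onD]
    have "on_ob P x = on_ob P y" if "(x, y) \<in> r" for x y
      using that JP r_closed[OF that] functor_ob[OF P] r_iff[of x y]
      by (intro inj(1)) (auto simp: feq_def)
    moreover have "on_ar P f = on_ar P h" if "f \<in> Ar C" "(f, h) \<in> s" for f h
      using that JP s_closed[of f h] functor_ar[OF P] s_iff[of f h]
      by (intro inj(2)) (auto simp: feq_def)
    ultimately obtain v where v: "is_functor Q Z v" "feq C (func_comp v (quot_functor r s)) P"
      using quot_functor_universal[OF P] by blast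
    have "feq Q I (func_comp J v)"
      by (rule quot_functor_cancel) (use I(2) v(2) JP in \<open>simp add: feq_def\<close>)
    moreover have "feq Q w v" if w: "is_functor Q Z w" "feq Q I (func_comp J w)" for w
      using calculation w(2) functor_ob[OF w(1)] functor_ob[OF v(1)]
        functor_ar[OF w(1)] functor_ar[OF v(1)] inj
      unfolding feq_def by auto
    ultimately show ?thesis using v(1) by blast
  qed
  ultimately show ?thesis
    using I K is_functor_quot_functor unfolding is_image_def by blast
qed


section \<open>Subcategories, powers and equalisers\<close>

lemma is_category_subcat:
  assumes C: "is_category C" and "Obs \<subseteq> Ob C" "Ars \<subseteq> Ar C"
    and "\<And>f. f \<in> Ars \<Longrightarrow> Dom C f \<in> Obs" "\<And>f. f \<in> Ars \<Longrightarrow> Cod C f \<in> Obs"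
    and "\<And>x. x \<in> Obs \<Longrightarrow> Idn C x \<in> Ars"
    and "\<And>f f'. f \<in> Ars \<Longrightarrow> f' \<in> Ars \<Longrightarrow> Cod C f = Dom C f' \<Longrightarrow> Comp C f' f \<in> Ars"
  shows "is_category (C\<lparr>Ob := Obs, Ar := Ars\<rparr>)"
  unfolding is_category_def
  using assms(2-7) by (auto simp: subset_iff cat_simps[OF C] cat_assoc[OF C])

lemma is_category_power_cat:
  assumes C: "is_category C"
  shows "is_category (power_cat S C)"
proof -
  have restrict_self: "(\<lambda>i\<in>S. f i) = f" if "f \<in> S \<rightarrow>\<^sub>E Y" for f :: "_ \<Rightarrow> 'z" and Y
    using that by (rule PiE_restrict)
  have pointwise: "h i = k i" if "(\<lambda>i\<in>S. h i) = (\<lambda>i\<in>S. k i)" "i \<in> S" for h k :: "_ \<Rightarrow> 'z" and i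
    using fun_cong[OF that(1), of i] that(2) by simp
  show ?thesis
    unfolding is_category_def power_cat_def category.simps
  proof (intro conjI ballI impI)
    fix f f' assume f: "f \<in> S \<rightarrow>\<^sub>E Ar C" "f' \<in> S \<rightarrow>\<^sub>E Ar C"
      and "(\<lambda>i\<in>S. Cod C (f i)) = (\<lambda>i\<in>S. Dom C (f' i))"
    then have c: "Cod C (f i) = Dom C (f' i)" if "i \<in> S" for i
      using pointwise that by blast
    show "(\<lambda>i\<in>S. Comp C (f' i) (f i)) \<in> S \<rightarrow>\<^sub>E Ar C"
      using c by (auto simp: cat_simps[OF C] PiE_mem[OF f(1)] PiE_mem[OF f(2)])
    show "(\<lambda>i\<in>S. Dom C ((\<lambda>i\<in>S. Comp C (f' i) (f i)) i)) = (\<lambda>i\<in>S. Dom C (f i))"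
      "(\<lambda>i\<in>S. Cod C ((\<lambda>i\<in>S. Comp C (f' i) (f i)) i)) = (\<lambda>i\<in>S. Cod C (f' i))"
      using c by (auto intro!: restrict_ext simp: cat_simps[OF C] PiE_mem[OF f(1)] PiE_mem[OF f(2)])
    fix f'' assume f'': "f'' \<in> S \<rightarrow>\<^sub>E Ar C"
      and "(\<lambda>i\<in>S. Cod C (f' i)) = (\<lambda>i\<in>S. Dom C (f'' i))"
    then have c': "Cod C (f' i) = Dom C (f'' i)" if "i \<in> S" for i
      using pointwise that by blast
    show "(\<lambda>i\<in>S. Comp C (f'' i) ((\<lambda>i\<in>S. Comp C (f' i) (f i)) i)) =
        (\<lambda>i\<in>S. Comp C ((\<lambda>i\<in>S. Comp C (f'' i) (f' i)) i) (f i))"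
      using c c' by (auto intro!: restrict_ext cat_assoc[OF C]
          simp: PiE_mem[OF f(1)] PiE_mem[OF f(2)] PiE_mem[OF f''])
  next
    fix f assume f: "f \<in> S \<rightarrow>\<^sub>E Ar C"
    have "(\<lambda>i\<in>S. Comp C (f i) ((\<lambda>i\<in>S. Idn C ((\<lambda>i\<in>S. Dom C (f i)) i)) i)) = (\<lambda>i\<in>S. f i)"
      "(\<lambda>i\<in>S. Comp C ((\<lambda>i\<in>S. Idn C ((\<lambda>i\<in>S. Cod C (f i)) i)) i) (f i)) = (\<lambda>i\<in>S. f i)"
      by (auto intro!: restrict_ext simp: cat_simps[OF C] PiE_mem[OF f])
    then show "(\<lambda>i\<in>S. Comp C (f i) ((\<lambda>i\<in>S. Idn C ((\<lambda>i\<in>S. Dom C (f i)) i)) i)) = f"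
      "(\<lambda>i\<in>S. Comp C ((\<lambda>i\<in>S. Idn C ((\<lambda>i\<in>S. Cod C (f i)) i)) i) (f i)) = f"
      using restrict_self[OF f] by simp_all
  next
    fix x assume x: "x \<in> S \<rightarrow>\<^sub>E Ob C"
    have "(\<lambda>i\<in>S. Dom C ((\<lambda>i\<in>S. Idn C (x i)) i)) = (\<lambda>i\<in>S. x i)"
      "(\<lambda>i\<in>S. Cod C ((\<lambda>i\<in>S. Idn C (x i)) i)) = (\<lambda>i\<in>S. x i)"
      by (auto intro!: restrict_ext simp: cat_simps[OF C] PiE_mem[OF x])
    then show "(\<lambda>i\<in>S. Dom C ((\<lambda>i\<in>S. Idn C (x i)) i)) = x" "(\<lambda>i\<in>S. Cod C ((\<lambda>i\<in>S. Idn C (x i)) i)) = x"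
      using restrict_self[OF x] by simp_all
  qed (auto intro: cat_dom[OF C] cat_cod[OF C] cat_idn[OF C] PiE_mem)
qed

text \<open>Equalisers of categories are computed separately on objects and on arrows. The mediating
  functor inverts the two bijections; its functoriality follows because \<iota> is injective and
  preserves the structure.\<close>

lemma is_equaliserI:
  assumes F: "is_functor C D F" and G: "is_functor C D G" and \<iota>: "is_functor E C \<iota>"
    and ob: "bij_betw (on_ob \<iota>) (Ob E) {x \<in> Ob C. on_ob F x = on_ob G x}"
    and ar: "bij_betw (on_ar \<iota>) (Ar E) {f \<in> Ar C. on_ar F f = on_ar G f}"
  shows "is_equaliser TYPE('u) C D F G E \<iota>"
  unfolding is_equaliser_def
proof (intro conjI allI impI F G \<iota>)
  show "feq E (func_comp F \<iota>) (func_comp G \<iota>)"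
    using bij_betwE[OF ob] bij_betwE[OF ar] by (simp add: feq_def)
  note E = functor_source[OF \<iota>]
  note \<iota>_simps = functor_dom[OF \<iota>] functor_cod[OF \<iota>] functor_idn[OF \<iota>] functor_comp[OF \<iota>]
  fix Z :: "('u, 'u) category" and K
  assume K: "is_functor Z C K" and eq: "feq Z (func_comp F K) (func_comp G K)"
  note K_simps = functor_dom[OF K] functor_cod[OF K] functor_idn[OF K] functor_comp[OF K]
  note Z = functor_source[OF K]
  define v where "v = \<lparr>on_ob = (\<lambda>z. inv_into (Ob E) (on_ob \<iota>) (on_ob K z)),
    on_ar = (\<lambda>z. inv_into (Ar E) (on_ar \<iota>) (on_ar K z))\<rparr>"
  have v_ob: "on_ob v z \<in> Ob E" "on_ob \<iota> (on_ob v z) = on_ob K z" if "z \<in> Ob Z" for z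
  proof -
    have "on_ob K z \<in> on_ob \<iota> ` Ob E"
      using that eq functor_ob[OF K] bij_betw_imp_surj_on[OF ob] by (simp add: feq_def)
    then show "on_ob v z \<in> Ob E" "on_ob \<iota> (on_ob v z) = on_ob K z"
      by (simp_all add: v_def inv_into_into f_inv_into_f)
  qed
  have v_ar: "on_ar v f \<in> Ar E" "on_ar \<iota> (on_ar v f) = on_ar K f" if "f \<in> Ar Z" for f
  proof -
    have "on_ar K f \<in> on_ar \<iota> ` Ar E"
      using that eq functor_ar[OF K] bij_betw_imp_surj_on[OF ar] by (simp add: feq_def)
    then show "on_ar v f \<in> Ar E" "on_ar \<iota> (on_ar v f) = on_ar K f"
      by (simp_all add: v_def inv_into_into f_inv_into_f)
  qed
  note inj_ob = inj_onD[OF bij_betw_imp_inj_on[OF ob]]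
  note inj_ar = inj_onD[OF bij_betw_imp_inj_on[OF ar]]
  \<comment> \<open>Both sides are compared in \<open>C\<close>, after applying \<iota>, which is
    injective on objects.\<close>
  have v_dom: "Dom E (on_ar v f) = on_ob v (Dom Z f)" if "f \<in> Ar Z" for f
    by (rule inj_ob) (use that in
      \<open>simp_all add: functor_dom[OF \<iota>, symmetric] cat_simps[OF E] cat_simps[OF Z] v_ob v_ar K_simps\<close>)
  have v_cod: "Cod E (on_ar v f) = on_ob v (Cod Z f)" if "f \<in> Ar Z" for f
    by (rule inj_ob) (use that in
      \<open>simp_all add: functor_cod[OF \<iota>, symmetric] cat_simps[OF E] cat_simps[OF Z] v_ob v_ar K_simps\<close>)
  have "is_functor Z E v"
    using Z E v_ob(1) v_ar(1) v_dom v_cod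
  proof (rule is_functorI)
    fix x assume "x \<in> Ob Z"
    then show "on_ar v (Idn Z x) = Idn E (on_ob v x)"
      by (intro inj_ar) (simp_all add: \<iota>_simps cat_simps[OF E] cat_simps[OF Z] v_ob v_ar K_simps)
  next
    fix f f' assume "f \<in> Ar Z" "f' \<in> Ar Z" "Cod Z f = Dom Z f'"
    then show "on_ar v (Comp Z f' f) = Comp E (on_ar v f') (on_ar v f)"
      by (intro inj_ar) (simp_all add: \<iota>_simps cat_simps[OF E] cat_simps[OF Z] v_ar K_simps v_dom v_cod)
  qed
  moreover have "feq Z (func_comp \<iota> v) K" by (simp add: feq_def v_ob v_ar)
  moreover have "feq Z w v" if w: "is_functor Z E w" "feq Z (func_comp \<iota> w) K" for w
    unfolding feq_def
  proof (intro conjI ballI)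
    fix x assume "x \<in> Ob Z"
    with w(2) show "on_ob w x = on_ob v x"
      by (intro inj_ob) (simp_all add: feq_def v_ob functor_ob[OF w(1)])
  next
    fix f assume "f \<in> Ar Z"
    with w(2) show "on_ar w f = on_ar v f"
      by (intro inj_ar) (simp_all add: feq_def v_ar functor_ar[OF w(1)])
  qed
  ultimately show "\<exists>v. is_functor Z E v \<and> feq Z (func_comp \<iota> v) K \<and>
      (\<forall>w. is_functor Z E w \<longrightarrow> feq Z (func_comp \<iota> w) K \<longrightarrow> feq Z w v)"
    by blast
qed

text \<open>This transports the generators between homomorphisms on the free group and tuples. In
  the backward direction composability has to be reflected too, and this is where injectivity on
  objects enters.\<close>

lemma comp_pairs_iso_iff:
  assumes F: "is_functor C D F" and ob: "inj_on (on_ob F) (Ob C)" and ar: "bij_betw (on_ar F) (Ar C) (Ar D)"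
    and s: "\<And>f f'. f \<in> Ar C \<Longrightarrow> f' \<in> Ar C \<Longrightarrow> (f, f') \<in> s \<longleftrightarrow> (on_ar F f, on_ar F f') \<in> s'"
    and xy: "x \<in> Ar C" "y \<in> Ar C"
  shows "(x, y) \<in> comp_pairs C s \<longleftrightarrow> (on_ar F x, on_ar F y) \<in> comp_pairs D s'"
proof
  note F_simps = functor_ar[OF F] functor_dom[OF F] functor_cod[OF F] functor_comp[OF F]
  assume "(x, y) \<in> comp_pairs C s"
  then obtain f1 f2 f1' f2' where "x = Comp C f2 f1" "y = Comp C f2' f1'"
    "f1 \<in> Ar C" "f2 \<in> Ar C" "Cod C f1 = Dom C f2" "f1' \<in> Ar C" "f2' \<in> Ar C" "Cod C f1' = Dom C f2'"
    "(f1, f1') \<in> s" "(f2, f2') \<in> s"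
    by (auto simp: comp_pairs_def)
  then show "(on_ar F x, on_ar F y) \<in> comp_pairs D s'"
    unfolding comp_pairs_def
    by (intro CollectI exI[of _ "on_ar F f1"] exI[of _ "on_ar F f2"] exI[of _ "on_ar F f1'"]
        exI[of _ "on_ar F f2'"]) (simp add: F_simps s)
next
  note F_simps = functor_ar[OF F] functor_dom[OF F] functor_cod[OF F] functor_comp[OF F]
  note C = functor_source[OF F]
  assume "(on_ar F x, on_ar F y) \<in> comp_pairs D s'"
  then obtain m1 m2 m1' m2' where m: "on_ar F x = Comp D m2 m1" "on_ar F y = Comp D m2' m1'"
    "m1 \<in> Ar D" "m2 \<in> Ar D" "m1' \<in> Ar D" "m2' \<in> Ar D"
    and c: "Cod D m1 = Dom D m2" "Cod D m1' = Dom D m2'"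
    and "(m1, m1') \<in> s'" "(m2, m2') \<in> s'"
    by (auto simp: comp_pairs_def)
  have preimage: "\<exists>f\<in>Ar C. m = on_ar F f" if "m \<in> Ar D" for m
    using that bij_betw_imp_surj_on[OF ar] by blast
  obtain f1 f2 f1' f2' where f: "f1 \<in> Ar C" "f2 \<in> Ar C" "f1' \<in> Ar C" "f2' \<in> Ar C"
    and mf: "m1 = on_ar F f1" "m2 = on_ar F f2" "m1' = on_ar F f1'" "m2' = on_ar F f2'"
    using m(3-6)[THEN preimage] by blast
  have cod: "Cod C f1 = Dom C f2" "Cod C f1' = Dom C f2'"
    by (rule inj_onD[OF ob]; use c f in \<open>simp add: mf F_simps cat_simps[OF C]\<close>)+
  have "x = Comp C f2 f1" "y = Comp C f2' f1'"
    by (rule inj_onD[OF bij_betw_imp_inj_on[OF ar]];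
        use xy m(1,2) f cod in \<open>simp add: mf F_simps cat_simps[OF C]\<close>)+
  with f cod \<open>(m1, m1') \<in> s'\<close> \<open>(m2, m2') \<in> s'\<close> show "(x, y) \<in> comp_pairs C s"
    unfolding comp_pairs_def mf using s by blast
qed


section \<open>Invariants of a strict action of a group object in \<open>Cat\<close>\<close>

lemma equiv_orbits:
  assumes G: "group G" and closed: "\<And>h x. h \<in> carrier G \<Longrightarrow> x \<in> S \<Longrightarrow> \<alpha> h x \<in> S"
    and one: "\<And>x. x \<in> S \<Longrightarrow> \<alpha> \<one>\<^bsub>G\<^esub> x = x"
    and mult: "\<And>h k x. h \<in> carrier G \<Longrightarrow> k \<in> carrier G \<Longrightarrow> x \<in> S \<Longrightarrow> \<alpha> (h \<otimes>\<^bsub>G\<^esub> k) x = \<alpha> h (\<alpha> k x)"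
  shows "equiv S {(x, \<alpha> h x) | x h. x \<in> S \<and> h \<in> carrier G}" (is "equiv S ?R")
proof (rule equivI)
  interpret group G by (rule G)
  show "?R \<subseteq> S \<times> S" using closed by auto
  show "refl_on S ?R"
  proof (rule refl_onI)
    fix x assume "x \<in> S"
    with one[of x] show "(x, x) \<in> ?R" by (intro CollectI exI[of _ x] exI[of _ "\<one>\<^bsub>G\<^esub>"]) simp
  qed
  show "sym ?R"
  proof (rule symI)
    fix x y assume "(x, y) \<in> ?R"
    then obtain h where h: "x \<in> S" "h \<in> carrier G" "y = \<alpha> h x" by auto
    then have "x = \<alpha> (inv\<^bsub>G\<^esub> h) y" "inv\<^bsub>G\<^esub> h \<in> carrier G"
      using mult[of "inv\<^bsub>G\<^esub> h" h x] one by simp_all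
    with h closed show "(y, x) \<in> ?R" by blast
  qed
  show "trans ?R"
  proof (rule transI)
    fix x y z assume "(x, y) \<in> ?R" "(y, z) \<in> ?R"
    then obtain h k where "x \<in> S" "h \<in> carrier G" "k \<in> carrier G" "y = \<alpha> h x" "z = \<alpha> k y" by auto
    then have "z = \<alpha> (k \<otimes>\<^bsub>G\<^esub> h) x" "k \<otimes>\<^bsub>G\<^esub> h \<in> carrier G" using mult by simp_all
    with \<open>x \<in> S\<close> show "(x, z) \<in> ?R" by blast
  qed
qed

text \<open>A strict action is given in two layers, \<open>GO\<close> acting on objects and
  \<open>GA\<close> on arrows, which are tied together by functoriality of \<open>T\<close>.\<close>

locale cat_action =
  fixes H :: "('b, 'c) category" and M :: "('o, 'm) category"
    and T :: "('b \<times> 'o, 'c \<times> 'm, 'o, 'm) cfunctor"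
    and GO :: "'b monoid" and GA :: "'c monoid"
  assumes cat_H: "is_category H"
    and T: "is_functor (prod_cat H M) M T"
    and GO: "group GO" "carrier GO = Ob H"
    and GA: "group GA" "carrier GA = Ar H"
    and one_ob: "x \<in> Ob M \<Longrightarrow> on_ob T (\<one>\<^bsub>GO\<^esub>, x) = x"
    and one_ar: "f \<in> Ar M \<Longrightarrow> on_ar T (\<one>\<^bsub>GA\<^esub>, f) = f"
    and mult_ob: "b \<in> Ob H \<Longrightarrow> b' \<in> Ob H \<Longrightarrow> x \<in> Ob M \<Longrightarrow>
      on_ob T (b \<otimes>\<^bsub>GO\<^esub> b', x) = on_ob T (b, on_ob T (b', x))"
    and mult_ar: "c \<in> Ar H \<Longrightarrow> c' \<in> Ar H \<Longrightarrow> f \<in> Ar M \<Longrightarrow>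
      on_ar T (c \<otimes>\<^bsub>GA\<^esub> c', f) = on_ar T (c, on_ar T (c', f))"
begin

lemma cat_M: "is_category M"
  using functor_target[OF T] .

abbreviation act_ob (infixr "\<rhd>" 75) where "b \<rhd> x \<equiv> on_ob T (b, x)"
abbreviation act_ar (infixr "\<unrhd>" 75) where "c \<unrhd> f \<equiv> on_ar T (c, f)"
abbreviation comp (infixr "\<cdot>" 70) where "f' \<cdot> f \<equiv> Comp M f' f"
abbreviation "\<I> \<equiv> Idn H"

definition "orb_ob = {(x, b \<rhd> x) | b x. b \<in> Ob H \<and> x \<in> Ob M}"
definition "orb_ar = {(f, c \<unrhd> f) | c f. c \<in> Ar H \<and> f \<in> Ar M}"
definition "orb_rel = gen_equiv (comp_pairs M orb_ar)"

lemmas H_simps = cat_simps[OF cat_H]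
lemmas M_simps = cat_simps[OF cat_M]

lemma act_simps:
  "b \<in> Ob H \<Longrightarrow> x \<in> Ob M \<Longrightarrow> b \<rhd> x \<in> Ob M"
  "c \<in> Ar H \<Longrightarrow> f \<in> Ar M \<Longrightarrow> c \<unrhd> f \<in> Ar M"
  "c \<in> Ar H \<Longrightarrow> f \<in> Ar M \<Longrightarrow> Dom M (c \<unrhd> f) = Dom H c \<rhd> Dom M f"
  "c \<in> Ar H \<Longrightarrow> f \<in> Ar M \<Longrightarrow> Cod M (c \<unrhd> f) = Cod H c \<rhd> Cod M f"
  "b \<in> Ob H \<Longrightarrow> x \<in> Ob M \<Longrightarrow> \<I> b \<unrhd> Idn M x = Idn M (b \<rhd> x)"
  using functor_ob[OF T, of "(b, x)"] functor_ar[OF T, of "(c, f)"] functor_dom[OF T, of "(c, f)"]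
    functor_cod[OF T, of "(c, f)"] functor_idn[OF T, of "(b, x)"]
  by (auto simp: prod_cat_def)

lemma act_comp:
  "c \<in> Ar H \<Longrightarrow> c' \<in> Ar H \<Longrightarrow> f \<in> Ar M \<Longrightarrow> f' \<in> Ar M \<Longrightarrow> Cod H c = Dom H c' \<Longrightarrow> Cod M f = Dom M f' \<Longrightarrow>
    (Comp H c' c) \<unrhd> (f' \<cdot> f) = (c' \<unrhd> f') \<cdot> (c \<unrhd> f)"
  using functor_comp[OF T, of "(c, f)" "(c', f')"] by (auto simp: prod_cat_def)

section \<open>Orbits of objects and of arrows\<close>

lemma equiv_orb_ob: "equiv (Ob M) orb_ob"
proof -
  have "orb_ob = {(x, b \<rhd> x) | x b. x \<in> Ob M \<and> b \<in> carrier GO}"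
    by (auto simp: orb_ob_def GO)
  then show ?thesis
    using equiv_orbits[OF GO(1), of "Ob M" "\<lambda>b x. b \<rhd> x"]
    by (simp add: GO act_simps one_ob mult_ob)
qed

lemma equiv_orb_ar: "equiv (Ar M) orb_ar"
proof -
  have "orb_ar = {(f, c \<unrhd> f) | f c. f \<in> Ar M \<and> c \<in> carrier GA}"
    by (auto simp: orb_ar_def GA)
  then show ?thesis
    using equiv_orbits[OF GA(1), of "Ar M" "\<lambda>c f. c \<unrhd> f"]
    by (simp add: GA act_simps one_ar mult_ar)
qed

lemma orb_ob_sym: "(x, y) \<in> orb_ob \<Longrightarrow> (y, x) \<in> orb_ob"
  using equiv_orb_ob by (meson equivE symD)

lemma orb_ar_sym: "(f, h) \<in> orb_ar \<Longrightarrow> (h, f) \<in> orb_ar"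
  and orb_ar_trans: "(f, h) \<in> orb_ar \<Longrightarrow> (h, k) \<in> orb_ar \<Longrightarrow> (f, k) \<in> orb_ar"
  and orb_ar_refl: "f \<in> Ar M \<Longrightarrow> (f, f) \<in> orb_ar"
  and orb_ar_closed: "(f, h) \<in> orb_ar \<Longrightarrow> f \<in> Ar M" "(f, h) \<in> orb_ar \<Longrightarrow> h \<in> Ar M"
  using equiv_orb_ar by (meson equivE symD transD refl_onD subsetD SigmaE2)+

lemma orb_arI: "c \<in> Ar H \<Longrightarrow> f \<in> Ar M \<Longrightarrow> (f, c \<unrhd> f) \<in> orb_ar"
  by (auto simp: orb_ar_def)

lemma orb_obI: "b \<in> Ob H \<Longrightarrow> x \<in> Ob M \<Longrightarrow> (x, b \<rhd> x) \<in> orb_ob"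
  by (auto simp: orb_ob_def)

lemma orb_ar_dom_cod:
  assumes "(f, h) \<in> orb_ar"
  shows "(Dom M f, Dom M h) \<in> orb_ob" "(Cod M f, Cod M h) \<in> orb_ob"
  using assms by (auto simp: orb_ar_def act_simps H_simps M_simps intro!: orb_obI)

text \<open>The identity arrow of \<open>b\<close> translates both endpoints of \<open>h\<close> by
  \<open>b\<close>, so the source can be put anywhere in its orbit. This provides
  \<open>s_lift\<close> and keeps the links of a chain composable with a neighbouring arrow.\<close>

lemma orb_lift_dom:
  assumes "h \<in> Ar M" "(Dom M h, x) \<in> orb_ob"
  obtains h' where "(h, h') \<in> orb_ar" "Dom M h' = x"
proof -
  from assms obtain b where "b \<in> Ob H" "x = b \<rhd> Dom M h" by (auto simp: orb_ob_def)
  with assms(1) that[of "\<I> b \<unrhd> h"] show ?thesis by (simp add: act_simps H_simps orb_arI)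
qed

lemma orb_lift_cod:
  assumes "h \<in> Ar M" "(Cod M h, x) \<in> orb_ob"
  obtains h' where "(h, h') \<in> orb_ar" "Cod M h' = x"
proof -
  from assms obtain b where "b \<in> Ob H" "x = b \<rhd> Cod M h" by (auto simp: orb_ob_def)
  with assms(1) that[of "\<I> b \<unrhd> h"] show ?thesis by (simp add: act_simps H_simps orb_arI)
qed

section \<open>The relation generated by composites of orbits is a congruence\<close>

lemma orb_rel_compI:
  assumes "(f, f') \<in> orb_ar" "(h, h') \<in> orb_ar" "Cod M f = Dom M h" "Cod M f' = Dom M h'"
  shows "(h \<cdot> f, h' \<cdot> f') \<in> orb_rel"
  unfolding orb_rel_def comp_pairs_def
  using assms orb_ar_closed by (intro gen_equiv_base) blast

lemma orb_rel_refl [simp]: "(f, f) \<in> orb_rel"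
  and orb_rel_sym: "(f, f') \<in> orb_rel \<Longrightarrow> (f', f) \<in> orb_rel"
  and orb_rel_trans [trans]: "(f, f') \<in> orb_rel \<Longrightarrow> (f', f'') \<in> orb_rel \<Longrightarrow> (f, f'') \<in> orb_rel"
  by (auto simp: orb_rel_def intro: gen_equiv_sym gen_equiv_trans)

text \<open>The generators relate composites, so \<open>f\<close> is read as \<open>f\<close> after
  the identity of its source. The identity arrow of a \<open>b\<close> with
  \<open>Dom M h = b \<rhd> Dom M f\<close> carries this identity to the one needed for
  \<open>h\<close>.\<close>

lemma orb_ar_imp_orb_rel:
  assumes "(f, h) \<in> orb_ar"
  shows "(f, h) \<in> orb_rel"
proof -
  have *: "f \<in> Ar M" "h \<in> Ar M" using assms orb_ar_closed by auto
  from orb_ar_dom_cod[OF assms] obtain b where b: "b \<in> Ob H" "Dom M h = b \<rhd> Dom M f"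
    by (auto simp: orb_ob_def)
  with * have "(Idn M (Dom M f), Idn M (Dom M h)) \<in> orb_ar"
    using orb_arI[of "\<I> b" "Idn M (Dom M f)"] by (simp add: act_simps H_simps M_simps)
  from orb_rel_compI[OF this assms] * show ?thesis by (simp add: M_simps)
qed

text \<open>An arrow \<open>c : b \<rightarrow> e\<close> of \<open>H\<close> acts by \<open>c \<unrhd> f = (c \<unrhd> 1) \<cdot> (1\<^sub>b \<unrhd> f) = (1\<^sub>e \<unrhd> f) \<cdot> (c \<unrhd> 1)\<close>. Hence the factor
  \<open>c \<unrhd> 1\<close> that separates \<open>c \<unrhd> f\<^sub>2\<close> from \<open>1\<^sub>b \<unrhd> f\<^sub>2\<close> can be moved to its other neighbour \<open>h\<close>.\<close>

lemma orb_rel_triple: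
  assumes f1: "(f1, f1') \<in> orb_ar" and f2: "(f2, f2') \<in> orb_ar" and h: "(h, h') \<in> orb_ar"
    and comp: "Cod M f1 = Dom M f2" "Cod M f2 = Dom M h"
    and comp': "Cod M f1' = Dom M f2'" "Cod M f2' = Dom M h'"
  shows "(h \<cdot> (f2 \<cdot> f1), h' \<cdot> (f2' \<cdot> f1')) \<in> orb_rel"
proof -
  have ar [simp]: "f1 \<in> Ar M" "f1' \<in> Ar M" "f2 \<in> Ar M" "f2' \<in> Ar M" "h \<in> Ar M" "h' \<in> Ar M"
    using f1 f2 h orb_ar_closed by auto
  from f2 obtain c where c [simp]: "c \<in> Ar H" and f2': "f2' = c \<unrhd> f2"
    by (auto simp: orb_ar_def)
  define b e y where "b = Dom H c" and "e = Cod H c" and "y = Cod M f2"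
  have [simp]: "b \<in> Ob H" "e \<in> Ob H" "y \<in> Ob M" "\<I> b \<in> Ar H" "\<I> e \<in> Ar H"
    by (simp_all add: b_def e_def y_def H_simps M_simps)
  have y: "Dom M h = y" "Cod M f2 = y" using comp by (simp_all add: y_def)
  have c_dom: "Dom H c = b" "Cod H c = e" by (simp_all add: b_def e_def)
  have f1'_cod: "Cod M f1' = b \<rhd> Dom M f2"
    by (simp add: comp' f2' act_simps c_dom)
  \<comment> \<open>This is the part of \<open>f2' \<cdot> f1'\<close> that remains when the factor
    \<open>c \<unrhd> Idn M y\<close> is split off on the left.\<close>
  define w where "w = (\<I> b \<unrhd> f2) \<cdot> f1'"
  have f2'_eq: "f2' = (c \<unrhd> Idn M y) \<cdot> (\<I> b \<unrhd> f2)"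
    using act_comp[of "\<I> b" c f2 "Idn M y"] by (simp add: f2' H_simps M_simps c_dom y)
  have w: "w \<in> Ar M" "Cod M w = b \<rhd> y"
    by (simp_all add: w_def act_simps M_simps H_simps f1'_cod y)
  have f2'_f1': "f2' \<cdot> f1' = (c \<unrhd> Idn M y) \<cdot> w"
    unfolding f2'_eq w_def
    by (rule cat_assoc[OF cat_M, symmetric]) (simp_all add: act_simps M_simps H_simps f1'_cod y c_dom)
  \<comment> \<open>Regroup so that \<open>h \<cdot> f2\<close> counts as a single arrow, and
    translate it by the identity of \<open>b\<close> alone: its source becomes
    \<open>b \<rhd> Dom M f2\<close>, where \<open>f1'\<close> ends.\<close>
  have "(h \<cdot> (f2 \<cdot> f1), (\<I> b \<unrhd> (h \<cdot> f2)) \<cdot> f1') \<in> orb_rel"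
    unfolding cat_assoc[OF cat_M \<open>f1 \<in> Ar M\<close> \<open>f2 \<in> Ar M\<close> \<open>h \<in> Ar M\<close> comp]
    by (rule orb_rel_compI[OF f1])
      (simp_all add: orb_arI comp act_simps M_simps H_simps f1'_cod y)
  also have "(\<I> b \<unrhd> (h \<cdot> f2)) = (\<I> b \<unrhd> h) \<cdot> (\<I> b \<unrhd> f2)"
    using act_comp[of "\<I> b" "\<I> b" f2 h] by (simp add: H_simps y)
  also have "((\<I> b \<unrhd> h) \<cdot> (\<I> b \<unrhd> f2)) \<cdot> f1' = (\<I> b \<unrhd> h) \<cdot> w"
    unfolding w_def
    by (rule cat_assoc[OF cat_M, symmetric]) (simp_all add: act_simps M_simps H_simps f1'_cod y)
  \<comment> \<open>The missing factor enters on the side of \<open>h\<close>: both translates lie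
    in the orbit of \<open>h\<close> and both start at \<open>b \<rhd> y\<close>, because
    \<open>c\<close> has source \<open>b\<close>.\<close>
  also have "((\<I> b \<unrhd> h) \<cdot> w, (c \<unrhd> h) \<cdot> w) \<in> orb_rel"
  proof (rule orb_rel_compI)
    show "(\<I> b \<unrhd> h, c \<unrhd> h) \<in> orb_ar"
      by (meson orb_arI orb_ar_sym orb_ar_trans c ar \<open>\<I> b \<in> Ar H\<close>)
  qed (simp_all add: w orb_ar_refl act_simps H_simps y c_dom)
  also have "c \<unrhd> h = (\<I> e \<unrhd> h) \<cdot> (c \<unrhd> Idn M y)"
    using act_comp[of c "\<I> e" "Idn M y" h] by (simp add: H_simps M_simps c_dom y)
  also have "((\<I> e \<unrhd> h) \<cdot> (c \<unrhd> Idn M y)) \<cdot> w = (\<I> e \<unrhd> h) \<cdot> (f2' \<cdot> f1')"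
    unfolding f2'_f1'
    by (rule cat_assoc[OF cat_M, symmetric]) (simp_all add: w act_simps M_simps H_simps y c_dom)
  \<comment> \<open>With \<open>f2' \<cdot> f1'\<close> completed, the outer arrow is free again:
    \<open>\<I> e \<unrhd> h\<close> and \<open>h'\<close> lie in one orbit and both start at
    \<open>e \<rhd> y\<close>.\<close>
  also have "((\<I> e \<unrhd> h) \<cdot> (f2' \<cdot> f1'), h' \<cdot> (f2' \<cdot> f1')) \<in> orb_rel"
  proof (rule orb_rel_compI)
    show "(\<I> e \<unrhd> h, h') \<in> orb_ar"
      by (meson h orb_arI orb_ar_sym orb_ar_trans ar \<open>\<I> e \<in> Ar H\<close>)
  qed (simp_all add: comp'(2)[symmetric] f1'_cod f2' orb_ar_refl act_simps M_simps H_simps y c_dom)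
  finally show ?thesis .
qed

lemma comp_pairs_sym: "(f, f') \<in> comp_pairs M orb_ar \<union> (comp_pairs M orb_ar)\<inverse> \<Longrightarrow> (f, f') \<in> comp_pairs M orb_ar"
  unfolding comp_pairs_def using orb_ar_sym by blast

lemma comp_pairs_closed: "comp_pairs M orb_ar \<subseteq> Ar M \<times> Ar M"
  by (auto simp: comp_pairs_def M_simps)

lemma orb_rel_closed: "(f, f') \<in> orb_rel \<Longrightarrow> f \<in> Ar M \<longleftrightarrow> f' \<in> Ar M"
  unfolding orb_rel_def using gen_equiv_closed[OF _ comp_pairs_closed] .

text \<open>The orbits of the endpoints are invariants of a generating pair, since a composite takes
  its source from the first factor and its target from the second.\<close>

lemma orb_rel_dom_cod:
  assumes "(f, f') \<in> orb_rel" "f \<in> Ar M"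
  shows "(Dom M f, Dom M f') \<in> orb_ob" "(Cod M f, Cod M f') \<in> orb_ob"
proof -
  let ?cl = "\<lambda>f. (orb_ob `` {Dom M f}, orb_ob `` {Cod M f})"
  have "?cl h = ?cl h'" if "(h, h') \<in> comp_pairs M orb_ar" for h h'
  proof -
    from that obtain f1 f2 f1' f2' where *: "h = f2 \<cdot> f1" "h' = f2' \<cdot> f1'"
      "f1 \<in> Ar M" "f2 \<in> Ar M" "f1' \<in> Ar M" "f2' \<in> Ar M"
      "Cod M f1 = Dom M f2" "Cod M f1' = Dom M f2'" and orb: "(f1, f1') \<in> orb_ar" "(f2, f2') \<in> orb_ar"
      unfolding comp_pairs_def by blast
    from * orb_ar_dom_cod(1)[OF orb(1)] orb_ar_dom_cod(2)[OF orb(2)] show ?thesis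
      by (simp add: M_simps equiv_class_eq[OF equiv_orb_ob])
  qed
  with assms(1) have "?cl f = ?cl f'" unfolding orb_rel_def by (rule gen_equiv_eq)
  moreover have "f' \<in> Ar M" using assms orb_rel_closed by blast
  ultimately show "(Dom M f, Dom M f') \<in> orb_ob" "(Cod M f, Cod M f') \<in> orb_ob"
    using assms(2) by (simp_all add: eq_equiv_class_iff[OF equiv_orb_ob] M_simps)
qed

lemma comp_pairs_orb_rel_comp:
  assumes "(f, f') \<in> comp_pairs M orb_ar" "(h, h') \<in> orb_ar" "Cod M f = Dom M h" "Cod M f' = Dom M h'"
  shows "(h \<cdot> f, h' \<cdot> f') \<in> orb_rel"
  using assms(1)
  unfolding comp_pairs_def
proof clarify
  fix f1 f2 f1' f2'
  assume "f = f2 \<cdot> f1" "f' = f2' \<cdot> f1'" "f1 \<in> Ar M" "f2 \<in> Ar M" "f1' \<in> Ar M" "f2' \<in> Ar M"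
    "Cod M f1 = Dom M f2" "Cod M f1' = Dom M f2'" "(f1, f1') \<in> orb_ar" "(f2, f2') \<in> orb_ar"
  with assms show "(h \<cdot> (f2 \<cdot> f1), h' \<cdot> (f2' \<cdot> f1')) \<in> orb_rel"
    by (intro orb_rel_triple) (simp_all add: M_simps)
qed

text \<open>After reassociation this is again \<open>orb_rel_triple\<close>, with the new arrow now
  in the first place instead of the last.\<close>

lemma orb_rel_comp_pairs_comp:
  assumes "(f, f') \<in> orb_ar" "(h, h') \<in> comp_pairs M orb_ar" "Cod M f = Dom M h" "Cod M f' = Dom M h'"
  shows "(h \<cdot> f, h' \<cdot> f') \<in> orb_rel"
  using assms(2)
  unfolding comp_pairs_def
proof clarify
  fix f1 f2 f1' f2'
  assume *: "h = f2 \<cdot> f1" "h' = f2' \<cdot> f1'" "f1 \<in> Ar M" "f2 \<in> Ar M" "f1' \<in> Ar M" "f2' \<in> Ar M"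
    "Cod M f1 = Dom M f2" "Cod M f1' = Dom M f2'" "(f1, f1') \<in> orb_ar" "(f2, f2') \<in> orb_ar"
  with assms have "(f2 \<cdot> (f1 \<cdot> f), f2' \<cdot> (f1' \<cdot> f')) \<in> orb_rel"
    by (intro orb_rel_triple) (simp_all add: M_simps)
  with assms * orb_ar_closed[OF assms(1)] show "((f2 \<cdot> f1) \<cdot> f, (f2' \<cdot> f1') \<cdot> f') \<in> orb_rel"
    by (simp add: cat_assoc[OF cat_M] M_simps)
qed

text \<open>The links of the chain from \<open>f\<close> to \<open>f'\<close> may end at different
  points of one orbit, so a fixed \<open>h'\<close> is not composable with all of them. The
  induction therefore quantifies over every translate of \<open>h\<close> that fits the current
  link, and \<open>orb_lift_dom\<close> supplies one for the link before.\<close>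

lemma orb_rel_comp_right:
  assumes "(f, f') \<in> orb_rel" "f \<in> Ar M" "(h, h') \<in> orb_ar" "Cod M f = Dom M h" "Cod M f' = Dom M h'"
  shows "(h \<cdot> f, h' \<cdot> f') \<in> orb_rel"
proof -
  have "\<forall>h'. (h, h') \<in> orb_ar \<longrightarrow> Cod M f' = Dom M h' \<longrightarrow> (h \<cdot> f, h' \<cdot> f') \<in> orb_rel"
    using assms(1)[unfolded orb_rel_def]
  proof (induction rule: gen_equiv_induct)
    case refl
    show ?case using assms orb_ar_refl by (auto intro!: orb_rel_compI)
  next
    case (step y z)
    show ?case
    proof (intro allI impI)
      fix h' assume h': "(h, h') \<in> orb_ar" "Cod M z = Dom M h'"
      note yz = comp_pairs_sym[OF step(2)]
      then have "y \<in> Ar M" using comp_pairs_closed by auto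
      moreover have "(y, z) \<in> orb_rel" using yz by (auto simp: orb_rel_def intro: gen_equiv_base)
      ultimately have "(Dom M h', Cod M y) \<in> orb_ob"
        using orb_rel_dom_cod(2) orb_ob_sym h' by metis
      then obtain h'' where h'': "(h', h'') \<in> orb_ar" "Dom M h'' = Cod M y"
        using orb_lift_dom orb_ar_closed(2)[OF h'(1)] by metis
      have "(h \<cdot> f, h'' \<cdot> y) \<in> orb_rel"
        using step(3) h'' orb_ar_trans[OF h'(1) h''(1)] by simp
      also have "(h'' \<cdot> y, h' \<cdot> z) \<in> orb_rel"
        using comp_pairs_orb_rel_comp[OF yz orb_ar_sym[OF h''(1)]] h'' h' by simp
      finally show "(h \<cdot> f, h' \<cdot> z) \<in> orb_rel" .
    qed
  qed
  with assms show ?thesis by blast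
qed

lemma orb_rel_comp_left:
  assumes "(h, h') \<in> orb_rel" "h \<in> Ar M" "(f, f') \<in> orb_ar" "Cod M f = Dom M h" "Cod M f' = Dom M h'"
  shows "(h \<cdot> f, h' \<cdot> f') \<in> orb_rel"
proof -
  have "\<forall>f'. (f, f') \<in> orb_ar \<longrightarrow> Cod M f' = Dom M h' \<longrightarrow> (h \<cdot> f, h' \<cdot> f') \<in> orb_rel"
    using assms(1)[unfolded orb_rel_def]
  proof (induction rule: gen_equiv_induct)
    case refl
    show ?case using assms orb_ar_refl by (auto intro!: orb_rel_compI)
  next
    case (step y z)
    show ?case
    proof (intro allI impI)
      fix f' assume f': "(f, f') \<in> orb_ar" "Cod M f' = Dom M z"
      note yz = comp_pairs_sym[OF step(2)]
      then have "y \<in> Ar M" using comp_pairs_closed by auto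
      moreover have "(y, z) \<in> orb_rel" using yz by (auto simp: orb_rel_def intro: gen_equiv_base)
      ultimately have "(Cod M f', Dom M y) \<in> orb_ob"
        using orb_rel_dom_cod(1) orb_ob_sym f' by metis
      then obtain f'' where f'': "(f', f'') \<in> orb_ar" "Cod M f'' = Dom M y"
        using orb_lift_cod orb_ar_closed(2)[OF f'(1)] by metis
      have "(h \<cdot> f, y \<cdot> f'') \<in> orb_rel"
        using step(3) f'' orb_ar_trans[OF f'(1) f''(1)] by simp
      also have "(y \<cdot> f'', z \<cdot> f') \<in> orb_rel"
        using orb_rel_comp_pairs_comp[OF orb_ar_sym[OF f''(1)] yz] f'' f' by simp
      finally show "(h \<cdot> f, z \<cdot> f') \<in> orb_rel" .
    qed
  qed
  with assms show ?thesis by blast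
qed

lemma cat_congruence_orb: "cat_congruence M orb_ob orb_rel"
proof (rule cat_congruence.intro[OF cat_M equiv_orb_ob])
  fix x x' assume "(x, x') \<in> orb_ob"
  then obtain b where "b \<in> Ob H" "x \<in> Ob M" "x' = b \<rhd> x" by (auto simp: orb_ob_def)
  then show "(Idn M x, Idn M x') \<in> orb_rel"
    using orb_ar_imp_orb_rel[OF orb_arI, of "\<I> b" "Idn M x"] by (simp add: act_simps H_simps M_simps)
next
  fix h h' f f'
  assume *: "(h, h') \<in> orb_rel" "(f, f') \<in> orb_rel" "h \<in> Ar M" "f \<in> Ar M"
    "Cod M f = Dom M h" "Cod M f' = Dom M h'"
  then have "(Dom M h, Cod M f') \<in> orb_ob" using orb_rel_dom_cod(2) by metis
  then obtain h'' where h'': "(h, h'') \<in> orb_ar" "Dom M h'' = Cod M f'"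
    using orb_lift_dom * by metis
  \<comment> \<open>The factors are changed one at a time: first \<open>f\<close> becomes
    \<open>f'\<close> while \<open>h\<close> only moves within its orbit, then \<open>h''\<close>
    becomes \<open>h'\<close> next to a fixed \<open>f'\<close>.\<close>
  have "(h \<cdot> f, h'' \<cdot> f') \<in> orb_rel"
    by (rule orb_rel_comp_right) (use * h'' in simp_all)
  also have "(h'' \<cdot> f', h' \<cdot> f') \<in> orb_rel"
  proof (rule orb_rel_comp_left)
    show "(h'', h') \<in> orb_rel"
      using orb_rel_trans[OF orb_rel_sym[OF orb_ar_imp_orb_rel[OF h''(1)]] *(1)] .
    show "(f', f') \<in> orb_ar" using *(2,4) orb_rel_closed orb_ar_refl by blast
  qed (use * h'' orb_ar_closed in auto)
  finally show "(h \<cdot> f, h' \<cdot> f') \<in> orb_rel" .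
next
  fix f h assume "f \<in> Ar M" "h \<in> Ar M" "(Cod M f, Dom M h) \<in> orb_ob"
  then show "\<exists>h'. (h, h') \<in> orb_rel \<and> Dom M h' = Cod M f"
    by (meson orb_lift_dom orb_ob_sym orb_ar_imp_orb_rel)
qed (use orb_rel_refl orb_rel_sym orb_rel_trans orb_rel_closed orb_rel_dom_cod in blast)+

text \<open>A functor that coequalises the action and the projection is constant on orbits, hence by
  functoriality on composites of orbit-related factors, hence on \<open>orb_rel\<close>. So it
  descends to the quotient, which is a category because \<open>orb_rel\<close> is a
  congruence.\<close>

theorem is_coequaliser_orb:
  "is_coequaliser TYPE('u) (prod_cat H M) M T proj2
     (quot_cat M orb_ob orb_rel) (quot_functor orb_ob orb_rel)"
  unfolding is_coequaliser_def
proof (intro conjI allI impI)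
  interpret cat_congruence M orb_ob orb_rel by (rule cat_congruence_orb)
  show "is_functor (prod_cat H M) M T" by (rule T)
  show "is_functor (prod_cat H M) M proj2" by (rule is_functor_proj2[OF cat_H cat_M])
  show "is_functor M Q (quot_functor orb_ob orb_rel)" by (rule is_functor_quot_functor)
  show "feq (prod_cat H M) (func_comp (quot_functor orb_ob orb_rel) T)
      (func_comp (quot_functor orb_ob orb_rel) proj2)"
    unfolding feq_def quot_functor_def proj2_def prod_cat_def
    by (auto simp: s_class_eq_iff act_simps intro!: r_class_eq orb_ob_sym[OF orb_obI]
        orb_ar_imp_orb_rel[OF orb_ar_sym[OF orb_arI]] dest!: equalityD1)
  fix Z :: "('u, 'u) category" and K
  assume K: "is_functor M Z K" and eq: "feq (prod_cat H M) (func_comp K T) (func_comp K proj2)"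
  have K_ob: "on_ob K x = on_ob K y" if "(x, y) \<in> orb_ob" for x y
    using that eq by (auto simp: orb_ob_def feq_def proj2_def prod_cat_def)
  have K_orb: "on_ar K f = on_ar K h" if "(f, h) \<in> orb_ar" for f h
    using that eq by (auto simp: orb_ar_def feq_def proj2_def prod_cat_def)
  have "on_ar K f = on_ar K h" if "(f, h) \<in> comp_pairs M orb_ar" for f h
    using that by (auto simp: comp_pairs_def functor_comp[OF K] dest!: K_orb)
  then have "on_ar K f = on_ar K h" if "(f, h) \<in> orb_rel" for f h
    using gen_equiv_eq[OF that[unfolded orb_rel_def], of "on_ar K"] by blast
  then obtain v where v: "is_functor Q Z v" "feq M (func_comp v (quot_functor orb_ob orb_rel)) K"
    using quot_functor_universal[OF K] K_ob by blast
  have "feq Q w v" if "feq M (func_comp w (quot_functor orb_ob orb_rel)) K" for w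
    by (rule quot_functor_cancel) (use v(2) that in \<open>simp add: feq_def\<close>)
  with v show "\<exists>v. is_functor Q Z v \<and> feq M (func_comp v (quot_functor orb_ob orb_rel)) K \<and>
    (\<forall>w. is_functor Q Z w \<longrightarrow> feq M (func_comp w (quot_functor orb_ob orb_rel)) K \<longrightarrow> feq Q w v)"
    by blast
qed

end


section \<open>Free groups and surface groups\<close>

definition word_eval :: "('k, 'z) monoid_scheme \<Rightarrow> ('x \<Rightarrow> 'k) \<Rightarrow> ('x \<times> bool) list \<Rightarrow> 'k" where
  "word_eval K x w = foldr (\<lambda>(i, s) a. (if s then x i else inv\<^bsub>K\<^esub> x i) \<otimes>\<^bsub>K\<^esub> a) w \<one>\<^bsub>K\<^esub>"

lemma word_eval_simps [simp]:
  "word_eval K x [] = \<one>\<^bsub>K\<^esub>"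
  "word_eval K x ((i, s) # w) = (if s then x i else inv\<^bsub>K\<^esub> x i) \<otimes>\<^bsub>K\<^esub> word_eval K x w"
  by (simp_all add: word_eval_def)

lemma word_eval_closed:
  assumes "group K" "x \<in> S \<rightarrow> carrier K" "w \<in> lists (S \<times> UNIV)"
  shows "word_eval K x w \<in> carrier K"
proof -
  interpret group K by fact
  from assms(3) show ?thesis
    by induction (use assms(2) in \<open>auto simp: Pi_iff\<close>)
qed

lemma word_eval_append:
  assumes "group K" "x \<in> S \<rightarrow> carrier K" "u \<in> lists (S \<times> UNIV)" "v \<in> lists (S \<times> UNIV)"
  shows "word_eval K x (u @ v) = word_eval K x u \<otimes>\<^bsub>K\<^esub> word_eval K x v"
proof -
  interpret group K by fact
  note closed = word_eval_closed[OF assms(1,2)]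
  from assms(3) show ?thesis
  proof induction
    case (Cons l u)
    then obtain i s where "l = (i, s)" "i \<in> S" by auto
    with assms(2) Cons closed[OF Cons(2)] closed[OF assms(4)] show ?case
      by (auto simp: Pi_iff m_assoc)
  qed (simp add: closed assms(4))
qed

lemma word_eval_cong:
  assumes "w \<in> lists (S \<times> UNIV)" "\<And>i. i \<in> S \<Longrightarrow> x i = y i"
  shows "word_eval K x w = word_eval K y w"
  using assms(1) by induction (auto simp: assms(2))

lemma word_eval_word_rel:
  assumes "group K" "x \<in> S \<rightarrow> carrier K" "(u, v) \<in> word_rel S"
  shows "word_eval K x u = word_eval K x v"
  using assms(3) unfolding word_rel_def
proof (rule gen_equiv_eq)
  interpret group K by fact
  fix u v
  assume "(u, v) \<in> {(u @ [(x, s), (x, \<not> s)] @ v, u @ v) |u v x s.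
    u \<in> lists (S \<times> UNIV) \<and> v \<in> lists (S \<times> UNIV) \<and> x \<in> S}"
  then obtain p q i s where *: "u = p @ [(i, s), (i, \<not> s)] @ q" "v = p @ q"
    "p \<in> lists (S \<times> UNIV)" "q \<in> lists (S \<times> UNIV)" "i \<in> S" by auto
  moreover have "[(i, s), (i, \<not> s)] @ q \<in> lists (S \<times> UNIV)" using * by auto
  moreover have "x i \<in> carrier K" using assms(2) * by auto
  moreover have "word_eval K x q \<in> carrier K" using word_eval_closed[OF assms(1,2)] * by auto
  ultimately show "word_eval K x u = word_eval K x v"
    by (simp add: word_eval_append[OF assms(1,2)] m_assoc[symmetric] del: append.simps)
qed

section \<open>Free groups as classes of words\<close>

lemma equiv_word_rel: "equiv UNIV (word_rel S)"
  unfolding word_rel_def by (rule equiv_gen_equiv)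

lemma word_rel_class_eq_iff: "word_rel S `` {u} = word_rel S `` {v} \<longleftrightarrow> (u, v) \<in> word_rel S"
  using eq_equiv_class_iff[OF equiv_word_rel] by simp

lemma word_rel_closed: "(u, v) \<in> word_rel S \<Longrightarrow> u \<in> lists (S \<times> UNIV) \<longleftrightarrow> v \<in> lists (S \<times> UNIV)"
  unfolding word_rel_def by (rule gen_equiv_closed) auto

lemma word_rel_append:
  assumes "(u, u') \<in> word_rel S" "(v, v') \<in> word_rel S" "u \<in> lists (S \<times> UNIV)" "v \<in> lists (S \<times> UNIV)"
  shows "(u @ v, u' @ v') \<in> word_rel S"
proof -
  have "(u @ v, u' @ v) \<in> word_rel S"
    using assms(1) unfolding word_rel_def
  proof (rule gen_equiv_map[where f = "\<lambda>w. w @ v"])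
    fix a b
    assume "(a, b) \<in> {(u @ [(x, s), (x, \<not> s)] @ v, u @ v) |u v x s.
      u \<in> lists (S \<times> UNIV) \<and> v \<in> lists (S \<times> UNIV) \<and> x \<in> S}"
    then obtain p q i s where "a = p @ [(i, s), (i, \<not> s)] @ q" "b = p @ q"
      "p \<in> lists (S \<times> UNIV)" "q \<in> lists (S \<times> UNIV)" "i \<in> S" by auto
    with assms(4) have "a @ v = p @ [(i, s), (i, \<not> s)] @ (q @ v)" "b @ v = p @ (q @ v)"
      "q @ v \<in> lists (S \<times> UNIV)" by auto
    with \<open>p \<in> _\<close> \<open>i \<in> S\<close> show "(a @ v, b @ v) \<in> gen_equiv {(u @ [(x, s), (x, \<not> s)] @ v, u @ v) |u v x s.
      u \<in> lists (S \<times> UNIV) \<and> v \<in> lists (S \<times> UNIV) \<and> x \<in> S}"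
      by (intro gen_equiv_base) blast
  qed
  moreover have "(u' @ v, u' @ v') \<in> word_rel S"
    using assms(2) unfolding word_rel_def
  proof (rule gen_equiv_map[where f = "\<lambda>w. u' @ w"])
    fix a b
    assume "(a, b) \<in> {(u @ [(x, s), (x, \<not> s)] @ v, u @ v) |u v x s.
      u \<in> lists (S \<times> UNIV) \<and> v \<in> lists (S \<times> UNIV) \<and> x \<in> S}"
    then obtain p q i s where "a = p @ [(i, s), (i, \<not> s)] @ q" "b = p @ q"
      "p \<in> lists (S \<times> UNIV)" "q \<in> lists (S \<times> UNIV)" "i \<in> S" by auto
    moreover have "u' \<in> lists (S \<times> UNIV)" using assms(1,3) word_rel_closed by blast
    ultimately have "u' @ a = (u' @ p) @ [(i, s), (i, \<not> s)] @ q" "u' @ b = (u' @ p) @ q"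
      "u' @ p \<in> lists (S \<times> UNIV)" by auto
    with \<open>q \<in> _\<close> \<open>i \<in> S\<close> show "(u' @ a, u' @ b) \<in> gen_equiv {(u @ [(x, s), (x, \<not> s)] @ v, u @ v) |u v x s.
      u \<in> lists (S \<times> UNIV) \<and> v \<in> lists (S \<times> UNIV) \<and> x \<in> S}"
      by (intro gen_equiv_base) blast
  qed
  ultimately show ?thesis
    unfolding word_rel_def by (rule gen_equiv_trans)
qed

lemma free_group_mult:
  assumes "u \<in> lists (S \<times> UNIV)" "v \<in> lists (S \<times> UNIV)"
  shows "word_rel S `` {u} \<otimes>\<^bsub>free_group S\<^esub> word_rel S `` {v} = word_rel S `` {u @ v}"
proof -
  have "word_rel S `` {u' @ v'} = word_rel S `` {u @ v}"
    if "u' \<in> word_rel S `` {u}" "v' \<in> word_rel S `` {v}" for u' v'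
    using word_rel_append[of u u' S v v'] that assms word_rel_class_eq_iff by (metis Image_singleton_iff)
  moreover have "u \<in> word_rel S `` {u}" "v \<in> word_rel S `` {v}"
    by (simp_all add: word_rel_def)
  ultimately have "(\<Union>u'\<in>word_rel S `` {u}. \<Union>v'\<in>word_rel S `` {v}. word_rel S `` {u' @ v'}) = word_rel S `` {u @ v}"
    by blast
  then show ?thesis by (simp add: free_group_def)
qed

lemma free_group_carrier: "carrier (free_group S) = (\<lambda>w. word_rel S `` {w}) ` lists (S \<times> UNIV)"
  by (auto simp: free_group_def quotient_def)

lemma free_group_one: "\<one>\<^bsub>free_group S\<^esub> = word_rel S `` {[]}"
  by (simp add: free_group_def)

lemma free_group_cancel:
  assumes "i \<in> S"
  shows "word_rel S `` {[(i, s), (i, \<not> s)]} = \<one>\<^bsub>free_group S\<^esub>"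
proof -
  have "([] @ [(i, s), (i, \<not> s)] @ [], [] @ []) \<in> word_rel S"
    unfolding word_rel_def using assms by (intro gen_equiv_base) blast
  then show ?thesis by (simp add: free_group_one word_rel_class_eq_iff)
qed

lemma group_free_group: "group (free_group S)"
proof (rule groupI)
  fix a b c assume abc: "a \<in> carrier (free_group S)" "b \<in> carrier (free_group S)" "c \<in> carrier (free_group S)"
  then obtain u v w where *: "u \<in> lists (S \<times> UNIV)" "v \<in> lists (S \<times> UNIV)" "w \<in> lists (S \<times> UNIV)"
    "a = word_rel S `` {u}" "b = word_rel S `` {v}" "c = word_rel S `` {w}"
    by (auto simp: free_group_carrier)
  moreover have "u @ v \<in> lists (S \<times> UNIV)" "v @ w \<in> lists (S \<times> UNIV)" using * by auto
  ultimately show "a \<otimes>\<^bsub>free_group S\<^esub> b \<otimes>\<^bsub>free_group S\<^esub> c = a \<otimes>\<^bsub>free_group S\<^esub> (b \<otimes>\<^bsub>free_group S\<^esub> c)"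
    by (simp add: free_group_mult)
next
  fix a b assume "a \<in> carrier (free_group S)" "b \<in> carrier (free_group S)"
  then obtain u v where *: "u \<in> lists (S \<times> UNIV)" "v \<in> lists (S \<times> UNIV)"
    "a = word_rel S `` {u}" "b = word_rel S `` {v}"
    by (auto simp: free_group_carrier)
  then have "u @ v \<in> lists (S \<times> UNIV)" by auto
  with * show "a \<otimes>\<^bsub>free_group S\<^esub> b \<in> carrier (free_group S)"
    by (simp add: free_group_mult free_group_carrier)
next
  show "\<one>\<^bsub>free_group S\<^esub> \<in> carrier (free_group S)"
    by (simp add: free_group_one free_group_carrier)
next
  fix a assume "a \<in> carrier (free_group S)"
  then obtain u where u: "u \<in> lists (S \<times> UNIV)" "a = word_rel S `` {u}"
    by (auto simp: free_group_carrier)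
  then show "\<one>\<^bsub>free_group S\<^esub> \<otimes>\<^bsub>free_group S\<^esub> a = a"
    by (simp add: free_group_one free_group_mult)
  \<comment> \<open>A left inverse is built along the word: if \<open>v\<close> is one for
    \<open>u\<close>, then \<open>v\<close> followed by the opposite of the letter \<open>l\<close>
    is one for \<open>l # u\<close>.\<close>
  have "\<exists>v\<in>lists (S \<times> UNIV). (v @ u, []) \<in> word_rel S"
    using u(1)
  proof induction
    case Nil
    show ?case by (intro bexI[of _ "[]"]) (simp_all add: word_rel_def)
  next
    case (Cons l u)
    obtain i s where l: "l = (i, s)" "i \<in> S" using Cons by auto
    from Cons obtain v where v: "v \<in> lists (S \<times> UNIV)" "(v @ u, []) \<in> word_rel S" by blast
    \<comment> \<open>The double negation gives the pair of letters literally the shape of a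
      generator of \<open>word_rel\<close>, with \<open>\<not> s\<close> as its sign.\<close>
    have "((v @ [(i, \<not> s), (i, \<not> \<not> s)]) @ u, v @ u) \<in> word_rel S"
      unfolding word_rel_def append_assoc using v Cons l by (intro gen_equiv_base) blast
    with v have "((v @ [(i, \<not> s)]) @ l # u, []) \<in> word_rel S"
      unfolding word_rel_def using gen_equiv_trans l by fastforce
    moreover have "v @ [(i, \<not> s)] \<in> lists (S \<times> UNIV)" using v l by auto
    ultimately show ?case by blast
  qed
  then obtain v where "v \<in> lists (S \<times> UNIV)" "(v @ u, []) \<in> word_rel S" by blast
  with u show "\<exists>b\<in>carrier (free_group S). b \<otimes>\<^bsub>free_group S\<^esub> a = \<one>\<^bsub>free_group S\<^esub>"
    unfolding free_group_carrier
    by (intro bexI[of _ "word_rel S `` {v}"] imageI)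
      (simp_all add: free_group_mult free_group_one word_rel_class_eq_iff)
qed

lemma free_gen_carrier: "i \<in> S \<Longrightarrow> free_gen S i \<in> carrier (free_group S)"
  by (auto simp: free_gen_def free_group_carrier)

lemma free_group_inv_gen:
  assumes "i \<in> S"
  shows "inv\<^bsub>free_group S\<^esub> (free_gen S i) = word_rel S `` {[(i, False)]}"
proof (rule group.inv_equality[OF group_free_group])
  show "word_rel S `` {[(i, False)]} \<otimes>\<^bsub>free_group S\<^esub> free_gen S i = \<one>\<^bsub>free_group S\<^esub>"
    using assms free_group_cancel[of i S False] by (simp add: free_gen_def free_group_mult)
  show "word_rel S `` {[(i, False)]} \<in> carrier (free_group S)"
    using assms by (auto simp: free_group_carrier)
qed (rule free_gen_carrier[OF assms])

lemma hom_word_eval: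
  assumes K: "group K" and h: "h \<in> hom (free_group S) K" and w: "w \<in> lists (S \<times> UNIV)"
  shows "h (word_rel S `` {w}) = word_eval K (\<lambda>i. h (free_gen S i)) w"
proof -
  interpret h: group_hom "free_group S" K h
    using K h group_free_group by (simp add: group_hom_def group_hom_axioms_def)
  from w show ?thesis
  proof induction
    case Nil
    show ?case using h.hom_one by (simp add: free_group_one)
  next
    case (Cons l w)
    obtain i s where l: "l = (i, s)" "i \<in> S" using Cons by auto
    have "word_rel S `` {[l]} = (if s then free_gen S i else inv\<^bsub>free_group S\<^esub> (free_gen S i))"
      by (simp add: l free_gen_def[symmetric] free_group_inv_gen)
    then have "h (word_rel S `` {[l]}) = (if s then h (free_gen S i) else inv\<^bsub>K\<^esub> h (free_gen S i))"
      using l h.hom_inv[OF free_gen_carrier[OF l(2)]] by simp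
    moreover have "[l] \<in> lists (S \<times> UNIV)" using l by simp
    then have "h (word_rel S `` {[l] @ w}) = h (word_rel S `` {[l]}) \<otimes>\<^bsub>K\<^esub> h (word_rel S `` {w})"
      using Cons by (subst free_group_mult[symmetric]) (auto simp: free_group_carrier)
    ultimately show ?case by (simp add: l Cons)
  qed
qed

section \<open>Homomorphisms and the universal property of free groups\<close>

lemma HomsD:
  assumes "\<tau> \<in> Homs K L"
  shows Homs_hom: "\<tau> \<in> hom K L" and Homs_closed: "x \<in> carrier K \<Longrightarrow> \<tau> x \<in> carrier L"
    and Homs_mult: "x \<in> carrier K \<Longrightarrow> y \<in> carrier K \<Longrightarrow> \<tau> (x \<otimes>\<^bsub>K\<^esub> y) = \<tau> x \<otimes>\<^bsub>L\<^esub> \<tau> y"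
    and Homs_extensional: "\<tau> \<in> extensional (carrier K)"
  using assms by (auto simp: Homs_def hom_def)

lemma HomsI:
  assumes "\<And>x. x \<in> carrier K \<Longrightarrow> \<tau> x \<in> carrier L"
    and "\<And>x y. x \<in> carrier K \<Longrightarrow> y \<in> carrier K \<Longrightarrow> \<tau> (x \<otimes>\<^bsub>K\<^esub> y) = \<tau> x \<otimes>\<^bsub>L\<^esub> \<tau> y"
    and "\<tau> \<in> extensional (carrier K)"
  shows "\<tau> \<in> Homs K L"
  using assms by (auto simp: Homs_def hom_def)

lemma Homs_restrict:
  assumes "h \<in> hom K L" "group K"
  shows "restrict h (carrier K) \<in> Homs K L"
proof -
  interpret group K by fact
  show ?thesis using assms(1) by (auto simp: Homs_def hom_def Pi_iff)
qed

text \<open>The family \<open>e\<close> is a parameter so that \<open>free_gen\<close> and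
  \<open>pi1_gen\<close> are treated alike and homomorphisms on either group can be compared as
  tuples in \<open>M_cat\<close>.\<close>

definition on_gens :: "('i \<Rightarrow> 'k) \<Rightarrow> 'i set \<Rightarrow> ('k \<Rightarrow> 'l) \<Rightarrow> 'i \<Rightarrow> 'l" where
  "on_gens e S \<tau> = (\<lambda>i\<in>S. \<tau> (e i))"

theorem free_group_universal:
  assumes K: "group K"
  shows "bij_betw (on_gens (free_gen S) S) (Homs (free_group S) K) (S \<rightarrow>\<^sub>E carrier K)"
proof (rule bij_betw_imageI)
  show "inj_on (on_gens (free_gen S) S) (Homs (free_group S) K)"
  proof (rule inj_onI)
    fix h h' assume h: "h \<in> Homs (free_group S) K" "h' \<in> Homs (free_group S) K"
      and eq: "on_gens (free_gen S) S h = on_gens (free_gen S) S h'"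
    have gen: "h (free_gen S i) = h' (free_gen S i)" if "i \<in> S" for i
      using fun_cong[OF eq, of i] that by (simp add: on_gens_def)
    show "h = h'"
      using Homs_extensional[OF h(1)] Homs_extensional[OF h(2)]
    proof (rule extensionalityI)
      fix a assume "a \<in> carrier (free_group S)"
      then obtain w where "w \<in> lists (S \<times> UNIV)" "a = word_rel S `` {w}"
        by (auto simp: free_group_carrier)
      then show "h a = h' a"
        using hom_word_eval[OF K Homs_hom[OF h(1)]] hom_word_eval[OF K Homs_hom[OF h(2)]]
          word_eval_cong[OF _ gen] by simp
    qed
  qed
  show "on_gens (free_gen S) S ` Homs (free_group S) K = S \<rightarrow>\<^sub>E carrier K"
  proof (intro equalityI subsetI)
    fix x assume x: "x \<in> S \<rightarrow>\<^sub>E carrier K"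
    then have x': "x \<in> S \<rightarrow> carrier K" by auto
    \<comment> \<open>Evaluation is constant on each class by \<open>word_eval_word_rel\<close>, so
      an arbitrary word of the class may be evaluated.\<close>
    define h where "h = (\<lambda>a\<in>carrier (free_group S). word_eval K x (SOME w. w \<in> a))"
    have h: "h (word_rel S `` {w}) = word_eval K x w" if "w \<in> lists (S \<times> UNIV)" for w
    proof -
      have "w \<in> word_rel S `` {w}" by (simp add: word_rel_def)
      then have "(w, SOME v. v \<in> word_rel S `` {w}) \<in> word_rel S"
        using someI[of "\<lambda>v. v \<in> word_rel S `` {w}" w] by simp
      with word_eval_word_rel[OF K x' this] that show ?thesis
        by (simp add: h_def free_group_carrier)
    qed
    have "h \<in> Homs (free_group S) K"
    proof (rule HomsI)
      show "h \<in> extensional (carrier (free_group S))" by (simp add: h_def)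
    next
      fix a assume "a \<in> carrier (free_group S)"
      then obtain u where "u \<in> lists (S \<times> UNIV)" "a = word_rel S `` {u}"
        by (auto simp: free_group_carrier)
      then show "h a \<in> carrier K"
        using word_eval_closed[OF K x'] by (simp add: h)
    next
      fix a b assume "a \<in> carrier (free_group S)" "b \<in> carrier (free_group S)"
      then obtain u v where *: "u \<in> lists (S \<times> UNIV)" "v \<in> lists (S \<times> UNIV)"
        "a = word_rel S `` {u}" "b = word_rel S `` {v}"
        by (auto simp: free_group_carrier)
      then have "u @ v \<in> lists (S \<times> UNIV)" by auto
      with * show "h (a \<otimes>\<^bsub>free_group S\<^esub> b) = h a \<otimes>\<^bsub>K\<^esub> h b"
        by (simp add: free_group_mult h word_eval_append[OF K x'])
    qed
    moreover have "on_gens (free_gen S) S h = x"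
    proof
      fix i
      interpret group K by fact
      show "on_gens (free_gen S) S h i = x i"
      proof (cases "i \<in> S")
        case True
        with x' h[of "[(i, True)]"] show ?thesis by (simp add: on_gens_def free_gen_def Pi_iff)
      qed (simp add: on_gens_def PiE_arb[OF x])
    qed
    ultimately show "x \<in> on_gens (free_gen S) S ` Homs (free_group S) K" by blast
  qed (auto simp: on_gens_def Homs_closed free_gen_carrier)
qed

section \<open>Surface words\<close>

lemma commutator_closed:
  assumes "group K" "x \<in> carrier K" "y \<in> carrier K"
  shows "commutator K x y \<in> carrier K"
proof -
  interpret group K by fact
  show ?thesis using assms(2,3) by (simp add: commutator_def)
qed

lemma sgens_Suc: "sgens (Suc n) = {Alpha (Suc n), Beta (Suc n)} \<union> sgens n"
  by (auto simp: sgens_def atLeastAtMostSuc_conv)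

lemma surface_word_closed:
  assumes "group K"
  shows "x \<in> sgens g \<rightarrow> carrier K \<Longrightarrow> surface_word K g x \<in> carrier K"
proof (induction g)
  interpret group K by fact
  case (Suc n)
  then show ?case by (simp add: sgens_Suc commutator_closed[OF assms])
qed (simp add: assms group.is_monoid)

lemma surface_word_cong:
  "(\<And>i. i \<in> sgens g \<Longrightarrow> x i = y i) \<Longrightarrow> surface_word K g x = surface_word K g y"
  by (induction g) (simp_all add: sgens_Suc)

text \<open>Besides the relation in \<open>pi1 g\<close>, this yields the functoriality of
  \<open>coact_functor\<close>: it is applied to \<open>Dom H\<close>, \<open>Cod H\<close>,
  \<open>Idn H\<close> and, on composable pairs, to composition.\<close>

lemma surface_word_hom:
  assumes K: "group K" and L: "group L" and h: "h \<in> hom K L"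
  shows "x \<in> sgens g \<rightarrow> carrier K \<Longrightarrow> h (surface_word K g x) = surface_word L g (\<lambda>i. h (x i))"
proof -
  interpret h: group_hom K L h
    using K L h by (simp add: group_hom_def group_hom_axioms_def)
  show "x \<in> sgens g \<rightarrow> carrier K \<Longrightarrow> h (surface_word K g x) = surface_word L g (\<lambda>i. h (x i))"
  proof (induction g)
    case (Suc n)
    then show ?case
      by (simp add: sgens_Suc surface_word_closed[OF K] commutator_closed[OF K])
        (simp add: commutator_def)
  qed simp
qed

section \<open>The surface group and its universal property\<close>

lemma group_F2g: "group (F2g g)"
  by (simp add: F2g_def group_free_group)

lemma free_gen_F2g: "i \<in> sgens g \<Longrightarrow> free_gen (sgens g) i \<in> carrier (F2g g)"
  by (simp add: F2g_def free_gen_carrier)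

lemma normal_relator_closure: "relator_closure g \<lhd> F2g g"
proof -
  interpret group "F2g g" by (rule group_F2g)
  let ?\<N> = "{N. N \<lhd> F2g g \<and> surface_word (F2g g) g (free_gen (sgens g)) \<in> N}"
  \<comment> \<open>The whole group witnesses that the family is nonempty; an empty intersection
    would be the whole type and not a subgroup.\<close>
  have "carrier (F2g g) \<lhd> F2g g" by (simp add: normal_inv_iff subgroup_self)
  moreover have "surface_word (F2g g) g (free_gen (sgens g)) \<in> carrier (F2g g)"
    by (intro surface_word_closed group_F2g) (simp add: free_gen_F2g)
  ultimately have "?\<N> \<noteq> {}" by blast
  then have "subgroup (\<Inter> ?\<N>) (F2g g)"
    by (intro subgroups_Inter) (auto simp: normal_imp_subgroup)
  then show ?thesis
    unfolding relator_closure_def normal_inv_iff by (auto simp: normal_inv_iff)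
qed

lemma relator_in_relator_closure:
  "surface_word (F2g g) g (free_gen (sgens g)) \<in> relator_closure g"
  by (simp add: relator_closure_def)

lemma group_pi1: "group (pi1 g)"
  unfolding pi1_def by (rule normal.factorgroup_is_group[OF normal_relator_closure])

lemma pi1_proj_hom: "pi1_proj g \<in> hom (F2g g) (pi1 g)"
  unfolding pi1_def pi1_proj_def by (rule normal.r_coset_hom_Mod[OF normal_relator_closure])

lemma pi1_proj_carrier: "x \<in> carrier (F2g g) \<Longrightarrow> pi1_proj g x \<in> carrier (pi1 g)"
  using pi1_proj_hom by (auto simp: hom_def)

lemma pi1_carrier: "carrier (pi1 g) = pi1_proj g ` carrier (F2g g)"
  unfolding pi1_def pi1_proj_def by (rule carrier_FactGroup)

lemma pi1_gen_carrier: "i \<in> sgens g \<Longrightarrow> pi1_gen g i \<in> carrier (pi1 g)"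
  by (simp add: pi1_gen_def pi1_proj_carrier free_gen_F2g)

lemma pi1_relation: "surface_word (pi1 g) g (pi1_gen g) = \<one>\<^bsub>pi1 g\<^esub>"
proof -
  interpret normal "relator_closure g" "F2g g" by (rule normal_relator_closure)
  have "pi1_proj g (surface_word (F2g g) g (free_gen (sgens g))) = surface_word (pi1 g) g (pi1_gen g)"
    unfolding pi1_gen_def
    by (rule surface_word_hom[OF group_F2g group_pi1 pi1_proj_hom]) (simp add: free_gen_F2g)
  moreover have "pi1_proj g (surface_word (F2g g) g (free_gen (sgens g))) = relator_closure g"
    unfolding pi1_proj_def
    by (rule rcos_const) (simp_all add: relator_in_relator_closure group_F2g)
  ultimately show ?thesis by (simp add: pi1_def)
qed

lemma inflate_Homs:
  assumes "\<tau> \<in> Homs (pi1 g) L"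
  shows "inflate g \<tau> \<in> Homs (F2g g) L"
proof -
  have "(\<lambda>x. \<tau> (pi1_proj g x)) \<in> hom (F2g g) L"
    using hom_compose[OF pi1_proj_hom Homs_hom[OF assms]] by (simp add: o_def)
  then show ?thesis unfolding inflate_def by (rule Homs_restrict[OF _ group_F2g])
qed

text \<open>Since inflation keeps the values on generators, \<open>prot_rel\<close>, which is
  defined through homomorphisms on \<open>F2g g\<close>, can be studied on the tuples of
  homomorphisms on \<open>pi1 g\<close>.\<close>

lemma on_gens_inflate:
  "on_gens (free_gen (sgens g)) (sgens g) (inflate g \<tau>) = on_gens (pi1_gen g) (sgens g) \<tau>"
  by (auto simp: on_gens_def inflate_def pi1_gen_def free_gen_F2g)

lemma F2g_universal:
  "group K \<Longrightarrow> bij_betw (on_gens (free_gen (sgens g)) (sgens g)) (Homs (F2g g) K) (sgens g \<rightarrow>\<^sub>E carrier K)"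
  unfolding F2g_def by (rule free_group_universal)

text \<open>A tuple extends to the free group. If its surface word is trivial, the kernel of the
  extension is a normal subgroup containing the relator, hence contains
  \<open>relator_closure g\<close>, and the extension factors. Uniqueness is inherited from the free
  group by inflation.\<close>

theorem pi1_universal:
  assumes L: "group L"
  shows "bij_betw (on_gens (pi1_gen g) (sgens g)) (Homs (pi1 g) L)
    {x \<in> sgens g \<rightarrow>\<^sub>E carrier L. surface_word L g x = \<one>\<^bsub>L\<^esub>}"
proof (rule bij_betw_imageI)
  show "inj_on (on_gens (pi1_gen g) (sgens g)) (Homs (pi1 g) L)"
  proof (rule inj_onI)
    fix \<tau> \<tau>' assume \<tau>: "\<tau> \<in> Homs (pi1 g) L" "\<tau>' \<in> Homs (pi1 g) L"
      "on_gens (pi1_gen g) (sgens g) \<tau> = on_gens (pi1_gen g) (sgens g) \<tau>'"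
    then have "inflate g \<tau> = inflate g \<tau>'"
      by (intro inj_onD[OF bij_betw_imp_inj_on[OF F2g_universal[OF L, of g]]])
        (simp_all add: on_gens_inflate inflate_Homs)
    then have eq: "\<tau> (pi1_proj g x) = \<tau>' (pi1_proj g x)" if "x \<in> carrier (F2g g)" for x
      using that by (metis inflate_def restrict_apply')
    show "\<tau> = \<tau>'"
      using Homs_extensional[OF \<tau>(1)] Homs_extensional[OF \<tau>(2)]
      by (rule extensionalityI) (auto simp: pi1_carrier eq)
  qed
  show "on_gens (pi1_gen g) (sgens g) ` Homs (pi1 g) L = {x \<in> sgens g \<rightarrow>\<^sub>E carrier L. surface_word L g x = \<one>\<^bsub>L\<^esub>}"
  proof (intro equalityI subsetI)
    fix x assume "x \<in> on_gens (pi1_gen g) (sgens g) ` Homs (pi1 g) L"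
    then obtain \<tau> where \<tau>: "\<tau> \<in> Homs (pi1 g) L" "x = on_gens (pi1_gen g) (sgens g) \<tau>" by blast
    have "surface_word L g x = surface_word L g (\<lambda>i. \<tau> (pi1_gen g i))"
      by (rule surface_word_cong) (simp add: \<tau>(2) on_gens_def)
    also have "\<dots> = \<tau> (surface_word (pi1 g) g (pi1_gen g))"
      by (rule surface_word_hom[OF group_pi1 L Homs_hom[OF \<tau>(1)], symmetric]) (simp add: pi1_gen_carrier)
    also have "\<dots> = \<one>\<^bsub>L\<^esub>"
      using hom_one[OF Homs_hom[OF \<tau>(1)] group_pi1 L] by (simp add: pi1_relation)
    finally show "x \<in> {x \<in> sgens g \<rightarrow>\<^sub>E carrier L. surface_word L g x = \<one>\<^bsub>L\<^esub>}"
      using \<tau> by (auto simp: on_gens_def Homs_closed pi1_gen_carrier)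
  next
    fix x assume "x \<in> {x \<in> sgens g \<rightarrow>\<^sub>E carrier L. surface_word L g x = \<one>\<^bsub>L\<^esub>}"
    then have x: "x \<in> sgens g \<rightarrow>\<^sub>E carrier L" "surface_word L g x = \<one>\<^bsub>L\<^esub>" by auto
    then obtain h where h: "h \<in> Homs (F2g g) L" "x = on_gens (free_gen (sgens g)) (sgens g) h"
      using bij_betw_imp_surj_on[OF F2g_universal[OF L, of g]] by blast
    interpret h: group_hom "F2g g" L h
      using group_F2g L Homs_hom[OF h(1)] by (simp add: group_hom_def group_hom_axioms_def)
    interpret N: normal "relator_closure g" "F2g g" by (rule normal_relator_closure)
    have "h (surface_word (F2g g) g (free_gen (sgens g))) = surface_word L g (\<lambda>i. h (free_gen (sgens g) i))"
      by (rule surface_word_hom[OF group_F2g L Homs_hom[OF h(1)]]) (simp add: free_gen_F2g)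
    also have "\<dots> = surface_word L g x"
      by (rule surface_word_cong) (simp add: h(2) on_gens_def)
    finally have "surface_word (F2g g) g (free_gen (sgens g)) \<in> kernel (F2g g) L h"
      using x surface_word_closed[OF group_F2g, of "free_gen (sgens g)" g]
      by (simp add: kernel_def free_gen_F2g)
    with h.normal_kernel have sub: "relator_closure g \<subseteq> kernel (F2g g) L h"
      unfolding relator_closure_def by blast
    have factor: "h a = h b"
      if ab: "a \<in> carrier (F2g g)" "b \<in> carrier (F2g g)" "relator_closure g #>\<^bsub>F2g g\<^esub> a = relator_closure g #>\<^bsub>F2g g\<^esub> b"
      for a b
    proof -
      have "a \<in> relator_closure g #>\<^bsub>F2g g\<^esub> b"
        using group.rcos_self[OF group_F2g ab(1) N.subgroup_axioms] ab(3) by simp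
      then obtain n where n: "n \<in> relator_closure g" "a = n \<otimes>\<^bsub>F2g g\<^esub> b"
        by (auto simp: r_coset_def)
      with sub have "n \<in> carrier (F2g g)" "h n = \<one>\<^bsub>L\<^esub>" by (auto simp: kernel_def)
      with n ab show "h a = h b" by simp
    qed
    obtain \<tau> where \<tau>: "\<tau> \<in> hom (pi1 g) L" "\<And>a. a \<in> carrier (F2g g) \<Longrightarrow> \<tau> (pi1_proj g a) = h a"
      using FactGroup_universal[OF Homs_hom[OF h(1)] normal_relator_closure factor]
      unfolding pi1_def pi1_proj_def by blast
    have "on_gens (pi1_gen g) (sgens g) (restrict \<tau> (carrier (pi1 g))) = x"
      by (auto simp: h(2) on_gens_def pi1_gen_carrier fun_eq_iff) (simp add: pi1_gen_def \<tau>(2) free_gen_F2g)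
    with Homs_restrict[OF \<tau>(1) group_pi1]
    show "x \<in> on_gens (pi1_gen g) (sgens g) ` Homs (pi1 g) L" by blast
  qed
qed


section \<open>Crossed modules\<close>

lemma conj_fun_closed:
  assumes "group L" "h \<in> carrier L" "x \<in> S \<rightarrow> carrier L"
  shows "conj_fun L S h x \<in> S \<rightarrow>\<^sub>E carrier L"
proof -
  interpret group L by fact
  show ?thesis using assms by (auto simp: conj_fun_def Pi_iff)
qed

lemma conj_fun_one:
  assumes "group L" "x \<in> S \<rightarrow>\<^sub>E carrier L"
  shows "conj_fun L S \<one>\<^bsub>L\<^esub> x = x"
proof -
  interpret group L by fact
  have "conj_fun L S \<one>\<^bsub>L\<^esub> x = (\<lambda>i\<in>S. x i)"
    unfolding conj_fun_def by (intro restrict_ext) (simp add: PiE_mem[OF assms(2)])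
  then show ?thesis using PiE_restrict[OF assms(2)] by simp
qed

lemma conj_fun_mult:
  assumes "group L" "h \<in> carrier L" "k \<in> carrier L" "x \<in> S \<rightarrow> carrier L"
  shows "conj_fun L S (h \<otimes>\<^bsub>L\<^esub> k) x = conj_fun L S h (conj_fun L S k x)"
proof -
  interpret group L by fact
  show ?thesis
    unfolding conj_fun_def using assms
    by (intro restrict_ext) (auto simp: Pi_iff inv_mult_group m_assoc)
qed

lemma conj_fun_hom:
  assumes "group K" "group L" "h \<in> hom K L" "k \<in> carrier K" "x \<in> S \<rightarrow> carrier K"
  shows "(\<lambda>i\<in>S. h (conj_fun K S k x i)) = conj_fun L S (h k) (\<lambda>i\<in>S. h (x i))"
proof -
  interpret h: group_hom K L h
    using assms by (simp add: group_hom_def group_hom_axioms_def)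
  show ?thesis
    unfolding conj_fun_def using assms(4,5) by (intro restrict_ext) (auto simp: Pi_iff)
qed

lemma conj_fun_Homs:
  assumes L: "group L" and h: "h \<in> carrier L" and \<tau>: "\<tau> \<in> Homs K L" and K: "group K"
  shows "conj_fun L (carrier K) h \<tau> \<in> Homs K L"
proof (rule HomsI)
  interpret L: group L by fact
  interpret K: group K by fact
  note [simp] = Homs_closed[OF \<tau>] Homs_mult[OF \<tau>] h
  fix x assume x: "x \<in> carrier K"
  then show "conj_fun L (carrier K) h \<tau> x \<in> carrier L" by (simp add: conj_fun_def)
  fix y assume y: "y \<in> carrier K"
  have "h \<otimes>\<^bsub>L\<^esub> \<tau> x \<otimes>\<^bsub>L\<^esub> inv\<^bsub>L\<^esub> h \<otimes>\<^bsub>L\<^esub> (h \<otimes>\<^bsub>L\<^esub> \<tau> y \<otimes>\<^bsub>L\<^esub> inv\<^bsub>L\<^esub> h) =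
      h \<otimes>\<^bsub>L\<^esub> \<tau> x \<otimes>\<^bsub>L\<^esub> (inv\<^bsub>L\<^esub> h \<otimes>\<^bsub>L\<^esub> h) \<otimes>\<^bsub>L\<^esub> \<tau> y \<otimes>\<^bsub>L\<^esub> inv\<^bsub>L\<^esub> h"
    using x y by (simp only: L.m_assoc L.m_closed L.inv_closed Homs_closed[OF \<tau>] h)
  with x y show "conj_fun L (carrier K) h \<tau> (x \<otimes>\<^bsub>K\<^esub> y) =
      conj_fun L (carrier K) h \<tau> x \<otimes>\<^bsub>L\<^esub> conj_fun L (carrier K) h \<tau> y"
    by (simp add: conj_fun_def L.m_assoc)
qed (simp add: conj_fun_def)

lemma on_gens_conj_fun:
  assumes "e \<in> S \<rightarrow> carrier K"
  shows "on_gens e S (conj_fun L (carrier K) h \<tau>) = conj_fun L S h (on_gens e S \<tau>)"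
  unfolding on_gens_def conj_fun_def using assms by (intro restrict_ext) (auto simp: Pi_iff)

lemma equiv_conjugacy:
  assumes K: "group K" and L: "group L"
  shows "equiv (Homs K L) (conjugacy K L)"
proof -
  have Pi: "\<rho> \<in> carrier K \<rightarrow>\<^sub>E carrier L" if "\<rho> \<in> Homs K L" for \<rho>
    using that by (auto simp: Homs_def hom_def PiE_def)
  show ?thesis
    unfolding conjugacy_def
    by (rule equiv_orbits[OF L])
      (use Pi in \<open>auto simp: conj_fun_Homs[OF L _ _ K] conj_fun_one[OF L] intro!: conj_fun_mult[OF L]\<close>)
qed

text \<open>A conjugate of a homomorphism is again one and is determined by its values on the
  generators, so the same \<open>h\<close> serves on both sides. It is used for \<open>pi1 g\<close>
  into \<open>B\<close> and for \<open>F2g g\<close> into the semidirect product.\<close>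

lemma conjugacy_iff:
  assumes K: "group K" and L: "group L" and e: "e \<in> S \<rightarrow> carrier K"
    and inj: "inj_on (on_gens e S) (Homs K L)"
    and \<tau>: "\<tau> \<in> Homs K L" "\<tau>' \<in> Homs K L"
  shows "(\<tau>, \<tau>') \<in> conjugacy K L \<longleftrightarrow>
    (\<exists>h\<in>carrier L. on_gens e S \<tau>' = conj_fun L S h (on_gens e S \<tau>))"
proof
  assume "(\<tau>, \<tau>') \<in> conjugacy K L"
  then show "\<exists>h\<in>carrier L. on_gens e S \<tau>' = conj_fun L S h (on_gens e S \<tau>)"
    by (auto simp: conjugacy_def on_gens_conj_fun[OF e])
next
  assume "\<exists>h\<in>carrier L. on_gens e S \<tau>' = conj_fun L S h (on_gens e S \<tau>)"
  then obtain h where h: "h \<in> carrier L" "on_gens e S \<tau>' = on_gens e S (conj_fun L (carrier K) h \<tau>)"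
    by (auto simp: on_gens_conj_fun[OF e])
  then have "\<tau>' = conj_fun L (carrier K) h \<tau>"
    using inj_onD[OF inj, OF h(2)] conj_fun_Homs[OF L _ _ K] \<tau> by blast
  with h \<tau> show "(\<tau>, \<tau>') \<in> conjugacy K L" by (auto simp: conjugacy_def)
qed

lemma (in group) inv_mult_cancel [simp]:
  "x \<in> carrier G \<Longrightarrow> y \<in> carrier G \<Longrightarrow> inv x \<otimes> (x \<otimes> y) = y"
  "x \<in> carrier G \<Longrightarrow> y \<in> carrier G \<Longrightarrow> x \<otimes> (inv x \<otimes> y) = y"
  by (simp_all flip: m_assoc)

section \<open>The semidirect product and the category \<open>H\<close>\<close>

locale xmod =
  fixes B :: "'b monoid" and A :: "'a monoid" and act :: "'b \<Rightarrow> 'a \<Rightarrow> 'a" and d :: "'a \<Rightarrow> 'b"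
  assumes crossed_module: "crossed_module B A act d"
begin

sublocale B: group B using crossed_module by (simp add: crossed_module_def)
sublocale A: group A using crossed_module by (simp add: crossed_module_def)
sublocale d: group_hom A B d
  using crossed_module by (simp add: crossed_module_def group_hom_def group_hom_axioms_def)

abbreviation "G \<equiv> semidirect B A act"
abbreviation "H \<equiv> H_cat B A d"

lemma act_auto:
  assumes "b \<in> carrier B"
  shows "act b \<in> hom A A" "act b \<in> Bij (carrier A)"
proof -
  have "act \<in> hom B (AutoGroup A)" using crossed_module by (simp add: crossed_module_def)
  then have "act b \<in> auto A" using assms by (auto simp: hom_def AutoGroup_def)
  then show "act b \<in> hom A A" "act b \<in> Bij (carrier A)" by (auto simp: auto_def)
qed

lemma act_closed [simp]: "b \<in> carrier B \<Longrightarrow> a \<in> carrier A \<Longrightarrow> act b a \<in> carrier A"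
  using act_auto(1) by (auto simp: hom_def)

lemma act_mult [simp]:
  "b \<in> carrier B \<Longrightarrow> a \<in> carrier A \<Longrightarrow> a' \<in> carrier A \<Longrightarrow> act b (a \<otimes>\<^bsub>A\<^esub> a') = act b a \<otimes>\<^bsub>A\<^esub> act b a'"
  using act_auto(1) by (auto simp: hom_def)

lemma act_one_right [simp]: "b \<in> carrier B \<Longrightarrow> act b \<one>\<^bsub>A\<^esub> = \<one>\<^bsub>A\<^esub>"
  using hom_one[OF act_auto(1) A.is_group A.is_group] .

lemma act_inv [simp]: "b \<in> carrier B \<Longrightarrow> a \<in> carrier A \<Longrightarrow> act b (inv\<^bsub>A\<^esub> a) = inv\<^bsub>A\<^esub> (act b a)"
  using group_hom.hom_inv[of A A "act b" a] act_auto(1)[of b]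
  by (simp add: group_hom_def group_hom_axioms_def)

lemma act_mult_left [simp]:
  assumes "b \<in> carrier B" "b' \<in> carrier B" "a \<in> carrier A"
  shows "act (b \<otimes>\<^bsub>B\<^esub> b') a = act b (act b' a)"
proof -
  have "act (b \<otimes>\<^bsub>B\<^esub> b') = act b \<otimes>\<^bsub>AutoGroup A\<^esub> act b'"
    using crossed_module assms by (auto simp: crossed_module_def hom_def)
  then show ?thesis
    using assms act_auto(2) by (simp add: AutoGroup_def BijGroup_def compose_def)
qed

text \<open>The unit acts by an idempotent map, by multiplicativity, and by an injective one, being
  an automorphism; hence by the identity.\<close>

lemma act_one_left [simp]:
  assumes "a \<in> carrier A"
  shows "act \<one>\<^bsub>B\<^esub> a = a"
proof (rule inj_onD)
  show "inj_on (act \<one>\<^bsub>B\<^esub>) (carrier A)" using act_auto(2)[of "\<one>\<^bsub>B\<^esub>"] by (auto simp: Bij_def bij_betw_def)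
  show "act \<one>\<^bsub>B\<^esub> (act \<one>\<^bsub>B\<^esub> a) = act \<one>\<^bsub>B\<^esub> a"
    using act_mult_left[of "\<one>\<^bsub>B\<^esub>" "\<one>\<^bsub>B\<^esub>" a] assms by simp
qed (use assms in simp_all)

lemma d_act [simp]:
  "b \<in> carrier B \<Longrightarrow> a \<in> carrier A \<Longrightarrow> d (act b a) = b \<otimes>\<^bsub>B\<^esub> d a \<otimes>\<^bsub>B\<^esub> inv\<^bsub>B\<^esub> b"
  and act_d [simp]:
  "a \<in> carrier A \<Longrightarrow> a' \<in> carrier A \<Longrightarrow> act (d a) a' = a \<otimes>\<^bsub>A\<^esub> a' \<otimes>\<^bsub>A\<^esub> inv\<^bsub>A\<^esub> a"
  using crossed_module by (simp_all add: crossed_module_def)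

lemma G_simps [simp]:
  "carrier G = carrier A \<times> carrier B"
  "\<one>\<^bsub>G\<^esub> = (\<one>\<^bsub>A\<^esub>, \<one>\<^bsub>B\<^esub>)"
  "(a', b') \<otimes>\<^bsub>G\<^esub> (a, b) = (a' \<otimes>\<^bsub>A\<^esub> act b' a, b' \<otimes>\<^bsub>B\<^esub> b)"
  by (simp_all add: semidirect_def)

lemma group_G: "group G"
proof (rule groupI)
  fix x assume "x \<in> carrier G"
  then obtain a b where "x = (a, b)" "a \<in> carrier A" "b \<in> carrier B" by auto
  then show "\<exists>y\<in>carrier G. y \<otimes>\<^bsub>G\<^esub> x = \<one>\<^bsub>G\<^esub>"
    by (intro bexI[of _ "(inv\<^bsub>A\<^esub> (act (inv\<^bsub>B\<^esub> b) a), inv\<^bsub>B\<^esub> b)"]) auto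
qed (auto simp: A.m_assoc B.m_assoc)

sublocale G: group G by (rule group_G)

lemma H_simps [simp]:
  "Ob H = carrier B" "Ar H = carrier A \<times> carrier B" "Dom H = snd"
  "Cod H (a, b) = d a \<otimes>\<^bsub>B\<^esub> b" "Idn H b = (\<one>\<^bsub>A\<^esub>, b)" "Comp H (a', b') (a, b) = (a' \<otimes>\<^bsub>A\<^esub> a, b)"
  by (simp_all add: H_cat_def)

lemma is_category_H: "is_category H"
  unfolding is_category_def by (auto simp: A.m_assoc B.m_assoc)

lemma Dom_hom: "Dom H \<in> hom G B"
  by (rule homI) auto

text \<open>This is equivariance of \<open>d\<close>: \<open>d (act b' a)\<close> is the conjugate
  of \<open>d a\<close> by \<open>b'\<close>, and its trailing inverse cancels against the
  \<open>b'\<close> of the second component.\<close>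

lemma Cod_hom: "Cod H \<in> hom G B"
  by (rule homI) (auto simp: B.m_assoc)

lemma Idn_hom: "Idn H \<in> hom B G"
  by (rule homI) auto

text \<open>This is the Peiffer identity \<open>act_d\<close>. The source of \<open>f'\<close> is
  \<open>d a \<otimes> b\<close>, so it acts on the first component of \<open>k'\<close> by
  \<open>b\<close> followed by conjugation with \<open>a\<close>; the inverse of \<open>a\<close> so
  produced cancels against the \<open>a\<close> of \<open>f\<close>.\<close>

lemma H_interchange:
  assumes "f \<in> carrier G" "f' \<in> carrier G" "k \<in> carrier G" "k' \<in> carrier G"
    and "Cod H f = Dom H f'" "Cod H k = Dom H k'"
  shows "Comp H (f' \<otimes>\<^bsub>G\<^esub> k') (f \<otimes>\<^bsub>G\<^esub> k) = Comp H f' f \<otimes>\<^bsub>G\<^esub> Comp H k' k"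
proof -
  obtain a b a' p q p' where *: "f = (a, b)" "f' = (a', d a \<otimes>\<^bsub>B\<^esub> b)" "k = (p, q)" "k' = (p', d p \<otimes>\<^bsub>B\<^esub> q)"
    using assms(5,6) by (cases f, cases f', cases k, cases k') auto
  then have "a \<in> carrier A" "b \<in> carrier B" "a' \<in> carrier A" "p \<in> carrier A" "q \<in> carrier B" "p' \<in> carrier A"
    using assms by auto
  then show ?thesis by (simp add: * A.m_assoc)
qed

text \<open>In this group of composable pairs the interchange law says that composition is a
  homomorphism to \<open>G\<close>. Inverses and surface words are then compatible with composition
  by general facts on homomorphisms.\<close>

definition H_pairs :: "(('a \<times> 'b) \<times> ('a \<times> 'b)) monoid" where
  "H_pairs = (G \<times>\<times> G)\<lparr>carrier := {(f', f). f' \<in> carrier G \<and> f \<in> carrier G \<and> Cod H f = Dom H f'}\<rparr>"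

lemma group_H_pairs: "group H_pairs"
  unfolding H_pairs_def
proof (rule subgroup.subgroup_is_group)
  interpret dom: group_hom G B "Dom H"
    using Dom_hom by (simp add: group_hom_def group_hom_axioms_def group_G B.is_group)
  interpret cod: group_hom G B "Cod H"
    using Cod_hom by (simp add: group_hom_def group_hom_axioms_def group_G B.is_group)
  note [simp del] = G_simps H_simps
  show GG: "group (G \<times>\<times> G)" by (rule DirProd_group[OF group_G group_G])
  let ?P = "{(f', f). f' \<in> carrier G \<and> f \<in> carrier G \<and> Cod H f = Dom H f'}"
  show "subgroup ?P (G \<times>\<times> G)"
  proof (rule group.subgroupI[OF GG])
    show "?P \<subseteq> carrier (G \<times>\<times> G)" by auto
    have "(\<one>\<^bsub>G\<^esub>, \<one>\<^bsub>G\<^esub>) \<in> ?P" by simp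
    then show "?P \<noteq> {}" by blast
  next
    fix p assume "p \<in> ?P"
    then obtain f' f where "p = (f', f)" "f' \<in> carrier G" "f \<in> carrier G" "Cod H f = Dom H f'" by blast
    then show "inv\<^bsub>G \<times>\<times> G\<^esub> p \<in> ?P" by (simp add: inv_DirProd[OF group_G group_G])
    fix q assume "q \<in> ?P"
    then obtain k' k where "q = (k', k)" "k' \<in> carrier G" "k \<in> carrier G" "Cod H k = Dom H k'" by blast
    with \<open>p = _\<close> \<open>f' \<in> _\<close> \<open>f \<in> _\<close> \<open>Cod H f = _\<close> show "p \<otimes>\<^bsub>G \<times>\<times> G\<^esub> q \<in> ?P" by simp
  qed
qed

lemma H_pairs_simps:
  "carrier H_pairs = {(f', f). f' \<in> carrier G \<and> f \<in> carrier G \<and> Cod H f = Dom H f'}"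
  "(f', f) \<otimes>\<^bsub>H_pairs\<^esub> (k', k) = (f' \<otimes>\<^bsub>G\<^esub> k', f \<otimes>\<^bsub>G\<^esub> k)"
  by (simp_all add: H_pairs_def del: G_simps)

lemma Comp_hom: "(\<lambda>(f', f). Comp H f' f) \<in> hom H_pairs G"
  and H_pairs_fst_hom: "fst \<in> hom H_pairs G" and H_pairs_snd_hom: "snd \<in> hom H_pairs G"
proof -
  show "(\<lambda>(f', f). Comp H f' f) \<in> hom H_pairs G"
    by (rule homI) (auto simp: H_pairs_simps H_interchange simp del: H_simps(4) G_simps(3) intro: cat_comp)
qed (rule homI; auto simp: H_pairs_simps simp del: G_simps)+

text \<open>The inverses are those of the group \<open>G\<close>, not inverse arrows, so the order
  of composition stays the same. The homomorphism out of \<open>H_pairs\<close> preserves inverses,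
  and these are taken componentwise.\<close>

lemma H_comp_inv:
  assumes "f \<in> carrier G" "f' \<in> carrier G" "Cod H f = Dom H f'"
  shows "Comp H (inv\<^bsub>G\<^esub> f') (inv\<^bsub>G\<^esub> f) = inv\<^bsub>G\<^esub> (Comp H f' f)"
proof -
  interpret c: group_hom H_pairs G "\<lambda>(f', f). Comp H f' f"
    using Comp_hom by (simp add: group_hom_def group_hom_axioms_def group_G group_H_pairs)
  interpret p: group_hom H_pairs G fst
    using H_pairs_fst_hom by (simp add: group_hom_def group_hom_axioms_def group_G group_H_pairs)
  interpret q: group_hom H_pairs G snd
    using H_pairs_snd_hom by (simp add: group_hom_def group_hom_axioms_def group_G group_H_pairs)
  have in_pairs: "(f', f) \<in> carrier H_pairs" using assms by (simp add: H_pairs_simps del: G_simps)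
  have "inv\<^bsub>H_pairs\<^esub> (f', f) = (inv\<^bsub>G\<^esub> f', inv\<^bsub>G\<^esub> f)"
    using p.hom_inv[OF in_pairs] q.hom_inv[OF in_pairs] by (metis fst_conv snd_conv prod.collapse)
  with c.hom_inv[OF in_pairs] show ?thesis by simp
qed

text \<open>The word is evaluated once in \<open>H_pairs\<close>; the two projections and
  composition, all homomorphisms to \<open>G\<close>, give the three surface words.\<close>

lemma H_comp_surface_word:
  assumes "f \<in> sgens g \<rightarrow> carrier G" "f' \<in> sgens g \<rightarrow> carrier G"
    and "\<And>i. i \<in> sgens g \<Longrightarrow> Cod H (f i) = Dom H (f' i)"
  shows "Comp H (surface_word G g f') (surface_word G g f) = surface_word G g (\<lambda>i. Comp H (f' i) (f i))"
proof -
  have p: "(\<lambda>i. (f' i, f i)) \<in> sgens g \<rightarrow> carrier H_pairs"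
    using assms by (auto simp: H_pairs_simps Pi_iff simp del: G_simps)
  let ?w = "surface_word H_pairs g (\<lambda>i. (f' i, f i))"
  have "?w = (surface_word G g f', surface_word G g f)"
    using surface_word_hom[OF group_H_pairs group_G H_pairs_fst_hom p]
      surface_word_hom[OF group_H_pairs group_G H_pairs_snd_hom p] by (simp add: prod_eq_iff)
  with surface_word_hom[OF group_H_pairs group_G Comp_hom p] show ?thesis by simp
qed

end

section \<open>The groupoid of homomorphisms\<close>

lemma Homs_comp:
  assumes "\<tau> \<in> Homs K L" "h \<in> hom L L'" "group K"
  shows "(\<lambda>k\<in>carrier K. h (\<tau> k)) \<in> Homs K L'"
proof -
  have "(\<lambda>k. h (\<tau> k)) \<in> hom K L'"
    using hom_compose[OF Homs_hom[OF assms(1)] assms(2)] by (simp add: o_def)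
  then show ?thesis by (rule Homs_restrict[OF _ assms(3)])
qed

context xmod
begin

lemma H_Ob: "Ob H = carrier B" and H_Ar: "Ar H = carrier G"
  by simp_all

lemma H_inverse:
  assumes "f \<in> carrier G"
  defines "f' \<equiv> (inv\<^bsub>A\<^esub> (fst f), d (fst f) \<otimes>\<^bsub>B\<^esub> snd f)"
  shows "f' \<in> carrier G" "Dom H f' = Cod H f" "Cod H f' = Dom H f"
    "Comp H f' f = Idn H (Dom H f)" "Comp H f f' = Idn H (Cod H f)"
  using assms by (cases f; simp)+

text \<open>Passing to inverse arrows respects the multiplication of \<open>G\<close>: a target
  \<open>d a' \<otimes> b'\<close> acts by \<open>b'\<close> and conjugation with \<open>a'\<close>,
  which exchanges the order of the two inverses in \<open>A\<close>. Hence the pointwise inverse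
  arrow of a homomorphism is a homomorphism, and \<open>hom_cat\<close> is a groupoid.\<close>

lemma H_inverse_hom: "(\<lambda>f. (inv\<^bsub>A\<^esub> (fst f), d (fst f) \<otimes>\<^bsub>B\<^esub> snd f)) \<in> hom G G"
  by (rule homI) (auto simp: A.m_assoc B.m_assoc A.inv_mult_group)

text \<open>Seen as a subcategory of a power of \<open>H\<close>, \<open>hom_cat\<close> inherits
  the category axioms; only closedness under the structure maps remains, and these are group
  homomorphisms.\<close>

lemma hom_cat_eq:
  "hom_cat K B A act d = (power_cat (carrier K) H)\<lparr>Ob := Homs K B, Ar := Homs K G\<rparr>"
  by (simp add: hom_cat_def power_cat_def H_cat_def case_prod_unfold)

lemma hom_cat_simps:
  "Ob (hom_cat K B A act d) = Homs K B"
  "Ar (hom_cat K B A act d) = Homs K G"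
  "Dom (hom_cat K B A act d) \<tau> = (\<lambda>k\<in>carrier K. Dom H (\<tau> k))"
  "Cod (hom_cat K B A act d) \<tau> = (\<lambda>k\<in>carrier K. Cod H (\<tau> k))"
  "Idn (hom_cat K B A act d) \<rho> = (\<lambda>k\<in>carrier K. Idn H (\<rho> k))"
  "Comp (hom_cat K B A act d) \<tau>' \<tau> = (\<lambda>k\<in>carrier K. Comp H (\<tau>' k) (\<tau> k))"
  unfolding hom_cat_eq by (simp_all add: power_cat_def)

lemma M_cat_simps:
  "Ob (M_cat B A d g) = sgens g \<rightarrow>\<^sub>E carrier B"
  "Ar (M_cat B A d g) = sgens g \<rightarrow>\<^sub>E carrier G"
  "Dom (M_cat B A d g) f = (\<lambda>i\<in>sgens g. Dom H (f i))"
  "Cod (M_cat B A d g) f = (\<lambda>i\<in>sgens g. Cod H (f i))"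
  "Idn (M_cat B A d g) x = (\<lambda>i\<in>sgens g. Idn H (x i))"
  "Comp (M_cat B A d g) f' f = (\<lambda>i\<in>sgens g. Comp H (f' i) (f i))"
  by (simp_all add: M_cat_def power_cat_def)

lemma is_category_M: "is_category (M_cat B A d g)"
  unfolding M_cat_def by (rule is_category_power_cat[OF is_category_H])

lemma restrict_eqD: "(\<lambda>i\<in>S. h i) = (\<lambda>i\<in>S. k i) \<Longrightarrow> i \<in> S \<Longrightarrow> h i = k i"
  by (metis restrict_apply')

lemma Comp_Homs:
  assumes K: "group K" and \<tau>: "\<tau> \<in> Homs K G" "\<tau>' \<in> Homs K G"
    and c: "\<And>k. k \<in> carrier K \<Longrightarrow> Cod H (\<tau> k) = Dom H (\<tau>' k)"
  shows "(\<lambda>k\<in>carrier K. Comp H (\<tau>' k) (\<tau> k)) \<in> Homs K G"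
proof (rule HomsI)
  interpret K: group K by fact
  note [simp del] = G_simps H_simps
  fix x assume x: "x \<in> carrier K"
  then show "(\<lambda>k\<in>carrier K. Comp H (\<tau>' k) (\<tau> k)) x \<in> carrier G"
    using cat_comp[OF is_category_H] c \<tau> by (simp add: H_Ar Homs_closed)
  fix y assume "y \<in> carrier K"
  with x c \<tau> show "(\<lambda>k\<in>carrier K. Comp H (\<tau>' k) (\<tau> k)) (x \<otimes>\<^bsub>K\<^esub> y) =
      (\<lambda>k\<in>carrier K. Comp H (\<tau>' k) (\<tau> k)) x \<otimes>\<^bsub>G\<^esub> (\<lambda>k\<in>carrier K. Comp H (\<tau>' k) (\<tau> k)) y"
    by (simp add: Homs_mult H_interchange Homs_closed)
qed simp

lemma is_category_hom_cat:
  assumes K: "group K"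
  shows "is_category (hom_cat K B A act d)"
  unfolding hom_cat_eq
proof (rule is_category_subcat[OF is_category_power_cat[OF is_category_H]])
  note [simp del] = G_simps H_simps
  show "Homs K B \<subseteq> Ob (power_cat (carrier K) H)" "Homs K G \<subseteq> Ar (power_cat (carrier K) H)"
    by (auto simp: power_cat_def Homs_def hom_def H_Ob H_Ar PiE_def)
  show "Dom (power_cat (carrier K) H) f \<in> Homs K B" "Cod (power_cat (carrier K) H) f \<in> Homs K B"
    if "f \<in> Homs K G" for f
    using Homs_comp[OF that Dom_hom K] Homs_comp[OF that Cod_hom K] by (simp_all add: power_cat_def)
  show "Idn (power_cat (carrier K) H) x \<in> Homs K G" if "x \<in> Homs K B" for x
    using Homs_comp[OF that Idn_hom K] by (simp add: power_cat_def)
  show "Comp (power_cat (carrier K) H) f' f \<in> Homs K G"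
    if "f \<in> Homs K G" "f' \<in> Homs K G" "Cod (power_cat (carrier K) H) f = Dom (power_cat (carrier K) H) f'" for f f'
    using Comp_Homs[OF K that(1,2)] that(3) by (auto simp: power_cat_def dest: restrict_eqD)
qed

lemma is_groupoid_hom_cat:
  assumes K: "group K"
  shows "is_groupoid (hom_cat K B A act d)"
  unfolding is_groupoid_def
proof (intro conjI ballI is_category_hom_cat[OF K])
  note [simp del] = G_simps H_simps
  fix f assume "f \<in> Ar (hom_cat K B A act d)"
  then have f: "f \<in> Homs K G" by (simp add: hom_cat_simps)
  let ?f = "\<lambda>k\<in>carrier K. (inv\<^bsub>A\<^esub> (fst (f k)), d (fst (f k)) \<otimes>\<^bsub>B\<^esub> snd (f k))"
  have "?f \<in> Homs K G" by (rule Homs_comp[OF f H_inverse_hom K])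
  then show "\<exists>f'\<in>Ar (hom_cat K B A act d).
      Dom (hom_cat K B A act d) f' = Cod (hom_cat K B A act d) f \<and>
      Cod (hom_cat K B A act d) f' = Dom (hom_cat K B A act d) f \<and>
      Comp (hom_cat K B A act d) f' f = Idn (hom_cat K B A act d) (Dom (hom_cat K B A act d) f) \<and>
      Comp (hom_cat K B A act d) f f' = Idn (hom_cat K B A act d) (Cod (hom_cat K B A act d) f)"
    by (intro bexI[of _ ?f])
      (auto simp: hom_cat_simps H_inverse Homs_closed[OF f] intro!: restrict_ext)
qed

section \<open>The functors on \<open>M\<close> and the coinvariants\<close>

definition gens_functor :: "('i \<Rightarrow> 'k) \<Rightarrow> 'i set \<Rightarrow> ('k \<Rightarrow> 'b, 'k \<Rightarrow> 'a \<times> 'b, 'i \<Rightarrow> 'b, 'i \<Rightarrow> 'a \<times> 'b) cfunctor" where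
  "gens_functor e S = \<lparr>on_ob = on_gens e S, on_ar = on_gens e S\<rparr>"

lemma gens_functor_simps [simp]:
  "on_ob (gens_functor e S) = on_gens e S" "on_ar (gens_functor e S) = on_gens e S"
  by (simp_all add: gens_functor_def)

lemma is_functor_gens_functor:
  assumes K: "group K" and e: "e \<in> sgens g \<rightarrow> carrier K"
  shows "is_functor (hom_cat K B A act d) (M_cat B A d g) (gens_functor e (sgens g))"
  using is_category_hom_cat[OF K] is_category_M
proof (rule is_functorI)
  note [simp del] = G_simps H_simps
  have e': "e i \<in> carrier K" if "i \<in> sgens g" for i using e that by auto
  show "on_ob (gens_functor e (sgens g)) x \<in> Ob (M_cat B A d g)" if "x \<in> Ob (hom_cat K B A act d)" for x
    using that by (auto simp: hom_cat_simps M_cat_simps on_gens_def e' Homs_closed)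
  show "on_ar (gens_functor e (sgens g)) f \<in> Ar (M_cat B A d g)" if "f \<in> Ar (hom_cat K B A act d)" for f
    using that by (auto simp: hom_cat_simps M_cat_simps on_gens_def e' Homs_closed)
qed (use e in \<open>auto simp: hom_cat_simps M_cat_simps on_gens_def Pi_iff intro!: restrict_ext simp del: H_simps\<close>)

text \<open>The interchange law is applied twice, once for each multiplication in a conjugate, and
  \<open>H_comp_inv\<close> treats the inverse.\<close>

lemma conj_fun_Comp:
  assumes h: "h \<in> carrier G" "h' \<in> carrier G" "Cod H h = Dom H h'"
    and x: "x \<in> S \<rightarrow> carrier G" "x' \<in> S \<rightarrow> carrier G" "\<And>i. i \<in> S \<Longrightarrow> Cod H (x i) = Dom H (x' i)"
  shows "(\<lambda>i\<in>S. Comp H (conj_fun G S h' x' i) (conj_fun G S h x i)) =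
    conj_fun G S (Comp H h' h) (\<lambda>i\<in>S. Comp H (x' i) (x i))"
  unfolding conj_fun_def
proof (rule restrict_ext)
  interpret dom: group_hom G B "Dom H"
    using Dom_hom by (simp add: group_hom_def group_hom_axioms_def group_G B.is_group)
  interpret cod: group_hom G B "Cod H"
    using Cod_hom by (simp add: group_hom_def group_hom_axioms_def group_G B.is_group)
  note [simp del] = G_simps H_simps
  fix i assume i: "i \<in> S"
  then have "x i \<in> carrier G" "x' i \<in> carrier G" using x by auto
  with h x i show "Comp H ((\<lambda>i\<in>S. h' \<otimes>\<^bsub>G\<^esub> x' i \<otimes>\<^bsub>G\<^esub> inv\<^bsub>G\<^esub> h') i) ((\<lambda>i\<in>S. h \<otimes>\<^bsub>G\<^esub> x i \<otimes>\<^bsub>G\<^esub> inv\<^bsub>G\<^esub> h) i) =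
      Comp H h' h \<otimes>\<^bsub>G\<^esub> (\<lambda>i\<in>S. Comp H (x' i) (x i)) i \<otimes>\<^bsub>G\<^esub> inv\<^bsub>G\<^esub> Comp H h' h"
    by (simp add: H_interchange H_comp_inv)
qed

lemma act_functor_simps [simp]:
  "on_ob (act_functor B A act g) (b, x) = conj_fun B (sgens g) b x"
  "on_ar (act_functor B A act g) (h, f) = conj_fun G (sgens g) h f"
  by (simp_all add: act_functor_def)

text \<open>Conjugation commutes with the group homomorphisms \<open>Dom H\<close>,
  \<open>Cod H\<close> and \<open>Idn H\<close>, and with composition by
  \<open>conj_fun_Comp\<close>.\<close>

lemma is_functor_act_functor:
  "is_functor (prod_cat H (M_cat B A d g)) (M_cat B A d g) (act_functor B A act g)"
  using is_category_prod_cat[OF is_category_H is_category_M] is_category_M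
proof (rule is_functorI)
  note [simp del] = G_simps H_simps
  note simps = prod_cat_def act_functor_def M_cat_simps H_Ob H_Ar
  show "on_ob (act_functor B A act g) p \<in> Ob (M_cat B A d g)" if "p \<in> Ob (prod_cat H (M_cat B A d g))" for p
    using that conj_fun_closed[OF B.is_group, of "fst p" "snd p" "sgens g"] by (auto simp: simps PiE_def)
  show "on_ar (act_functor B A act g) p \<in> Ar (M_cat B A d g)" if "p \<in> Ar (prod_cat H (M_cat B A d g))" for p
    using that conj_fun_closed[OF group_G, of "fst p" "snd p" "sgens g"]
    by (simp add: simps case_prod_unfold mem_Times_iff PiE_def)
  show "Dom (M_cat B A d g) (on_ar (act_functor B A act g) p) =
      on_ob (act_functor B A act g) (Dom (prod_cat H (M_cat B A d g)) p)"
    if "p \<in> Ar (prod_cat H (M_cat B A d g))" for p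
    using that conj_fun_hom[OF group_G B.is_group Dom_hom, of "fst p" "snd p" "sgens g"]
    by (simp add: simps case_prod_unfold mem_Times_iff PiE_def)
  show "Cod (M_cat B A d g) (on_ar (act_functor B A act g) p) =
      on_ob (act_functor B A act g) (Cod (prod_cat H (M_cat B A d g)) p)"
    if "p \<in> Ar (prod_cat H (M_cat B A d g))" for p
    using that conj_fun_hom[OF group_G B.is_group Cod_hom, of "fst p" "snd p" "sgens g"]
    by (simp add: simps case_prod_unfold mem_Times_iff PiE_def)
  show "on_ar (act_functor B A act g) (Idn (prod_cat H (M_cat B A d g)) p) =
      Idn (M_cat B A d g) (on_ob (act_functor B A act g) p)"
    if "p \<in> Ob (prod_cat H (M_cat B A d g))" for p
    using that conj_fun_hom[OF B.is_group group_G Idn_hom, of "fst p" "snd p" "sgens g"]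
    by (simp add: simps case_prod_unfold mem_Times_iff PiE_def)
  fix p p'
  assume p: "p \<in> Ar (prod_cat H (M_cat B A d g))" "p' \<in> Ar (prod_cat H (M_cat B A d g))"
    and c: "Cod (prod_cat H (M_cat B A d g)) p = Dom (prod_cat H (M_cat B A d g)) p'"
  have "Cod H (fst p) = Dom H (fst p')"
    and eq: "(\<lambda>i\<in>sgens g. Cod H (snd p i)) = (\<lambda>i\<in>sgens g. Dom H (snd p' i))"
    using c by (simp_all add: simps map_prod_def case_prod_unfold)
  with p restrict_eqD[OF eq] show "on_ar (act_functor B A act g) (Comp (prod_cat H (M_cat B A d g)) p' p) =
      Comp (M_cat B A d g) (on_ar (act_functor B A act g) p') (on_ar (act_functor B A act g) p)"
    using conj_fun_Comp[of "fst p" "fst p'" "snd p" "sgens g" "snd p'"]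
    by (simp add: simps case_prod_unfold mem_Times_iff PiE_def)
qed

lemma cat_action_M: "cat_action H (M_cat B A d g) (act_functor B A act g) B G"
  by unfold_locales
    (auto simp: is_category_H is_functor_act_functor B.is_group group_G M_cat_simps
      conj_fun_one[OF B.is_group] conj_fun_one[OF group_G]
      intro!: conj_fun_mult[OF B.is_group] conj_fun_mult[OF group_G] simp del: G_simps
      simp add: H_Ar simp del: H_simps(2))

lemma is_functor_coact_functor:
  "is_functor (M_cat B A d g) (prod_cat H (M_cat B A d g)) (coact_functor B A act g)"
  using is_category_M is_category_prod_cat[OF is_category_H is_category_M]
proof (rule is_functorI)
  note [simp del] = G_simps H_simps
  note simps = prod_cat_def coact_functor_def M_cat_simps H_Ob H_Ar
  \<comment> \<open>Sources, targets, identities and composites in a power are restricted functions;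
    the surface word only reads them on \<open>sgens g\<close>.\<close>
  have word_restrict: "surface_word L g (\<lambda>i\<in>sgens g. x i) = surface_word L g x" for L :: "'z monoid" and x
    by (rule surface_word_cong) simp
  show "on_ob (coact_functor B A act g) x \<in> Ob (prod_cat H (M_cat B A d g))" if "x \<in> Ob (M_cat B A d g)" for x
    using that by (simp add: simps PiE_def surface_word_closed[OF B.is_group])
  show "on_ar (coact_functor B A act g) f \<in> Ar (prod_cat H (M_cat B A d g))" if "f \<in> Ar (M_cat B A d g)" for f
    using that by (simp add: simps PiE_def surface_word_closed[OF group_G])
  show "Dom (prod_cat H (M_cat B A d g)) (on_ar (coact_functor B A act g) f) =
      on_ob (coact_functor B A act g) (Dom (M_cat B A d g) f)" if "f \<in> Ar (M_cat B A d g)" for f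
    using that surface_word_hom[OF group_G B.is_group Dom_hom, of f g]
    by (simp add: simps PiE_def word_restrict)
  show "Cod (prod_cat H (M_cat B A d g)) (on_ar (coact_functor B A act g) f) =
      on_ob (coact_functor B A act g) (Cod (M_cat B A d g) f)" if "f \<in> Ar (M_cat B A d g)" for f
    using that surface_word_hom[OF group_G B.is_group Cod_hom, of f g]
    by (simp add: simps PiE_def word_restrict)
  show "on_ar (coact_functor B A act g) (Idn (M_cat B A d g) x) =
      Idn (prod_cat H (M_cat B A d g)) (on_ob (coact_functor B A act g) x)" if "x \<in> Ob (M_cat B A d g)" for x
    using that surface_word_hom[OF B.is_group group_G Idn_hom, of x g]
    by (simp add: simps PiE_def word_restrict)
  fix f f' assume f: "f \<in> Ar (M_cat B A d g)" "f' \<in> Ar (M_cat B A d g)"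
    "Cod (M_cat B A d g) f = Dom (M_cat B A d g) f'"
  then have "\<And>i. i \<in> sgens g \<Longrightarrow> Cod H (f i) = Dom H (f' i)"
    by (auto simp: M_cat_simps dest: restrict_eqD)
  with f show "on_ar (coact_functor B A act g) (Comp (M_cat B A d g) f' f) =
      Comp (prod_cat H (M_cat B A d g)) (on_ar (coact_functor B A act g) f') (on_ar (coact_functor B A act g) f)"
    by (simp add: simps PiE_def word_restrict H_comp_surface_word)
qed

lemma is_functor_unit_functor:
  "is_functor (M_cat B A d g) (prod_cat H (M_cat B A d g)) (unit_functor B A d)"
  using is_category_M is_category_prod_cat[OF is_category_H is_category_M]
  by (rule is_functorI) (simp_all add: unit_functor_def prod_cat_def cat_simps[OF is_category_M])

lemma coinv_incl_eq: "coinv_incl g = gens_functor (pi1_gen g) (sgens g)"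
  by (simp add: coinv_incl_def gens_functor_def on_gens_def fun_eq_iff)

lemma is_functor_coinv_incl:
  "is_functor (hom_cat (pi1 g) B A act d) (M_cat B A d g) (coinv_incl g)"
  unfolding coinv_incl_eq
  by (rule is_functor_gens_functor[OF group_pi1]) (simp add: pi1_gen_carrier)

text \<open>The two functors agree where the surface word is trivial, in \<open>B\<close> for
  objects and in \<open>G\<close> for arrows; the identity arrow of the unit of \<open>B\<close> is
  the unit of \<open>G\<close>. Thus \<open>pi1_universal\<close> for these two groups gives both
  bijections.\<close>

lemma is_equaliser_coinv:
  "is_equaliser TYPE('u) (M_cat B A d g) (prod_cat H (M_cat B A d g))
    (coact_functor B A act g) (unit_functor B A d) (coinv_cat B A act d g) (coinv_incl g)"
  unfolding coinv_cat_def
proof (rule is_equaliserI[OF is_functor_coact_functor is_functor_unit_functor is_functor_coinv_incl],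
    goal_cases)
  case 1
  show ?case
    using pi1_universal[OF B.is_group, of g]
    by (simp add: coinv_incl_eq hom_cat_simps M_cat_simps coact_functor_def unit_functor_def)
next
  case 2
  show ?case
    using pi1_universal[OF group_G, of g]
    by (simp add: coinv_incl_eq hom_cat_simps M_cat_simps coact_functor_def unit_functor_def)
qed

end

section \<open>The protected object as a quotient of the coinvariants\<close>

locale xmod_surface = xmod B A act d
  for B :: "'b monoid" and A :: "'a monoid" and act :: "'b \<Rightarrow> 'a \<Rightarrow> 'a" and d :: "'a \<Rightarrow> 'b" +
  fixes g :: nat
begin

abbreviation "M \<equiv> M_cat B A d g"
abbreviation "C \<equiv> hom_cat (pi1 g) B A act d"
abbreviation "\<iota> \<equiv> on_gens (pi1_gen g) (sgens g)"

sublocale M: cat_action H M "act_functor B A act g" B G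
  by (rule cat_action_M)

lemma orbit_ob_eq: "orbit_ob B A act d g = M.orb_ob"
  by (simp add: orbit_ob_def M.orb_ob_def)

lemma orbit_ar_eq: "orbit_ar B A act d g = M.orb_ar"
  by (simp add: orbit_ar_def M.orb_ar_def)

lemma inv_rel_eq: "inv_rel B A act d g = M.orb_rel"
  by (simp add: inv_rel_def M.orb_rel_def orbit_ar_eq)

lemma orb_ob_iff: "(x, y) \<in> M.orb_ob \<longleftrightarrow> x \<in> Ob M \<and> (\<exists>h\<in>carrier B. y = conj_fun B (sgens g) h x)"
  by (auto simp: M.orb_ob_def)

lemma orb_ar_iff: "(x, y) \<in> M.orb_ar \<longleftrightarrow> x \<in> Ar M \<and> (\<exists>h\<in>carrier G. y = conj_fun G (sgens g) h x)"
  by (auto simp: M.orb_ar_def)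

lemma pi1_gen_Pi: "pi1_gen g \<in> sgens g \<rightarrow> carrier (pi1 g)"
  by (simp add: pi1_gen_carrier)

lemma \<iota>_inj: "group L \<Longrightarrow> inj_on \<iota> (Homs (pi1 g) L)"
  by (rule bij_betw_imp_inj_on[OF pi1_universal])

lemma \<iota>_functor: "is_functor C M (gens_functor (pi1_gen g) (sgens g))"
  using is_functor_coinv_incl by (simp add: coinv_incl_eq)

lemmas \<iota>_simps = functor_ob[OF \<iota>_functor, simplified gens_functor_simps]
  functor_ar[OF \<iota>_functor, simplified gens_functor_simps]
  functor_dom[OF \<iota>_functor, simplified gens_functor_simps]
  functor_cod[OF \<iota>_functor, simplified gens_functor_simps]
  functor_idn[OF \<iota>_functor, simplified gens_functor_simps]
  functor_comp[OF \<iota>_functor, simplified gens_functor_simps]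

lemma cat_C: "is_category C"
  by (rule is_category_hom_cat[OF group_pi1])

lemma conjugacy_ob_iff:
  assumes "\<rho> \<in> Ob C" "\<rho>' \<in> Ob C"
  shows "(\<rho>, \<rho>') \<in> conjugacy (pi1 g) B \<longleftrightarrow> (\<iota> \<rho>, \<iota> \<rho>') \<in> M.orb_ob"
  using conjugacy_iff[OF group_pi1 B.is_group pi1_gen_Pi \<iota>_inj[OF B.is_group], of \<rho> \<rho>'] assms
  by (simp add: orb_ob_iff hom_cat_simps \<iota>_simps)

text \<open>Restriction to the generators is an isomorphism from \<open>hom_cat (F2g g) B A act d\<close> to \<open>M\<close>.\<close>

lemma prot_rel_iff:
  assumes \<tau>: "\<tau> \<in> Ar C" "\<tau>' \<in> Ar C"
  shows "(\<tau>, \<tau>') \<in> prot_rel B A act d g \<longleftrightarrow> (\<iota> \<tau>, \<iota> \<tau>') \<in> M.orb_rel"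
proof -
  let ?F = "hom_cat (F2g g) B A act d" and ?e = "free_gen (sgens g)"
  have e: "?e \<in> sgens g \<rightarrow> carrier (F2g g)" by (simp add: free_gen_F2g)
  have bij: "bij_betw (on_gens ?e (sgens g)) (Ar ?F) (Ar M)"
    using F2g_universal[OF group_G, of g] by (simp add: hom_cat_simps M_cat_simps)
  have F: "is_functor ?F M (gens_functor ?e (sgens g))"
    by (rule is_functor_gens_functor[OF group_F2g e])
  have conj_iff: "(f, f') \<in> conjugacy (F2g g) G \<longleftrightarrow> (on_gens ?e (sgens g) f, on_gens ?e (sgens g) f') \<in> M.orb_ar"
    if "f \<in> Ar ?F" "f' \<in> Ar ?F" for f f'
    using conjugacy_iff[OF group_F2g group_G e bij_betw_imp_inj_on[OF F2g_universal[OF group_G]], of f f'] that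
      functor_ar[OF F that(1)]
    by (simp add: orb_ar_iff hom_cat_simps)
  have "(f, f') \<in> comp_pairs ?F (conjugacy (F2g g) G) \<longleftrightarrow>
      (on_gens ?e (sgens g) f, on_gens ?e (sgens g) f') \<in> comp_pairs M M.orb_ar"
    if "f \<in> Ar ?F" "f' \<in> Ar ?F" for f f'
    using comp_pairs_iso_iff[OF F _ _ _ that, of "conjugacy (F2g g) G" M.orb_ar] conj_iff bij
      bij_betw_imp_inj_on[OF F2g_universal[OF B.is_group, of g]]
    by (simp add: hom_cat_simps)
  moreover have "comp_pairs ?F (conjugacy (F2g g) G) \<subseteq> Ar ?F \<times> Ar ?F"
    by (auto simp: comp_pairs_def cat_comp[OF is_category_hom_cat[OF group_F2g]])
  \<comment> \<open>The intermediate links of a chain are arbitrary homomorphisms on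
    \<open>F2g g\<close>, that is, arbitrary arrows of \<open>M\<close>, so the chains on the two
    sides correspond exactly.\<close>
  ultimately have "(inflate g \<tau>, inflate g \<tau>') \<in> gen_equiv (comp_pairs ?F (conjugacy (F2g g) G)) \<longleftrightarrow>
      (on_gens ?e (sgens g) (inflate g \<tau>), on_gens ?e (sgens g) (inflate g \<tau>')) \<in> M.orb_rel"
    unfolding M.orb_rel_def using \<tau>
    by (intro gen_equiv_bij_betw_iff[OF bij _ M.comp_pairs_closed])
      (simp_all add: hom_cat_simps inflate_Homs)
  with \<tau> show ?thesis by (simp add: prot_rel_def on_gens_inflate hom_cat_simps)
qed

lemma prot_rel_closed: "(\<tau>, \<tau>') \<in> prot_rel B A act d g \<Longrightarrow> \<tau> \<in> Ar C \<and> \<tau>' \<in> Ar C"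
  by (simp add: prot_rel_def hom_cat_simps)

lemma conjugacy_closed: "(\<rho>, \<rho>') \<in> conjugacy (pi1 g) B \<Longrightarrow> \<rho> \<in> Ob C \<and> \<rho>' \<in> Ob C"
  using equiv_conjugacy[OF group_pi1 B.is_group] by (auto simp: hom_cat_simps elim: equivE)

sublocale I: cat_congruence M M.orb_ob M.orb_rel
  by (rule M.cat_congruence_orb)

text \<open>All conditions but one are pulled back along \<iota> from the congruence on
  \<open>M\<close>. The exception is \<open>s_lift\<close>: a lift found in \<open>M\<close> need
  not satisfy the surface relation, so the lift is constructed among homomorphisms on
  \<open>pi1 g\<close>.\<close>

lemma cat_congruence_prot: "cat_congruence C (conjugacy (pi1 g) B) (prot_rel B A act d g)"
proof (rule cat_congruence.intro[OF cat_C])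
  note C_simps = cat_simps[OF cat_C]
  show equiv: "equiv (Ob C) (conjugacy (pi1 g) B)"
    unfolding hom_cat_simps by (rule equiv_conjugacy[OF group_pi1 B.is_group])
  fix f f' assume f: "(f, f') \<in> prot_rel B A act d g" "f \<in> Ar C"
  then have f': "f' \<in> Ar C" "(\<iota> f, \<iota> f') \<in> M.orb_rel" 
    using prot_rel_closed[OF f(1)] prot_rel_iff[of f f'] by simp_all
  then show "(Dom C f, Dom C f') \<in> conjugacy (pi1 g) B" "(Cod C f, Cod C f') \<in> conjugacy (pi1 g) B"
    using f M.orb_rel_dom_cod[OF f'(2)] by (simp_all add: conjugacy_ob_iff C_simps \<iota>_simps)
next
  note C_simps = cat_simps[OF cat_C]
  fix x x' assume "(x, x') \<in> conjugacy (pi1 g) B"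
  then show "(Idn C x, Idn C x') \<in> prot_rel B A act d g"
    using conjugacy_closed[of x x'] I.s_idn[of "\<iota> x" "\<iota> x'"]
    by (simp add: conjugacy_ob_iff prot_rel_iff C_simps \<iota>_simps)
next
  note C_simps = cat_simps[OF cat_C]
  fix h h' f f' assume *: "(h, h') \<in> prot_rel B A act d g" "(f, f') \<in> prot_rel B A act d g"
    "Cod C f = Dom C h" "Cod C f' = Dom C h'"
  then have ar: "f \<in> Ar C" "h \<in> Ar C" "f' \<in> Ar C" "h' \<in> Ar C" using prot_rel_closed by auto
  with * have "(Comp M (\<iota> h) (\<iota> f), Comp M (\<iota> h') (\<iota> f')) \<in> M.orb_rel"
    by (intro I.s_comp) (simp_all add: prot_rel_iff \<iota>_simps)
  with * ar show "(Comp C h f, Comp C h' f') \<in> prot_rel B A act d g"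
    by (simp add: prot_rel_iff \<iota>_simps C_simps)
next
  fix f h assume f: "f \<in> Ar C" "h \<in> Ar C" and c: "(Cod C f, Dom C h) \<in> conjugacy (pi1 g) B"
  note [simp del] = G_simps H_simps
  have h: "h \<in> Homs (pi1 g) G" using f by (simp add: hom_cat_simps)
  have "(Dom C h, Cod C f) \<in> conjugacy (pi1 g) B"
    using c equiv_conjugacy[OF group_pi1 B.is_group] by (meson equivE symD)
  then obtain b where b: "b \<in> carrier B" "Cod C f = conj_fun B (carrier (pi1 g)) b (Dom C h)"
    by (auto simp: conjugacy_def)
  then have Ib: "Idn H b \<in> carrier G" "Dom H (Idn H b) = b"
    using cat_idn[OF is_category_H] cat_dom_idn[OF is_category_H] by (simp_all add: H_Ob H_Ar)
  \<comment> \<open>Conjugating by the identity arrow of \<open>b\<close> gives a homomorphism on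
    the same group, and its source is the conjugate by \<open>b\<close> of the source of
    \<open>h\<close>.\<close>
  let ?h = "conj_fun G (carrier (pi1 g)) (Idn H b) h"
  have h': "?h \<in> Ar C"
    unfolding hom_cat_simps by (rule conj_fun_Homs[OF group_G Ib(1) h group_pi1])
  have "Dom C ?h = Cod C f"
    using conj_fun_hom[OF group_G B.is_group Dom_hom Ib(1), of h "carrier (pi1 g)"] h
    by (simp add: b(2) hom_cat_simps(3) Ib Homs_closed[OF h])
  moreover have "(\<iota> h, \<iota> ?h) \<in> M.orb_ar"
    unfolding on_gens_conj_fun[OF pi1_gen_Pi] orb_ar_iff using f Ib \<iota>_simps by blast
  then have "(h, ?h) \<in> prot_rel B A act d g"
    using f h' by (simp add: prot_rel_iff M.orb_ar_imp_orb_rel)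
  ultimately show "\<exists>h'. (h, h') \<in> prot_rel B A act d g \<and> Dom C h' = Cod C f" by blast
next
  fix f f' assume *: "(f, f') \<in> prot_rel B A act d g"
  then show "(f', f) \<in> prot_rel B A act d g"
    using prot_rel_closed[OF *] M.orb_rel_sym[of "\<iota> f" "\<iota> f'"] by (simp add: prot_rel_iff)
next
  fix f f' f''
  assume *: "(f, f') \<in> prot_rel B A act d g" "(f', f'') \<in> prot_rel B A act d g"
  then show "(f, f'') \<in> prot_rel B A act d g"
    using prot_rel_closed[OF *(1)] prot_rel_closed[OF *(2)]
      M.orb_rel_trans[of "\<iota> f" "\<iota> f'" "\<iota> f''"] by (simp add: prot_rel_iff)
next
  show "(f, f) \<in> prot_rel B A act d g" if "f \<in> Ar C" for f
    using that by (simp add: prot_rel_iff)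
qed (use prot_rel_closed in blast)

sublocale P: cat_congruence C "conjugacy (pi1 g) B" "prot_rel B A act d g"
  by (rule cat_congruence_prot)

lemma equiv_prot_rel: "equiv (Ar C) (prot_rel B A act d g)"
proof (rule equivI)
  show "prot_rel B A act d g \<subseteq> Ar C \<times> Ar C" using prot_rel_closed by auto
qed (use P.s_refl P.s_sym P.s_trans in \<open>blast intro: refl_onI symI transI\<close>)+

lemma is_functor_inv_proj: "is_functor M (inv_cat B A act d g) (inv_proj B A act d g)"
  unfolding inv_cat_def inv_proj_def orbit_ob_eq inv_rel_eq by (rule I.is_functor_quot_functor)

text \<open>Two homomorphisms have the same image in the invariants exactly if their tuples are
  related in \<open>M\<close>. By \<open>conjugacy_ob_iff\<close> and \<open>prot_rel_iff\<close>
  the two relations are therefore the kernel pair that \<open>is_image_quot\<close> asks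
  for.\<close>

lemma is_image_prot:
  assumes "infinite (UNIV :: 'u set)"
  shows "\<exists>I. is_image TYPE('u) C (inv_cat B A act d g)
    (func_comp (inv_proj B A act d g) (coinv_incl g)) (prot_cat B A act d g) I (prot_proj B A act d g)"
  unfolding prot_cat_def prot_proj_def
proof (rule P.is_image_quot[OF assms])
  show "is_functor C (inv_cat B A act d g) (func_comp (inv_proj B A act d g) (coinv_incl g))"
    by (rule is_functor_func_comp[OF is_functor_coinv_incl is_functor_inv_proj])
  fix x y assume "x \<in> Ob C" "y \<in> Ob C"
  then show "(x, y) \<in> conjugacy (pi1 g) B \<longleftrightarrow>
      on_ob (func_comp (inv_proj B A act d g) (coinv_incl g)) x =
      on_ob (func_comp (inv_proj B A act d g) (coinv_incl g)) y"
    by (simp add: inv_proj_def quot_functor_def coinv_incl_eq orbit_ob_eq conjugacy_ob_iff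
        I.r_class_eq_iff \<iota>_simps)
next
  fix f h assume "f \<in> Ar C" "h \<in> Ar C"
  then show "(f, h) \<in> prot_rel B A act d g \<longleftrightarrow>
      on_ar (func_comp (inv_proj B A act d g) (coinv_incl g)) f =
      on_ar (func_comp (inv_proj B A act d g) (coinv_incl g)) h"
    by (simp add: inv_proj_def quot_functor_def coinv_incl_eq inv_rel_eq prot_rel_iff
        I.s_class_eq_iff \<iota>_simps)
qed

end

text \<open>The three universal properties certify that the concrete models are the coinvariants,
  the invariants and the image; the remaining conjuncts describe this image. Infinitude of
  \<open>'u\<close> enters through \<open>is_mono_inj_on_ar\<close>.\<close>

theorem theorem7p19:
  fixes B :: "'b monoid" and A :: "'a monoid"
    and act :: "'b \<Rightarrow> 'a \<Rightarrow> 'a" and d :: "'a \<Rightarrow> 'b" and g :: nat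
  assumes "crossed_module B A act d"
    and "g \<ge> 1"
    and "infinite (UNIV :: 'u set)"
  shows
    "equiv (Homs (pi1 g) B) (conjugacy (pi1 g) B) \<and>
     equiv (Homs (pi1 g) (semidirect B A act)) (prot_rel B A act d g) \<and>
     is_groupoid (prot_cat B A act d g) \<and>
     Ob (prot_cat B A act d g) = Homs (pi1 g) B // conjugacy (pi1 g) B \<and>
     Ar (prot_cat B A act d g) = Homs (pi1 g) (semidirect B A act) // prot_rel B A act d g \<and>
     (\<forall>\<tau>\<in>Homs (pi1 g) (semidirect B A act).
        Dom (prot_cat B A act d g) (prot_rel B A act d g `` {\<tau>}) =
          conjugacy (pi1 g) B `` {\<lambda>k\<in>carrier (pi1 g). snd (\<tau> k)} \<and>
        Cod (prot_cat B A act d g) (prot_rel B A act d g `` {\<tau>}) =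
          conjugacy (pi1 g) B `` {\<lambda>k\<in>carrier (pi1 g). d (fst (\<tau> k)) \<otimes>\<^bsub>B\<^esub> snd (\<tau> k)}) \<and>
     is_equaliser TYPE('u)
       (M_cat B A d g) (prod_cat (H_cat B A d) (M_cat B A d g))
       (coact_functor B A act g) (unit_functor B A d)
       (coinv_cat B A act d g) (coinv_incl g) \<and>
     is_coequaliser TYPE('u)
       (prod_cat (H_cat B A d) (M_cat B A d g)) (M_cat B A d g)
       (act_functor B A act g) proj2
       (inv_cat B A act d g) (inv_proj B A act d g) \<and>
     (\<exists>I. is_image TYPE('u)
       (coinv_cat B A act d g) (inv_cat B A act d g)
       (func_comp (inv_proj B A act d g) (coinv_incl g))
       (prot_cat B A act d g) I (prot_proj B A act d g))"
proof -
  interpret xmod_surface B A act d g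
    using assms(1) by unfold_locales
  show ?thesis
  proof (intro conjI ballI)
    show "equiv (Homs (pi1 g) B) (conjugacy (pi1 g) B)"
      by (rule equiv_conjugacy[OF group_pi1 B.is_group])
    show "equiv (Homs (pi1 g) G) (prot_rel B A act d g)"
      using equiv_prot_rel by (simp only: hom_cat_simps)
    show "is_groupoid (prot_cat B A act d g)"
      unfolding prot_cat_def by (rule P.is_groupoid_quot[OF is_groupoid_hom_cat[OF group_pi1]])
    show "Ob (prot_cat B A act d g) = Homs (pi1 g) B // conjugacy (pi1 g) B"
      by (simp add: prot_cat_def P.quot_Ob hom_cat_simps)
    show "Ar (prot_cat B A act d g) = Homs (pi1 g) G // prot_rel B A act d g"
      by (simp add: prot_cat_def P.quot_Ar hom_cat_simps)
    fix \<tau> assume "\<tau> \<in> Homs (pi1 g) G"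
    then have \<tau>: "\<tau> \<in> Ar C" by (simp only: hom_cat_simps)
    show "Dom (prot_cat B A act d g) (prot_rel B A act d g `` {\<tau>}) =
          conjugacy (pi1 g) B `` {\<lambda>k\<in>carrier (pi1 g). snd (\<tau> k)}"
      unfolding prot_cat_def P.quot_Dom[OF \<tau>] by (simp add: hom_cat_def)
    show "Cod (prot_cat B A act d g) (prot_rel B A act d g `` {\<tau>}) =
          conjugacy (pi1 g) B `` {\<lambda>k\<in>carrier (pi1 g). d (fst (\<tau> k)) \<otimes>\<^bsub>B\<^esub> snd (\<tau> k)}"
      unfolding prot_cat_def P.quot_Cod[OF \<tau>] by (simp add: hom_cat_def)
  next
    show "is_equaliser TYPE('u) M (prod_cat H M) (coact_functor B A act g) (unit_functor B A d)
        (coinv_cat B A act d g) (coinv_incl g)"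
      by (rule is_equaliser_coinv)
    show "is_coequaliser TYPE('u) (prod_cat H M) M (act_functor B A act g) proj2
        (inv_cat B A act d g) (inv_proj B A act d g)"
      unfolding inv_cat_def inv_proj_def orbit_ob_eq inv_rel_eq by (rule M.is_coequaliser_orb)
    show "\<exists>I. is_image TYPE('u) (coinv_cat B A act d g) (inv_cat B A act d g)
        (func_comp (inv_proj B A act d g) (coinv_incl g)) (prot_cat B A act d g) I (prot_proj B A act d g)"
      unfolding coinv_cat_def by (rule is_image_prot[OF assms(3)])
  qed
qed

end
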